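(* Let $\kappa_1=\rho\|\mathcal A^\top\mathcal A\|$, $\kappa_2=\rho\|\mathcal B^\top\mathcal B\|$, $\kappa_3=\rho\|\mathcal A^\top\mathcal B\|$ (spectral norms), and suppose that $\mu,\beta,\tau,\sigma$ satisfy $$0<\sigma<\tfrac1{24},\qquad \beta>\frac{4\kappa_1}{1-24\sigma}\Big(4+3\sigma+\sqrt{24-168\sigma+9\sigma^2}\Big)>0,\qquad \mu>\kappa_2+\frac{16\kappa_3^2}{\sigma\beta}>0,$$ $$\max\Big\{\frac\beta2,\ \frac{\beta}{24\sigma}\Big(1-\frac{16\kappa_1}{\beta}-\sqrt{\varsigma}\Big)\Big\}<\tau<\frac{\beta}{24\sigma}\Big(1-\frac{16\kappa_1}{\beta}+\sqrt{\varsigma}\Big),$$ where $\varsigma=1-\frac{32\kappa_1}{\beta}-\frac{128\kappa_1^2}{\beta^2}-\frac{24\kappa_1\sigma}{\beta}-24\sigma>0$. Let $\{(\widetilde W_k,\widetilde P_k,z_k,u_k)\}_{k\ge0}$ be generated, from an initial point $(\widetilde W_0,\widetilde P_0,z_0,u_0)$, by the PALM iteration $$\begin{aligned} &\widetilde P_{k+1}\in\mathbf{prox}_{\mu^{-1}g}\big(\widetilde P_k-\mu^{-1}\nabla_{\widetilde P}H(\widetilde W_k,\widetilde P_k)\big),\\ &z_{k+1}\in\mathbf{prox}_{\beta^{-1}f}\big(\widetilde W_k+\beta^{-1}u_k\big),\\ &\widetilde W_{k+1}=\widetilde W_k-\tau^{-1}\big(\nabla_{\widetilde W}H(\widetilde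 W_k,\widetilde P_{k+1})+u_k+\beta(\widetilde W_k-z_{k+1})\big),\\ &u_{k+1}=u_k+\sigma\beta(\widetilde W_{k+1}-z_{k+1}). \end{aligned}$$ Then: (1) the sequence has finite length: $\sum_{k\ge0}\|\widetilde W_{k+1}-\widetilde W_k\|<\infty$, $\sum_{k\ge0}\|\widetilde P_{k+1}-\widetilde P_k\|<\infty$, $\sum_{k\ge0}\|z_{k+1}-z_k\|<\infty$, $\sum_{k\ge0}\|u_{k+1}-u_k\|<\infty$; (2) the sequence converges to a KKT point of the problem $\min_{\widetilde W,\widetilde P} f(\widetilde W)+g(\widetilde P)+H(\widetilde W,\widetilde P)$, i.e. $(\widetilde W_k,\widetilde P_k,z_k,u_k)\to(\widetilde W^*,\widetilde P^*,z^*,u^* )$ with $$0=u^*+\rho\mathcal A^\top(\mathcal A\widetilde W^*+\mathcal B\widetilde P^* ),\quad 0\in\partial g(\widetilde P^* )+\rho\mathcal B^\top(\mathcal A\widetilde W^*+\mathcal B\widetilde P^* ),\quad u^*\in\partial f(z^* ),\quad z^*=\widetilde W^*.$$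
   Context: Data. Let $m,n,l,q,M\ge 1$ be integers and $p=m+n$; let $m=\sum_{i=1}^s m_i$, $n=\sum_{j=1}^t n_j$ be partitions into positive integers. Let $A\in\mathbb R^{n\times n}$, $B_2\in\mathbb R^{n\times m}$, $B_1\in\mathbb R^{n\times l}$, $C\in\mathbb R^{q\times n}$, $D\in\mathbb R^{q\times m}$. Put $Q=\begin{bmatrix}B_1B_1^\top&0\\0&0\end{bmatrix}$, $R=\begin{bmatrix}C^\top C&0\\0&D^\top D\end{bmatrix}$ in $\mathbb S^p$ (symmetric $p\times p$ matrices), $F_i=\begin{bmatrix}A_i&B_{2,i}\\0&0\end{bmatrix}\in\mathbb R^{p\times p}$ ($i=1,\dots,M$) given, with $A_i\in\mathbb R^{n\times n}$, $B_{2,i}\in\mathbb R^{n\times m}$. Put $V_1=[0,I_m]\in\mathbb R^{m\times p}$, $V_2=[I_n,0]\in\mathbb R^{n\times p}$ and $\Upsilon_i(W)=-V_2(F_iW+WF_i^\top+Q)V_2^\top$. Standing assumptions. (1) $C^\top D=0$, $D^\top D\succ0$, $C^\top C\succ0$, $B_1B_1^\top\succ0$, $(A,B_2)$ is stabilizable, and $(A,C)$ has no unobservable modes on the imaginary axis. (2) $\begin{bmatrix}A&B_2\\0&0\end{bmatrix}$ is a convex combination of $F_1,\dots,F_M$. (3) There is $W\in\mathbb S^p$ with $W\succ0$ and $\Upsilon_i(W)\succ0$ for all $i$. (4) Every $W\in\mathbb S^p$ with $W\succeq0$ and $\Upsilon_i(W)\succeq0$ for all $i$ has positive definite upper-left $n\times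 n$ block. Functions. $\mathrm{vec}$ stacks columns; $\Gamma_+^k=\{\mathrm{vec}(S):S\in\mathbb S^k,\ S\succeq0\}$; $\delta_E$ is the indicator function ($0$ on $E$, $+\infty$ off $E$). For $\widetilde W\in\mathbb R^{p^2}$, $\widetilde P\in\mathbb R^{mn}$, with $W=\mathrm{vec}^{-1}(\widetilde W)\in\mathbb R^{p\times p}$, $$f(\widetilde W)=\langle\mathrm{vec}(R),\widetilde W\rangle+\delta_{\Gamma_+^p}(\widetilde W)+\sum_{i=1}^M\delta_{\Gamma_+^n}(\mathrm{vec}(\Upsilon_i(W))),\qquad g(\widetilde P)=\gamma\,\|\mathrm{vec}^{-1}(\widetilde P)\|_{s,t;0},$$ where $\gamma>0$ and $\|P\|_{s,t;0}$ is the number of nonzero blocks $P_{ij}\in\mathbb R^{m_i\times n_j}$ of $P=(P_{ij})_{i\le s,j\le t}\in\mathbb R^{m\times n}$. Coupling. Let $N=t(t-1)/2$ and let $(\xi(j),\kappa(j))$, $j=1,\dots,N$, enumerate lexicographically the pairs $(a,b)$ with $1\le a<b\le t$. For $a\le t$ let $E_a=[0_{n_a\times\sum_{r<a}n_r},\ I_{n_a},\ 0]\in\mathbb R^{n_a\times p}$, and put $V_{j1}=E_{\xi(j)}$, $V_{j2}=E_{\kappa(j)}^\top$. Let $\mathcal A$ be the matrix obtained by stacking vertically $V_{12}^\top\otimes V_{11},\dots,V_{N2}^\top\otimes V_{N1}$, $V_2\otimes V_1$, and let $\mathcal B$ be obtained by stacking vertically zero blocks (matching the first $N$ blocks of $\mathcal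 A$) and $-I_{mn}$. For $\rho>0$ set $H(\widetilde W,\widetilde P)=\frac\rho2\|\mathcal A\widetilde W+\mathcal B\widetilde P\|^2$. The proximal operator is the (set-valued) map $\mathbf{prox}_{\alpha h}(z)=\operatorname{argmin}_y\{h(y)+\frac1{2\alpha}\|y-z\|^2\}$ for $\alpha>0$. The symbol $\partial$ is the limiting (Mordukhovich) subdifferential: $\hat\partial\psi(x)=\{d:\liminf_{y\to x,\,y\neq x}\frac{\psi(y)-\psi(x)-\langle d,y-x\rangle}{\|y-x\|}\ge0\}$ for $x\in\mathrm{dom}\,\psi$, and $\partial\psi(x)$ is the set of $d$ for which there are $x_k\to x$, $d_k\to d$ with $\psi(x_k)\to\psi(x)$, $d_k\in\hat\partial\psi(x_k)$; both are empty off $\mathrm{dom}\,\psi$. *)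

theory Defs
  imports "HOL-Analysis.Analysis"
begin

section \<open>Block matrices, vectorization and Kronecker products\<close>

definition hcat :: "real^'a^'r \<Rightarrow> real^'b^'r \<Rightarrow> real^('a + 'b)^'r" where
  "hcat X Y = (\<chi> i k. case k of Inl a \<Rightarrow> X $ i $ a | Inr b \<Rightarrow> Y $ i $ b)"

definition vcat :: "real^'c^'a \<Rightarrow> real^'c^'b \<Rightarrow> real^'c^('a + 'b)" where
  "vcat X Y = (\<chi> k. case k of Inl a \<Rightarrow> X $ a | Inr b \<Rightarrow> Y $ b)"

definition vcat_family :: "('j::finite \<Rightarrow> real^'c^'r) \<Rightarrow> real^'c^('j \<times> 'r)" where
  "vcat_family X = (\<chi> k. X (fst k) $ snd k)"

definition four_block ::
    "real^'a^'r \<Rightarrow> real^'b^'r \<Rightarrow> real^'a^'s \<Rightarrow> real^'b^'s \<Rightarrow> real^('a + 'b)^('r + 's)" where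
  "four_block X Y Z U = vcat (hcat X Y) (hcat Z U)"

definition upper_left :: "real^('a + 'b::finite)^('a + 'b) \<Rightarrow> real^'a^'a" where
  "upper_left X = (\<chi> i j. X $ Inl i $ Inl j)"

text \<open>
  Column stacking: the entry in row \<open>r\<close> and column \<open>c\<close> is placed at the index \<open>(c, r)\<close>, so that
  the lexicographic order on indices is column-major order.
\<close>

definition vec_of :: "real^'c^'r \<Rightarrow> real^('c \<times> 'r)" where
  "vec_of X = (\<chi> k. X $ snd k $ fst k)"

definition unvec :: "real^('c \<times> 'r) \<Rightarrow> real^'c^'r" where
  "unvec x = (\<chi> r c. x $ (c, r))"

definition kron :: "real^'b^'a \<Rightarrow> real^'d^'c \<Rightarrow> real^('b \<times> 'd)^('a \<times> 'c)" where
  "kron X Y = (\<chi> i j. X $ fst i $ fst j * Y $ snd i $ snd j)"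

lemma unvec_vec_of [simp]: "unvec (vec_of X) = X"
  by (simp add: unvec_def vec_of_def vec_eq_iff)

lemma vec_of_unvec [simp]: "vec_of (unvec x) = x"
  by (simp add: unvec_def vec_of_def vec_eq_iff)

lemma kron_vec_of: "kron X Y *v vec_of W = vec_of (Y ** W ** transpose X)"
proof -
  have "(\<Sum>j\<in>UNIV. X $ a $ fst j * Y $ b $ snd j * W $ snd j $ fst j)
      = (\<Sum>c\<in>UNIV. (\<Sum>r\<in>UNIV. Y $ b $ r * W $ r $ c) * X $ a $ c)" for a b
  proof -
    have "(\<Sum>j\<in>UNIV. X $ a $ fst j * Y $ b $ snd j * W $ snd j $ fst j)
        = (\<Sum>(c, r)\<in>UNIV \<times> UNIV. X $ a $ c * Y $ b $ r * W $ r $ c)"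
      by (simp only: UNIV_Times_UNIV case_prod_unfold)
    also have "\<dots> = (\<Sum>c\<in>UNIV. \<Sum>r\<in>UNIV. X $ a $ c * Y $ b $ r * W $ r $ c)"
      by (rule sum.cartesian_product[symmetric])
    finally show ?thesis
      by (simp only: sum_distrib_left sum_distrib_right mult.commute mult.left_commute mult.assoc)
  qed
  then show ?thesis
    unfolding vec_eq_iff
    by (simp only: kron_def vec_of_def matrix_vector_mult_def matrix_matrix_mult_def
        transpose_def vec_lambda_beta split_paired_all fst_conv snd_conv simp_thms)
qed

definition spectral_norm :: "real^'c^'r \<Rightarrow> real" where
  "spectral_norm X = onorm (\<lambda>x. X *v x)"

definition psd :: "real^'a^'a \<Rightarrow> bool" where
  "psd X \<longleftrightarrow> transpose X = X \<and> (\<forall>x. 0 \<le> x \<bullet> (X *v x))"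

definition posdef :: "real^'a^'a \<Rightarrow> bool" where
  "posdef X \<longleftrightarrow> transpose X = X \<and> (\<forall>x. x \<noteq> 0 \<longrightarrow> 0 < x \<bullet> (X *v x))"

definition psd_vecs :: "(real^('a::finite \<times> 'a)) set" where
  "psd_vecs = {vec_of S | S :: real^'a^'a. psd S}"

section \<open>Linear systems\<close>

abbreviation cmat :: "real^'c^'r \<Rightarrow> complex^'c^'r" where
  "cmat \<equiv> map_matrix complex_of_real"

definition hurwitz :: "real^'a^'a \<Rightarrow> bool" where
  "hurwitz X \<longleftrightarrow> (\<forall>z x. x \<noteq> 0 \<and> cmat X *v x = z *s x \<longrightarrow> Re z < 0)"

definition stabilizable :: "real^'n^'n \<Rightarrow> real^'m^'n \<Rightarrow> bool" where
  "stabilizable A B \<longleftrightarrow> (\<exists>K :: real^'n^'m. hurwitz (A + B ** K))"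

definition unobservable_mode :: "real^'n^'n \<Rightarrow> real^'n^'q \<Rightarrow> complex \<Rightarrow> bool" where
  "unobservable_mode A C z \<longleftrightarrow> (\<exists>x. x \<noteq> 0 \<and> cmat A *v x = z *s x \<and> cmat C *v x = 0)"

section \<open>Variational analysis\<close>

definition indicator_fun :: "'a set \<Rightarrow> 'a \<Rightarrow> ereal" where
  "indicator_fun E x = (if x \<in> E then 0 else \<infinity>)"

definition prox :: "real \<Rightarrow> ('a::real_normed_vector \<Rightarrow> ereal) \<Rightarrow> 'a \<Rightarrow> 'a set" where
  "prox \<alpha> h z = {y. is_arg_min (\<lambda>y. h y + ereal (1 / (2 * \<alpha>) * (norm (y - z))\<^sup>2)) (\<lambda>_. True) y}"

definition frechet_subdiff :: "('a::euclidean_space \<Rightarrow> ereal) \<Rightarrow> 'a \<Rightarrow> 'a set" where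
  "frechet_subdiff \<psi> x = {d. \<psi> x < \<infinity> \<and>
     0 \<le> Liminf (at x) (\<lambda>y. (\<psi> y - \<psi> x - ereal (d \<bullet> (y - x))) / ereal (norm (y - x)))}"

definition limiting_subdiff :: "('a::euclidean_space \<Rightarrow> ereal) \<Rightarrow> 'a \<Rightarrow> 'a set" where
  "limiting_subdiff \<psi> x = {d. \<psi> x < \<infinity> \<and>
     (\<exists>X D. X \<longlonglongrightarrow> x \<and> D \<longlonglongrightarrow> d \<and> (\<lambda>k. \<psi> (X k)) \<longlonglongrightarrow> \<psi> x \<and>
       (\<forall>k. D k \<in> frechet_subdiff \<psi> (X k)))}"

definition gradient :: "('a::real_inner \<Rightarrow> real) \<Rightarrow> 'a \<Rightarrow> 'a" where
  "gradient f x = (THE D. GDERIV f x :> D)"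

lemma gradient_eq:
  assumes "GDERIV f x :> D"
  shows "gradient f x = D"
  unfolding gradient_def
proof (rule the_equality)
  fix D' assume "GDERIV f x :> D'"
  then have "(\<lambda>h. h \<bullet> D') = (\<lambda>h. h \<bullet> D)"
    using assms unfolding gderiv_def by (rule has_derivative_unique)
  then show "D' = D"
    by (simp add: fun_eq_iff vector_eq_ldot vector_eq_rdot)
qed (rule assms)

section \<open>Problem data\<close>

text \<open>
  A composition \<open>n = n\<^sub>1 + \<dots> + n\<^sub>t\<close> into positive parts is given by the map sending an index to
  the number of the block containing it. Monotonicity makes the blocks consecutive intervals in
  their natural order, and surjectivity makes them nonempty; \<open>n\<^sub>j = card (b -` {j})\<close>.
\<close>

definition block_partition :: "('a::linorder \<Rightarrow> 'b::linorder) \<Rightarrow> bool" where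
  "block_partition b \<longleftrightarrow> mono b \<and> surj b"

definition nonzero_blocks :: "('m \<Rightarrow> 's) \<Rightarrow> ('n \<Rightarrow> 't) \<Rightarrow> real^'n^'m \<Rightarrow> nat" where
  "nonzero_blocks rb cb P = card {(i, j). \<exists>a b. rb a = i \<and> cb b = j \<and> P $ a $ b \<noteq> 0}"

definition mat_V1 :: "real^('n::finite + 'm)^'m" where
  "mat_V1 = hcat 0 (mat 1)"

definition mat_V2 :: "real^('n + 'm::finite)^'n" where
  "mat_V2 = hcat (mat 1) 0"

definition mat_Q :: "real^'l^'n \<Rightarrow> real^('n + 'm::finite)^('n + 'm)" where
  "mat_Q B1 = four_block (B1 ** transpose B1) 0 0 0"

definition mat_R :: "real^'n^'q \<Rightarrow> real^'m^'q \<Rightarrow> real^('n + 'm)^('n + 'm)" where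
  "mat_R C D = four_block (transpose C ** C) 0 0 (transpose D ** D)"

definition mat_F :: "real^'n^'n \<Rightarrow> real^'m^'n \<Rightarrow> real^('n + 'm)^('n + 'm)" where
  "mat_F A B2 = four_block A B2 0 0"

definition Upsilon ::
    "real^('n + 'm::finite)^('n + 'm) \<Rightarrow> real^('n + 'm)^('n + 'm) \<Rightarrow> real^('n + 'm)^('n + 'm) \<Rightarrow> real^'n^'n" where
  "Upsilon Q F W = - (mat_V2 ** (F ** W + W ** transpose F + Q) ** transpose mat_V2)"

definition obj_f ::
    "real^('n::finite + 'm::finite)^('n + 'm) \<Rightarrow> real^('n + 'm)^('n + 'm) \<Rightarrow> ('i::finite \<Rightarrow> real^('n + 'm)^('n + 'm))
      \<Rightarrow> real^(('n + 'm) \<times> ('n + 'm)) \<Rightarrow> ereal" where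
  "obj_f R Q F w = ereal (vec_of R \<bullet> w) + indicator_fun psd_vecs w
     + (\<Sum>i\<in>UNIV. indicator_fun psd_vecs (vec_of (Upsilon Q (F i) (unvec w))))"

definition obj_g ::
    "real \<Rightarrow> ('m \<Rightarrow> 's) \<Rightarrow> ('n \<Rightarrow> 't) \<Rightarrow> real^('n::finite \<times> 'm::finite) \<Rightarrow> ereal" where
  "obj_g \<gamma> rb cb p = ereal (\<gamma> * real (nonzero_blocks rb cb (unvec p)))"

text \<open>
  The selector \<open>E\<^sub>a\<close> has one row for each index in block \<open>a\<close>. Since the number of these rows varies
  with \<open>a\<close>, the rows are indexed by all of \<open>'n\<close>, and the rows outside block \<open>a\<close> are zero. Likewise
  the blocks \<open>E\<^sub>b \<otimes> E\<^sub>a\<close>, \<open>a < b\<close>, of the coupling matrix are indexed by the pair \<open>(a, b)\<close> itself,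
  with zero blocks at the remaining pairs. Up to the added zero rows (which are also zero in
  \<open>coupling_B\<close>) this is the stacked matrix; the products \<open>\<A>\<^sup>T\<A>\<close>, \<open>\<A>\<^sup>T\<B>\<close>, \<open>\<B>\<^sup>T\<B>\<close> and the norm of
  \<open>\<A>w + \<B>p\<close> are unaffected by zero rows.
\<close>

definition block_sel :: "('n \<Rightarrow> 't) \<Rightarrow> 't \<Rightarrow> real^('n + 'm::finite)^'n" where
  "block_sel cb a = (\<chi> i k. if cb i = a \<and> k = Inl i then 1 else 0)"

definition coupling_A ::
    "('n \<Rightarrow> 't::{finite,linorder}) \<Rightarrow>
      real^(('n::finite + 'm::finite) \<times> ('n + 'm))^((('t \<times> 't) \<times> ('n \<times> 'n)) + ('n \<times> 'm))" where
  "coupling_A cb = vcat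
     (vcat_family (\<lambda>(a, b). if a < b then kron (block_sel cb b) (block_sel cb a) else 0))
     (kron mat_V2 mat_V1)"

definition coupling_B ::
    "real^('n::finite \<times> 'm::finite)^((('t::finite \<times> 't) \<times> ('n \<times> 'n)) + ('n \<times> 'm))" where
  "coupling_B = vcat 0 (- mat 1)"

definition coupling_H ::
    "real \<Rightarrow> real^'w^'r \<Rightarrow> real^'p^'r \<Rightarrow> real^'w \<Rightarrow> real^'p \<Rightarrow> real" where
  "coupling_H \<rho> \<A> \<B> w p = \<rho> / 2 * (norm (\<A> *v w + \<B> *v p))\<^sup>2"

end

theory Submission
  imports Defs
begin

text \<open>
  The augmented Lagrangian, regularized by squared increments, decreases by a multiple of the squared
  length of each step, and it is bounded below because the increments of \<open>\<parallel>u\<^sub>k\<parallel>\<^sup>2\<close> telescope. Hence the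
  steps tend to zero and the iterates are bounded. Since \<open>g\<close> counts nonzero blocks, its proximal map
  is a hard threshold: every nonzero block of an iterate has norm at least \<open>\<surd>(2\<gamma>/\<mu>)\<close>, so that the
  set of nonzero blocks is eventually constant. From then on the method minimizes a linear plus a
  quadratic function over a spectrahedron. For such convex problems the Kurdyka-Lojasiewicz
  inequality needs no semialgebraic geometry: it follows from Sturm's Hoelder error bound for linear
  matrix inequalities, proved by facial reduction. The usual telescoping argument then bounds the
  total length.
\<close>

section \<open>Error bounds for linear matrix inequalities\<close>

text \<open>Once the block pattern is frozen the remaining objective is convex, so every limit point
  is a global minimizer and the gap inequality holds on a whole ball instead of a neighbourhood of
  one point. Its constant depends on the radius, which is why the iterates must be bounded first.
  That is not automatic: the Lagrangian contains the indefinite term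
  \<open>u \<bullet> (w - z)\<close> with no bound on \<open>u\<close>. The way out is that
  \<open>u\<close> equals minus the gradient of the coupling term up to an error of the size of the
  steps. Exponents fit together as follows. A positive semidefinite form that is small at a vector
  is small there as an operator only up to a square root, so each facial reduction halves the
  Hoelder exponent. Passing from the objective gap to the linear data halves it once more, so
  \<open>\<theta> \<le> 1 / 2\<close>. This is exactly the range where
  \<open>1 / (1 - \<theta>) \<le> 2\<close>, so that the quadratic discrepancy between the Lyapunov
  function and the objective does no harm.\<close>

lemma linear_kernel_error_bound:
  fixes f :: "'a::euclidean_space \<Rightarrow> 'b::euclidean_space"
  assumes "linear f" and "subspace T"
  obtains C where "0 < C" "\<And>t. t \<in> T \<Longrightarrow> \<exists>s\<in>T. f s = 0 \<and> norm (t - s) \<le> C * norm (f t)"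
proof -
  define T0 where "T0 = {t \<in> T. f t = 0}"
  define T1 where "T1 = {t \<in> T. \<forall>s\<in>T0. orthogonal t s}"
  interpret f: linear f by fact
  have T0: "subspace T0"
    using assms(2) by (auto simp: T0_def subspace_def f.add f.scale)
  have T1: "subspace T1"
    using assms(2) by (auto simp: T1_def subspace_def orthogonal_def inner_add_left)
  have "\<forall>x\<in>T1. f x = 0 \<longrightarrow> x = 0"
    by (auto simp: T1_def T0_def orthogonal_def)
  then obtain e where e: "e > 0" "\<forall>x\<in>T1. e * norm x \<le> norm (f x)"
    using injective_imp_isometric[of T1 f] closed_subspace[OF T1] T1
      linear_conv_bounded_linear[of f] assms(1) by (auto simp: mult.commute)
  show ?thesis
  proof (rule that[of "1/e"])
    fix t assume t: "t \<in> T"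
    obtain y z where yz: "y \<in> span T0" "\<And>w. w \<in> span T0 \<Longrightarrow> orthogonal z w" "t = y + z"
      using orthogonal_subspace_decomp_exists[of T0 t] by blast
    have y: "y \<in> T0" using yz(1) T0 by (simp add: span_eq_iff[THEN iffD2])
    have z: "z \<in> T1"
      using y yz t T0 subspace_diff[OF assms(2), of t y]
      by (auto simp: T1_def T0_def span_base)
    have "f t = f z" using y yz by (simp add: f.add T0_def)
    then have "norm (t - y) \<le> 1/e * norm (f t)"
      using e z yz by (simp add: field_simps)
    then show "\<exists>s\<in>T. f s = 0 \<and> norm (t - s) \<le> 1/e * norm (f t)"
      using y by (auto simp: T0_def)
  qed (use e in simp)
qed

lemma psd_form_Cauchy_Schwarz:
  fixes Q :: "'g::real_inner \<Rightarrow> 'g"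
  assumes "linear Q" and sym: "\<And>v w. v \<bullet> Q w = Q v \<bullet> w" and psd: "\<And>v. 0 \<le> v \<bullet> Q v"
  shows "(a \<bullet> Q v)\<^sup>2 \<le> (a \<bullet> Q a) * (v \<bullet> Q v)"
proof -
  interpret Q: linear Q by fact
  have quad: "0 \<le> s\<^sup>2 * (a \<bullet> Q a) + 2 * s * t * (a \<bullet> Q v) + t\<^sup>2 * (v \<bullet> Q v)" for s t
  proof -
    have "v \<bullet> Q a = a \<bullet> Q v" using sym[of v a] by (simp add: inner_commute)
    then have "(s *\<^sub>R a + t *\<^sub>R v) \<bullet> Q (s *\<^sub>R a + t *\<^sub>R v)
      = s\<^sup>2 * (a \<bullet> Q a) + 2 * s * t * (a \<bullet> Q v) + t\<^sup>2 * (v \<bullet> Q v)"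
      by (simp add: Q.add Q.scale inner_simps power2_eq_square algebra_simps)
    then show ?thesis using psd by metis
  qed
  show ?thesis
  proof (cases "v \<bullet> Q v = 0")
    case True
    have "a \<bullet> Q v = 0"
    proof (rule ccontr)
      assume ne: "a \<bullet> Q v \<noteq> 0"
      \<comment> \<open>With \<open>v \<bullet> Q v = 0\<close> the quadratic is affine in its
        second coefficient, which is chosen to produce the value -1.\<close>
      have "0 \<le> (a \<bullet> Q a) + 2 * (-(1 + a \<bullet> Q a) / (2 * (a \<bullet> Q v))) * (a \<bullet> Q v)"
        using quad[of 1 "-(1 + a \<bullet> Q a) / (2 * (a \<bullet> Q v))"] True by simp
      also have "\<dots> = -1" using ne by (simp add: field_simps)
      finally show False by simp
    qed
    then show ?thesis using True by simp
  next
    case False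
    then have pos: "v \<bullet> Q v > 0" using psd[of v] by simp
    have "0 \<le> (v \<bullet> Q v) * ((a \<bullet> Q a) * (v \<bullet> Q v) - (a \<bullet> Q v)\<^sup>2)"
      using quad[of "v \<bullet> Q v" "- (a \<bullet> Q v)"] by (simp add: power2_eq_square algebra_simps)
    then show ?thesis using pos by (simp add: zero_le_mult_iff)
  qed
qed

text \<open>Cauchy-Schwarz with \<open>a = Q v\<close>, divided by the square of
  \<open>norm (Q v)\<close>. A vector on which the form is small is thus almost in the kernel, at
  the price of a square root.\<close>

lemma psd_form_norm_le:
  fixes Q :: "'g::real_inner \<Rightarrow> 'g"
  assumes "linear Q" and sym: "\<And>v w. v \<bullet> Q w = Q v \<bullet> w" and psd: "\<And>v. 0 \<le> v \<bullet> Q v"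
    and K: "\<And>v. norm (Q v) \<le> K * norm v"
  shows "(norm (Q v))\<^sup>2 \<le> K * (v \<bullet> Q v)"
proof (cases "Q v = 0")
  case True
  have "0 \<le> K \<or> v = 0" using K[of v] norm_ge_zero[of "Q v"]
    by (metis norm_le_zero_iff norm_zero mult_nonneg_nonneg zero_le_mult_iff order.trans)
  then show ?thesis using True by simp
next
  case False
  have "(norm (Q v))^2 * (norm (Q v))^2 = (Q v \<bullet> Q v)\<^sup>2"
    by (simp add: dot_square_norm power2_eq_square)
  also have "\<dots> \<le> (Q v \<bullet> Q (Q v)) * (v \<bullet> Q v)"
    by (rule psd_form_Cauchy_Schwarz[OF assms(1-3)])
  also have "\<dots> \<le> (norm (Q v) * (K * norm (Q v))) * (v \<bullet> Q v)"
    by (intro mult_right_mono psd order.trans[OF norm_cauchy_schwarz] mult_left_mono K) auto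
  also have "\<dots> = (norm (Q v))^2 * (K * (v \<bullet> Q v))" by (simp add: power2_eq_square)
  finally show ?thesis by (rule mult_left_le_imp_le) (use False in simp)
qed

text \<open>This extends functionals on a parameter subspace to the whole space, where they can be
  written in \<open>Basis\<close> coordinates.\<close>

lemma linear_projection_exists:
  fixes T :: "'e::euclidean_space set"
  assumes "subspace T"
  obtains \<pi> where "linear \<pi>" "\<And>x. \<pi> x \<in> T" "\<And>t. t \<in> T \<Longrightarrow> \<pi> t = t"
proof -
  obtain B where B: "B \<subseteq> T" "pairwise orthogonal B" "\<And>x. x \<in> B \<Longrightarrow> norm x = 1"
     "independent B" "card B = dim T" "span B = T"
    using orthonormal_basis_subspace[OF assms] by blast
  have fin: "finite B" using B(4) independent_imp_finite by blast
  show ?thesis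
  proof (rule that[of "\<lambda>x. \<Sum>b\<in>B. (x \<bullet> b) *\<^sub>R b"])
    show "linear (\<lambda>x. \<Sum>b\<in>B. (x \<bullet> b) *\<^sub>R b)"
      by (intro linear_compose_sum ballI linearI)
         (auto simp: inner_add_left algebra_simps)
    show "(\<Sum>b\<in>B. (x \<bullet> b) *\<^sub>R b) \<in> T" for x
      using B(1) by (intro subspace_sum[OF assms] subspace_scale[OF assms]) auto
    show "(\<Sum>b\<in>B. (t \<bullet> b) *\<^sub>R b) = t" if "t \<in> T" for t
      using orthonormal_basis_expand[of B t] B fin that by auto
  qed
qed

text \<open>
  If no form in the family is positive definite modulo \<open>N\<close>, separation produces a positive
  combination of rank-one functionals that annihilates the whole family.
\<close>

lemma facial_alternative:
  fixes M :: "'g::euclidean_space \<Rightarrow> 'g" and L :: "'e::euclidean_space \<Rightarrow> 'g \<Rightarrow> 'g"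
  assumes linM: "linear M" and psdM: "\<And>v. 0 \<le> v \<bullet> M v" and L: "bilinear L" and T: "subspace T"
    and S: "compact S"
  shows "(\<exists>t\<in>T. \<forall>v\<in>S. 0 < v \<bullet> (M v + L t v)) \<or>
    (\<exists>X l. finite X \<and> X \<subseteq> S \<and> (\<forall>x\<in>X. 0 \<le> l x) \<and> sum l X = (1::real) \<and>
        (\<forall>t\<in>T. (\<Sum>v\<in>X. l v * (v \<bullet> (M v + L t v))) = 0))"
proof -
  obtain \<pi> where \<pi>: "linear \<pi>" "\<And>x. \<pi> x \<in> T" "\<And>t. t \<in> T \<Longrightarrow> \<pi> t = t"
    using linear_projection_exists[OF T] by metis
  \<comment> \<open>Pairing \<open>\<Phi> v\<close> with \<open>(t, 1)\<close> evaluates the form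
    with parameter \<open>t\<close> at \<open>v\<close>, for \<open>t\<close> in \<open>T\<close>.
    The alternative is whether 0 lies in the convex hull of these points or can be separated from
    it.\<close>
  define \<Phi> where "\<Phi> v = ((\<Sum>b\<in>Basis. (v \<bullet> L (\<pi> b) v) *\<^sub>R b), v \<bullet> M v)" for v
  have linLv: "linear (\<lambda>t. L t v)" and linLt: "linear (L t)" for t v
    using L by (auto simp: bilinear_def)
  have fst\<Phi>: "t \<bullet> fst (\<Phi> v) = v \<bullet> L (\<pi> t) v" for t v
  proof -
    have lin: "linear (\<lambda>t. v \<bullet> L (\<pi> t) v)"
      using linear_compose[OF linear_compose[OF \<pi>(1) linLv[of v]], of "\<lambda>y. v \<bullet> y"]
      by (simp add: o_def bounded_linear.linear[OF bounded_linear_inner_right])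
    have "v \<bullet> L (\<pi> t) v = v \<bullet> L (\<pi> (\<Sum>b\<in>Basis. (t \<bullet> b) *\<^sub>R b)) v"
      by (simp add: euclidean_representation)
    also have "\<dots> = (\<Sum>b\<in>Basis. (t \<bullet> b) * (v \<bullet> L (\<pi> b) v))"
      by (subst linear_sum[OF lin]) (simp only: linear_scale[OF lin] real_scaleR_def)
    finally show ?thesis
      by (simp add: \<Phi>_def inner_sum_right mult.commute)
  qed
  have cont: "continuous_on S \<Phi>"
    unfolding \<Phi>_def
    by (intro continuous_intros linear_continuous_on[OF linear_conv_bounded_linear[THEN iffD1]] linM linLt)
  then have comp: "compact (convex hull (\<Phi> ` S))"
    by (intro compact_convex_hull compact_continuous_image S)
  show ?thesis
  proof (cases "0 \<in> convex hull (\<Phi> ` S)")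
    case False
    then obtain a b where ab: "a \<noteq> 0" "0 < b" "\<forall>x\<in>convex hull (\<Phi> ` S). b < a \<bullet> x"
      using separating_hyperplane_closed_0[of "convex hull (\<Phi> ` S)"] comp
      by (auto simp: compact_imp_closed)
    obtain t s where a: "a = (t, s)" by force
    \<comment> \<open>The second component of the separating normal may be small or negative.
      Raising it to at least 1 keeps the inequality because \<open>M\<close> is nonnegative, and
      makes division by it possible.\<close>
    define s' where "s' = max s 1"
    have "0 < v \<bullet> (M v + L (\<pi> ((1/s') *\<^sub>R t)) v)" if "v \<in> S" for v
    proof -
      have "\<Phi> v \<in> convex hull (\<Phi> ` S)" using that by (simp add: hull_inc)
      then have "0 < a \<bullet> \<Phi> v" using ab by force
      also have "\<dots> = v \<bullet> L (\<pi> t) v + s * (v \<bullet> M v)"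
        by (simp add: a inner_prod_def fst\<Phi>) (simp add: \<Phi>_def)
      also have "\<dots> \<le> v \<bullet> L (\<pi> t) v + s' * (v \<bullet> M v)"
        using psdM[of v] by (simp add: s'_def mult_right_mono)
      also have "\<dots> = s' * (v \<bullet> (M v + L (\<pi> ((1/s') *\<^sub>R t)) v))"
        using linear_scale[OF \<pi>(1)] linear_scale[OF linLv]
        by (simp add: s'_def inner_add_right algebra_simps)
      finally show ?thesis by (simp add: s'_def zero_less_mult_iff)
    qed
    then show ?thesis using \<pi>(2) by blast
  next
    case True
    then obtain Y l where Y: "finite Y" "Y \<subseteq> \<Phi> ` S" "\<forall>x\<in>Y. 0 \<le> l x" "sum l Y = (1::real)"
       "(\<Sum>y\<in>Y. l y *\<^sub>R y) = 0"
      unfolding convex_hull_explicit by auto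
    define h where "h = inv_into S \<Phi>"
    have h: "h y \<in> S" "\<Phi> (h y) = y" if "y \<in> Y" for y
      using that Y(2) by (auto simp: h_def inv_into_into f_inv_into_f)
    have inj: "inj_on h Y" using h by (metis inj_onI)
    have "(\<Sum>v\<in>h ` Y. l (\<Phi> v) * (v \<bullet> (M v + L t v))) = 0" if "t \<in> T" for t
    proof -
      have "(\<Sum>v\<in>h ` Y. l (\<Phi> v) * (v \<bullet> (M v + L t v)))
          = (\<Sum>y\<in>Y. l y * ((t, 1) \<bullet> y))"
        unfolding sum.reindex[OF inj] o_def
      proof (rule sum.cong[OF refl])
        fix y assume y: "y \<in> Y"
        have "(t, 1) \<bullet> \<Phi> (h y) = h y \<bullet> (M (h y) + L t (h y))"
          using fst\<Phi>[of t "h y"] \<pi>(3)[OF that]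
          by (simp add: inner_prod_def inner_add_right) (simp add: \<Phi>_def)
        then show "l (\<Phi> (h y)) * (h y \<bullet> (M (h y) + L t (h y))) = l y * ((t, 1) \<bullet> y)"
          using h[OF y] by simp
      qed
      also have "\<dots> = (t, 1) \<bullet> (\<Sum>y\<in>Y. l y *\<^sub>R y)" by (simp add: inner_sum_right)
      finally show ?thesis by (simp only: Y(5) inner_zero_right)
    qed
    moreover have "sum (\<lambda>v. l (\<Phi> v)) (h ` Y) = 1"
      unfolding sum.reindex[OF inj] o_def using Y(4) h by simp
    ultimately show ?thesis
      using Y h by (intro disjI2 exI[of _ "h ` Y"] exI[of _ "\<lambda>v. l (\<Phi> v)"]) auto
  qed
qed

text \<open>
  Induction on the codimension of a common kernel \<open>N\<close>. If Slater's condition holds modulo \<open>N\<close>, moving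
  towards a Slater point gives a linear bound. Otherwise some unit vector orthogonal to \<open>N\<close> lies in the
  kernel of every feasible form; forcing it into the kernel costs a square root and enlarges \<open>N\<close>.
\<close>

lemma lmi_error_bound_aux:
  fixes M :: "'g::euclidean_space \<Rightarrow> 'g" and L :: "'e::euclidean_space \<Rightarrow> 'g \<Rightarrow> 'g"
  assumes linM: "linear M" and symM: "\<And>v w. v \<bullet> M w = M v \<bullet> w" and psdM: "\<And>v. 0 \<le> v \<bullet> M v"
    and L: "bilinear L"
  shows "subspace T \<Longrightarrow> subspace N \<Longrightarrow> DIM('g) - dim N = n \<Longrightarrow>
    (\<And>t v w. t \<in> T \<Longrightarrow> v \<bullet> L t w = L t v \<bullet> w) \<Longrightarrow>
    (\<And>v. v \<in> N \<Longrightarrow> M v = 0) \<Longrightarrow> (\<And>t v. t \<in> T \<Longrightarrow> v \<in> N \<Longrightarrow> L t v = 0) \<Longrightarrow>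
    \<exists>C \<theta>. 0 \<le> C \<and> 0 < \<theta> \<and> \<theta> \<le> (1::real) \<and> (\<forall>t\<in>T. \<forall>\<epsilon>\<ge>0. norm t \<le> r \<longrightarrow>
      (\<forall>v. - \<epsilon> * (norm v)\<^sup>2 \<le> v \<bullet> (M v + L t v)) \<longrightarrow>
      (\<exists>s\<in>T. (\<forall>v. 0 \<le> v \<bullet> (M v + L s v)) \<and> norm (t - s) \<le> C * \<epsilon> powr \<theta>))"
proof (induction n arbitrary: T N r rule: less_induct)
  case (less n)
  note T = less.prems(1) and N = less.prems(2) and symL = less.prems(4)
    and MN = less.prems(5) and LN = less.prems(6)
  interpret M: linear M by fact
  have linLv: "linear (\<lambda>t. L t v)" and linLt: "linear (L t)" for t v
    using L by (auto simp: bilinear_def)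
  note L_simps = linear_add[OF linLv] linear_diff[OF linLv] linear_scale[OF linLv]
    linear_add[OF linLt] linear_diff[OF linLt] linear_scale[OF linLt]
  \<comment> \<open>All forms of the family vanish on \<open>N\<close>, so it is enough to test unit
    vectors orthogonal to \<open>N\<close>, and these form a compact set.\<close>
  define P where "P = {v. \<forall>n\<in>N. orthogonal v n} \<inter> sphere 0 1"
  have P: "compact P"
    unfolding P_def using closed_subspace[OF subspace_orthogonal_to_vectors]
    by (intro closed_Int_compact) (auto simp: orthogonal_commute)
  obtain KL where KL: "0 < KL" "\<And>t v. norm (L t v) \<le> KL * norm t * norm v"
    using bilinear_bounded_pos[OF L] by blast
  obtain KM where KM: "0 < KM" "\<And>v. norm (M v) \<le> KM * norm v"
    using linear_bounded_pos[OF linM] by blast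
  consider (slater) t0 where "t0 \<in> T" "\<forall>v\<in>P. 0 < v \<bullet> (M v + L t0 v)"
    | (face) X l where "finite X" "X \<subseteq> P" "\<forall>x\<in>X. 0 \<le> l x" "sum l X = (1::real)"
        "\<forall>t\<in>T. (\<Sum>v\<in>X. l v * (v \<bullet> (M v + L t v))) = 0"
    using facial_alternative[OF linM psdM L T P] by blast
  then show ?case
  proof cases
    case slater
    have "\<exists>\<delta>>0. \<forall>v\<in>P. \<delta> \<le> v \<bullet> (M v + L t0 v)"
    proof (cases "P = {}")
      case False
      have "continuous_on P (\<lambda>v. v \<bullet> (M v + L t0 v))"
        by (intro continuous_intros linear_continuous_on[OF linear_conv_bounded_linear[THEN iffD1]] linM linLt)
      from continuous_attains_inf[OF P False this] show ?thesis
        using slater(2) by blast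
    qed (auto intro: exI[of _ 1])
    then obtain \<delta> where \<delta>: "\<delta> > 0" "\<And>v. v \<in> P \<Longrightarrow> \<delta> \<le> v \<bullet> (M v + L t0 v)" by blast
    have decomp: "\<exists>v'. (\<forall>n\<in>N. orthogonal v' n) \<and>
        (\<forall>t\<in>T. v \<bullet> (M v + L t v) = v' \<bullet> (M v' + L t v'))" for v
    proof -
      obtain y z where yz: "y \<in> span N" "\<And>w. w \<in> span N \<Longrightarrow> orthogonal z w" "v = y + z"
        using orthogonal_subspace_decomp_exists[of N v] by blast
      have y: "y \<in> N" using yz(1) N by (simp add: span_eq_iff[THEN iffD2])
      have "v \<bullet> (M v + L t v) = z \<bullet> (M z + L t z)" if "t \<in> T" for t
      proof -
        have "M v = M z" "L t v = L t z" using MN[OF y] LN[OF that y] yz(3)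
          by (simp_all add: M.add L_simps)
        moreover have "y \<bullet> (M z + L t z) = 0"
          using MN[OF y] LN[OF that y] symM[of y z] symL[OF that, of y z] by (simp add: inner_add_right)
        ultimately show ?thesis using yz(3) by (simp add: inner_add_left)
      qed
      then show ?thesis using yz(2) by (intro exI[of _ z]) (simp add: span_base)
    qed
    have lower: "\<delta> * (norm v)\<^sup>2 \<le> v \<bullet> (M v + L t0 v)" if "\<forall>n\<in>N. orthogonal v n" for v
    proof (cases "v = 0")
      case False
      let ?e = "(1 / norm v) *\<^sub>R v"
      have "?e \<in> P" using that False by (auto simp: P_def orthogonal_def)
      from \<delta>(2)[OF this] have "\<delta> \<le> (1 / norm v)\<^sup>2 * (v \<bullet> (M v + L t0 v))"
        by (simp add: M.scale L_simps inner_simps power2_eq_square algebra_simps)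
      then show ?thesis using False by (simp add: field_simps)
    qed (simp add: M.zero)
    have "\<exists>s\<in>T. (\<forall>v. 0 \<le> v \<bullet> (M v + L s v)) \<and> norm (t - s) \<le> ((\<bar>r\<bar> + norm t0) / \<delta>) * \<epsilon> powr 1"
      if t: "t \<in> T" "norm t \<le> r" and \<epsilon>: "0 \<le> \<epsilon>" "\<And>v. - \<epsilon> * (norm v)\<^sup>2 \<le> v \<bullet> (M v + L t v)" for t \<epsilon>
    proof -
      \<comment> \<open>The weight solves \<open>(1 - c) * \<epsilon> = c * \<delta>\<close>: the
        violation at \<open>t\<close> is balanced exactly by the margin at the Slater point
        \<open>t0\<close>.\<close>
      define c where "c = \<epsilon> / (\<epsilon> + \<delta>)"
      have c: "0 \<le> c" "c \<le> 1" "1 - c = \<delta> / (\<epsilon> + \<delta>)" "c \<le> \<epsilon> / \<delta>"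
        using \<epsilon>(1) \<delta>(1) by (auto simp: c_def field_simps)
      define s where "s = (1 - c) *\<^sub>R t + c *\<^sub>R t0"
      have s: "s \<in> T" unfolding s_def by (intro subspace_add subspace_scale T t slater)
      have "0 \<le> v \<bullet> (M v + L s v)" for v
      proof -
        obtain v' where v': "\<forall>n\<in>N. orthogonal v' n"
          "\<And>t. t \<in> T \<Longrightarrow> v \<bullet> (M v + L t v) = v' \<bullet> (M v' + L t v')"
          using decomp by blast
        have "0 = (1 - c) * (- \<epsilon> * (norm v')\<^sup>2) + c * (\<delta> * (norm v')\<^sup>2)"
          unfolding c(3) unfolding c_def by simp
        also have "\<dots> \<le> (1 - c) * (v' \<bullet> (M v' + L t v')) + c * (v' \<bullet> (M v' + L t0 v'))"
          using c lower[OF v'(1)] by (intro add_mono mult_left_mono \<epsilon>) auto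
        also have "\<dots> = v' \<bullet> (M v' + L s v')"
          by (simp add: s_def L_simps inner_simps algebra_simps)
        finally show ?thesis using v'(2)[OF s] by simp
      qed
      moreover have "norm (t - s) \<le> ((\<bar>r\<bar> + norm t0) / \<delta>) * \<epsilon> powr 1"
      proof -
        have "t - s = c *\<^sub>R (t - t0)" by (simp add: s_def algebra_simps)
        then have "norm (t - s) = c * norm (t - t0)" using c by simp
        also have "\<dots> \<le> (\<epsilon> / \<delta>) * (\<bar>r\<bar> + norm t0)"
          using c t norm_triangle_ineq4[of t t0] \<epsilon> \<delta> by (intro mult_mono) auto
        finally show ?thesis using \<epsilon> by (simp add: mult.commute)
      qed
      ultimately show ?thesis using s by blast
    qed
    then show ?thesis using \<delta>(1)
      by (intro exI[of _ "(\<bar>r\<bar> + norm t0) / \<delta>"] exI[of _ 1]) auto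
  next
    case face
    obtain v0 where v0: "v0 \<in> X" "0 < l v0"
      using face(3,4) by (metis less_eq_real_def sum.neutral zero_neq_one)
    have v0P: "norm v0 = 1" "\<And>n. n \<in> N \<Longrightarrow> orthogonal v0 n" using v0 face(2) by (auto simp: P_def)
    \<comment> \<open>The weighted sum over \<open>X\<close> vanishes and the terms other than
      \<open>v0\<close> total at least \<open>- \<epsilon>\<close>, so the term at \<open>v0\<close>
      is at most \<open>\<epsilon>\<close>.\<close>
    have key: "l v0 * (v0 \<bullet> (M v0 + L t v0)) \<le> \<epsilon>"
      if "t \<in> T" "0 \<le> \<epsilon>" "\<And>v. - \<epsilon> * (norm v)\<^sup>2 \<le> v \<bullet> (M v + L t v)" for t \<epsilon>
    proof -
      have "- \<epsilon> \<le> (\<Sum>v\<in>X - {v0}. l v * (- \<epsilon>))"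
      proof -
        have "sum l (X - {v0}) \<le> 1" using face(1,4) v0 by (simp add: sum_diff1)
        from mult_right_mono[OF this that(2)] show ?thesis
          by (simp add: sum_distrib_right[symmetric] sum_negf)
      qed
      also have "\<dots> \<le> (\<Sum>v\<in>X - {v0}. l v * (v \<bullet> (M v + L t v)))"
        using face(2,3) by (intro sum_mono mult_left_mono order.trans[OF _ that(3)]) (auto simp: P_def)
      also have "\<dots> = - (l v0 * (v0 \<bullet> (M v0 + L t v0)))"
        using face(5) that(1) sum.remove[OF face(1) v0(1), of "\<lambda>v. l v * (v \<bullet> (M v + L t v))"] by force
      finally show ?thesis by simp
    qed
    have L0: "L 0 v = 0" for v using linear_0[OF linLv] .
    \<comment> \<open>The parameter \<open>t = 0\<close> is admissible with
      \<open>\<epsilon> = 0\<close>, since \<open>M\<close> itself is positive semidefinite.\<close>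
    have Mv0: "M v0 = 0"
    proof -
      have "l v0 * (v0 \<bullet> M v0) \<le> 0"
        using key[of 0 0] psdM subspace_0[OF T] by (simp add: L0)
      then have "v0 \<bullet> M v0 \<le> 0" using v0 by (simp add: mult_le_0_iff)
      then have "v0 \<bullet> M v0 = 0" using psdM[of v0] by simp
      then show ?thesis using psd_form_norm_le[OF linM symM psdM KM(2), of v0] by simp
    qed
    define T' where "T' = {t \<in> T. L t v0 = 0}"
    define N' where "N' = span (insert v0 N)"
    have T': "subspace T'" using T by (auto simp: T'_def subspace_def L_simps L0)
    have "span (insert v0 N) \<subseteq> {v. M v = 0 \<and> (\<forall>t\<in>T'. L t v = 0)}"
    proof (rule span_minimal)
      show "insert v0 N \<subseteq> {v. M v = 0 \<and> (\<forall>t\<in>T'. L t v = 0)}"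
        using MN LN Mv0 by (auto simp: T'_def)
      show "subspace {v. M v = 0 \<and> (\<forall>t\<in>T'. L t v = 0)}"
        by (auto simp: subspace_def M.zero M.add M.scale L_simps linear_0[OF linLt])
    qed
    then have zero: "M v = 0" "\<And>t. t \<in> T' \<Longrightarrow> L t v = 0" if "v \<in> N'" for v
      using that by (auto simp: N'_def)
    have "v0 \<notin> span N"
      unfolding span_eq_iff[THEN iffD2, OF N]
      using v0P(2)[of v0] v0P(1) by (auto simp: orthogonal_def)
    then have "dim N' = dim N + 1" by (simp add: N'_def dim_span dim_insert)
    moreover have "dim N' \<le> DIM('g)" by (rule dim_subset_UNIV)
    ultimately have dim: "DIM('g) - dim N' < n" using less.prems(3) by linarith
    obtain h where h: "0 < h" "\<And>t. t \<in> T \<Longrightarrow> \<exists>s\<in>T. L s v0 = 0 \<and> norm (t - s) \<le> h * norm (L t v0)"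
      using linear_kernel_error_bound[OF linLv[of v0] T] by blast
    \<comment> \<open>For \<open>\<epsilon> \<le> 1\<close>, \<open>K\<close> bounds the operator
      norm of the form shifted by \<open>\<epsilon>\<close> times the identity. Up to the factor
      \<open>sqrt \<epsilon>\<close>, \<open>c1\<close> bounds \<open>L t v0\<close>,
      \<open>c2\<close> the distance from \<open>t\<close> to \<open>T'\<close>, and
      \<open>c3\<close> the violation at the nearby point of \<open>T'\<close>. Hence the radius
      \<open>\<bar>r\<bar> + c2\<close> in the induction hypothesis.\<close>
    define K where "K = KM + KL * \<bar>r\<bar> + 1"
    define c1 where "c1 = sqrt (K * (1 / l v0 + 1)) + 1"
    define c2 where "c2 = h * c1"
    define c3 where "c3 = 1 + KL * c2"
    have K: "0 < K" using KM KL by (simp add: K_def add_pos_nonneg)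
    have c1: "1 \<le> c1" using K v0(2) by (simp add: c1_def)
    have c2: "0 \<le> c2" using c1 h(1) by (simp add: c2_def)
    have c3: "0 \<le> c3" using c2 KL(1) by (simp add: c3_def)
    have symL': "v \<bullet> L t w = L t v \<bullet> w" if "t \<in> T'" for t v w
      using that symL by (auto simp: T'_def)
    obtain C \<theta> where C: "0 \<le> C" "0 < \<theta>" "\<theta> \<le> 1"
      and IH: "\<And>t \<epsilon>. t \<in> T' \<Longrightarrow> \<epsilon> \<ge> 0 \<Longrightarrow> norm t \<le> \<bar>r\<bar> + c2 \<Longrightarrow>
      (\<And>v. - \<epsilon> * (norm v)\<^sup>2 \<le> v \<bullet> (M v + L t v)) \<Longrightarrow>
      (\<exists>s\<in>T'. (\<forall>v. 0 \<le> v \<bullet> (M v + L s v)) \<and> norm (t - s) \<le> C * \<epsilon> powr \<theta>)"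
      using less.IH[OF dim T' subspace_span[of "insert v0 N", folded N'_def] refl symL' zero, of "\<bar>r\<bar> + c2"] by blast
    define C' where "C' = c2 + C * c3 powr \<theta> + \<bar>r\<bar>"
    have C'le: "c2 + C * c3 powr \<theta> \<le> C'" "\<bar>r\<bar> \<le> C'" "0 \<le> C'" using c2 C by (simp_all add: C'_def)
    have "\<exists>s\<in>T. (\<forall>v. 0 \<le> v \<bullet> (M v + L s v)) \<and> norm (t - s) \<le> C' * \<epsilon> powr (\<theta> / 2)"
      if t: "t \<in> T" "norm t \<le> r" and \<epsilon>: "0 \<le> \<epsilon>" "\<And>v. - \<epsilon> * (norm v)\<^sup>2 \<le> v \<bullet> (M v + L t v)" for t \<epsilon>
    proof (cases "\<epsilon> \<le> 1")
      case False
      \<comment> \<open>For large \<open>\<epsilon>\<close> the feasible point 0 is close enough;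
        the summand \<open>\<bar>r\<bar>\<close> of \<open>C'\<close> serves this case.\<close>
      have "norm (t - 0) \<le> C' * 1" using t C'le by simp
      also have "\<dots> \<le> C' * \<epsilon> powr (\<theta> / 2)" using False C C'le by (intro mult_left_mono ge_one_powr_ge_zero) auto
      finally show ?thesis using psdM subspace_0[OF T] by (intro bexI[of _ 0]) (auto simp: L0)
    next
      case True
      \<comment> \<open>The shift by \<open>\<epsilon>\<close> times the identity makes the form
        positive semidefinite, so that \<open>psd_form_norm_le\<close> applies to it at
        \<open>v0\<close>.\<close>
      define Q where "Q v = M v + L t v + \<epsilon> *\<^sub>R v" for v
      have linQ: "linear Q" unfolding Q_def
        by (intro linear_compose_add linM linLt linear_scale_self) 
      have symQ: "v \<bullet> Q w = Q v \<bullet> w" for v w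
        using symM[of v w] symL[OF t(1), of v w] by (simp add: Q_def inner_simps)
      have psdQ: "0 \<le> v \<bullet> Q v" for v
        using \<epsilon>(2)[of v] by (simp add: Q_def inner_simps power2_norm_eq_inner)
      have KQ: "norm (Q v) \<le> K * norm v" for v
      proof -
        have "norm (Q v) \<le> norm (M v) + norm (L t v) + norm (\<epsilon> *\<^sub>R v)"
          unfolding Q_def by (meson add_mono norm_triangle_ineq norm_triangle_le order_refl)
        also have "\<dots> \<le> KM * norm v + KL * \<bar>r\<bar> * norm v + 1 * norm v"
        proof (intro add_mono KM)
          show "norm (L t v) \<le> KL * \<bar>r\<bar> * norm v"
            using KL(1) t by (intro order.trans[OF KL(2)] mult_right_mono mult_left_mono) auto
          show "norm (\<epsilon> *\<^sub>R v) \<le> 1 * norm v" using True \<epsilon>(1) by (simp add: mult_left_le_one_le)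
        qed
        finally show ?thesis by (simp add: K_def algebra_simps)
      qed
      have "v0 \<bullet> Q v0 \<le> (1 / l v0 + 1) * \<epsilon>"
        using key[OF t(1) \<epsilon>] v0(2) v0P(1)
        by (simp add: Q_def inner_simps power2_norm_eq_inner[symmetric] field_simps)
      then have "(norm (Q v0))\<^sup>2 \<le> K * ((1 / l v0 + 1) * \<epsilon>)"
        using psd_form_norm_le[OF linQ symQ psdQ KQ, of v0] K
        by (meson mult_left_mono less_imp_le order.trans)
      then have "norm (Q v0) \<le> sqrt (K * (1 / l v0 + 1)) * sqrt \<epsilon>"
        by (metis real_le_rsqrt real_sqrt_mult mult.assoc)
      moreover have "norm (L t v0) \<le> norm (Q v0) + \<epsilon>"
      proof -
        have "L t v0 = Q v0 - \<epsilon> *\<^sub>R v0" by (simp add: Q_def Mv0)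
        then show ?thesis using norm_triangle_ineq4[of "Q v0" "\<epsilon> *\<^sub>R v0"] v0P(1) \<epsilon>(1) by simp
      qed
      moreover have "\<epsilon> \<le> sqrt \<epsilon>" using True \<epsilon>(1) by (simp add: real_le_rsqrt power2_eq_square mult_left_le)
      ultimately have Lt: "norm (L t v0) \<le> c1 * sqrt \<epsilon>" by (simp add: c1_def algebra_simps)
      obtain t' where t': "t' \<in> T" "L t' v0 = 0" "norm (t - t') \<le> h * norm (L t v0)"
        using h(2)[OF t(1)] by blast
      have tt': "norm (t - t') \<le> c2 * sqrt \<epsilon>"
        using order.trans[OF t'(3) mult_left_mono[OF Lt, of h]] h(1) by (simp add: c2_def mult.assoc)
      have sq1: "0 \<le> sqrt \<epsilon>" "sqrt \<epsilon> \<le> 1" using True \<epsilon>(1) by auto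
      have "norm t' \<le> \<bar>r\<bar> + c2"
        using norm_triangle_ineq4[of t "t - t'"] tt' t(2) mult_left_le[OF sq1(2) c2] by simp
      moreover have "- (c3 * sqrt \<epsilon>) * (norm v)\<^sup>2 \<le> v \<bullet> (M v + L t' v)" for v
      proof -
        have "v \<bullet> L (t - t') v \<le> norm v * (KL * (c2 * sqrt \<epsilon>) * norm v)"
          using KL tt' by (intro order.trans[OF norm_cauchy_schwarz] mult_left_mono order.trans[OF KL(2)] mult_right_mono) auto
        moreover have "\<epsilon> * (norm v)\<^sup>2 \<le> sqrt \<epsilon> * (norm v)\<^sup>2"
          using \<open>\<epsilon> \<le> sqrt \<epsilon>\<close> by (intro mult_right_mono) auto
        ultimately show ?thesis using \<epsilon>(2)[of v]
          by (simp add: c3_def L_simps inner_simps power2_eq_square algebra_simps)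
      qed
      ultimately obtain s where s: "s \<in> T'" "\<And>v. 0 \<le> v \<bullet> (M v + L s v)"
          "norm (t' - s) \<le> C * (c3 * sqrt \<epsilon>) powr \<theta>"
        using IH[of t' "c3 * sqrt \<epsilon>"] t' c3 sq1(1) by (auto simp: T'_def)
      have "(c3 * sqrt \<epsilon>) powr \<theta> = c3 powr \<theta> * \<epsilon> powr (\<theta> / 2)"
        using c3 \<epsilon>(1) by (simp add: powr_mult powr_half_sqrt[symmetric] powr_powr)
      moreover have "sqrt \<epsilon> \<le> \<epsilon> powr (\<theta> / 2)"
        using \<epsilon>(1) True C by (auto simp: powr_half_sqrt[symmetric] intro!: powr_mono')
      ultimately have "norm (t - s) \<le> c2 * \<epsilon> powr (\<theta> / 2) + C * (c3 powr \<theta> * \<epsilon> powr (\<theta> / 2))"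
        using norm_triangle_ineq[of "t - t'" "t' - s"] tt' s(3) c2 mult_left_mono[of "sqrt \<epsilon>" "\<epsilon> powr (\<theta> / 2)" c2]
        by simp
      also have "\<dots> = (c2 + C * c3 powr \<theta>) * \<epsilon> powr (\<theta> / 2)" by (simp add: algebra_simps)
      also have "\<dots> \<le> C' * \<epsilon> powr (\<theta> / 2)" using C'le by (intro mult_right_mono) auto
      finally show ?thesis using s by (auto simp: T'_def)
    qed
    then show ?thesis using C C'le
      by (intro exI[of _ C'] exI[of _ "\<theta> / 2"]) auto
  qed
qed

lemma lmi_error_bound:
  fixes M :: "'g::euclidean_space \<Rightarrow> 'g" and L :: "'e::euclidean_space \<Rightarrow> 'g \<Rightarrow> 'g"
  assumes "linear M" "\<And>v w. v \<bullet> M w = M v \<bullet> w" "\<And>v. 0 \<le> v \<bullet> M v"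
    and "bilinear L" and "subspace T" and "\<And>t v w. t \<in> T \<Longrightarrow> v \<bullet> L t w = L t v \<bullet> w"
  obtains C \<theta> where "0 \<le> C" "0 < \<theta>" "\<theta> \<le> (1::real)"
    "\<And>t \<epsilon>. t \<in> T \<Longrightarrow> \<epsilon> \<ge> 0 \<Longrightarrow> norm t \<le> r \<Longrightarrow>
      (\<And>v. - \<epsilon> * (norm v)\<^sup>2 \<le> v \<bullet> (M v + L t v)) \<Longrightarrow>
      \<exists>s\<in>T. (\<forall>v. 0 \<le> v \<bullet> (M v + L s v)) \<and> norm (t - s) \<le> C * \<epsilon> powr \<theta>"
proof -
  have 0: "M v = 0" "L t v = 0" if "v \<in> {0}" for t v
    using that assms(1,4) by (auto simp: linear_0 bilinear_rzero)
  show ?thesis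
    using lmi_error_bound_aux[OF assms(1-5) subspace_single_0 refl assms(6) 0, of r] that by blast
qed

text \<open>
  By strict convexity of the norm, \<open>\<Lambda>\<close> and the linear part are constant on the set of minimizers, so
  that this set is again a spectrahedron. The error bound controls the distance to it by a power of
  the gap, and the subgradient inequality turns that distance into the stated estimate.
\<close>

lemma spectrahedron_KL:
  fixes c :: "'e::euclidean_space" and \<Lambda> :: "'e \<Rightarrow> 'r::euclidean_space"
    and M :: "'g::euclidean_space \<Rightarrow> 'g" and L :: "'e \<Rightarrow> 'g \<Rightarrow> 'g" and \<rho> :: real
  defines "F \<equiv> \<lambda>x. c \<bullet> x + \<rho> / 2 * (norm (\<Lambda> x))\<^sup>2"
  assumes \<rho>: "\<rho> > 0" and lin\<Lambda>: "linear \<Lambda>" and linM: "linear M" and symM: "\<And>v w. v \<bullet> M w = M v \<bullet> w"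
    and L: "bilinear L" and Y: "subspace Y" and symL: "\<And>t v w. t \<in> Y \<Longrightarrow> v \<bullet> L t w = L t v \<bullet> w"
    and S: "S = {x \<in> Y. \<forall>v. 0 \<le> v \<bullet> (M v + L x v)}"
    and x0: "x0 \<in> S" and min: "\<And>x. x \<in> S \<Longrightarrow> F x0 \<le> F x"
  obtains C \<theta> where "0 \<le> C" "0 < \<theta>" "\<theta> \<le> 1/2"
    "\<And>x d. x \<in> S \<Longrightarrow> norm x \<le> r \<Longrightarrow> (\<And>y. y \<in> S \<Longrightarrow> F x + d \<bullet> (y - x) \<le> F y) \<Longrightarrow>
       F x - F x0 \<le> C * norm d * (F x - F x0) powr \<theta>"
proof -
  interpret \<Lambda>: linear \<Lambda> by fact
  have linLv: "linear (\<lambda>t. L t v)" and linLt: "linear (L t)" for t v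
    using L by (auto simp: bilinear_def)
  note L_simps = linear_add[OF linLv] linear_diff[OF linLv] linear_scale[OF linLv]
  \<comment> \<open>Recentering at \<open>x0\<close> makes the constant part positive semidefinite,
    as the error bound requires. Feasible points \<open>x0 + s\<close> with \<open>s\<close> in
    \<open>T\<close> have the minimal value of \<open>F\<close>.\<close>
  define M0 where "M0 v = M v + L x0 v" for v
  define T where "T = {t \<in> Y. \<Lambda> t = 0 \<and> c \<bullet> t = 0}"
  have x0Y: "x0 \<in> Y" using x0 S by auto
  have T: "subspace T"
    using Y by (auto simp: T_def subspace_def \<Lambda>.zero \<Lambda>.add \<Lambda>.scale inner_simps)
  have linf: "linear (\<lambda>t. (\<Lambda> t, c \<bullet> t))"
    by (intro linearI) (auto simp: \<Lambda>.add \<Lambda>.scale inner_simps)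
  obtain h where h: "0 < h" and h': "\<And>t. t \<in> Y \<Longrightarrow>
      \<exists>s\<in>Y. (\<Lambda> s, c \<bullet> s) = 0 \<and> norm (t - s) \<le> h * norm (\<Lambda> t, c \<bullet> t)"
    by (rule linear_kernel_error_bound[OF linf Y]) blast
  have h'': "\<exists>s\<in>T. norm (t - s) \<le> h * norm (\<Lambda> t, c \<bullet> t)" if "t \<in> Y" for t
    using h'[OF that] by (auto simp: T_def zero_prod_def)
  obtain KL where KL: "0 < KL" "\<And>t v. norm (L t v) \<le> KL * norm t * norm v"
    using bilinear_bounded_pos[OF L] by blast
  \<comment> \<open>For a gap \<open>\<phi> \<le> 1\<close>, \<open>c1 * sqrt \<phi>\<close> will
    bound the change of \<open>\<Lambda>\<close> and of the linear part between \<open>x0\<close>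
    and \<open>x\<close>; \<open>h\<close> turns this into a distance to \<open>T\<close>.\<close>
  define c1 where "c1 = sqrt (2 / \<rho>) * (1 + \<rho> * norm (\<Lambda> x0)) + 1"
  define c2 where "c2 = h * c1"
  have c2: "0 \<le> c2" using h \<rho> by (simp add: c2_def c1_def add_nonneg_nonneg)
  have linM0: "linear M0" unfolding M0_def by (intro linear_compose_add linM linLt)
  have symM0: "v \<bullet> M0 w = M0 v \<bullet> w" for v w
    using symM[of v w] symL[OF x0Y, of v w] by (simp add: M0_def inner_simps)
  have psdM0: "0 \<le> v \<bullet> M0 v" for v using x0 S by (simp add: M0_def)
  have symLT: "v \<bullet> L t w = L t v \<bullet> w" if "t \<in> T" for t v w using that symL by (simp add: T_def)
  obtain C \<theta> where C: "0 \<le> C" "0 < \<theta>" "\<theta> \<le> (1::real)"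
    and bound: "\<And>t \<epsilon>. t \<in> T \<Longrightarrow> \<epsilon> \<ge> 0 \<Longrightarrow> norm t \<le> \<bar>r\<bar> + norm x0 + c2 \<Longrightarrow>
      (\<And>v. - \<epsilon> * (norm v)\<^sup>2 \<le> v \<bullet> (M0 v + L t v)) \<Longrightarrow>
      \<exists>s\<in>T. (\<forall>v. 0 \<le> v \<bullet> (M0 v + L s v)) \<and> norm (t - s) \<le> C * \<epsilon> powr \<theta>"
    using lmi_error_bound[OF linM0 symM0 psdM0 L T symLT, of "\<bar>r\<bar> + norm x0 + c2"] by blast
  define C' where "C' = c2 + C * (KL * c2) powr \<theta> + (\<bar>r\<bar> + norm x0)"
  have C'le: "c2 + C * (KL * c2) powr \<theta> \<le> C'" "\<bar>r\<bar> + norm x0 \<le> C'" "0 \<le> C'"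
    using c2 C by (simp_all add: C'_def)
  have expand: "F (x0 + t) - F x0 = c \<bullet> t + \<rho> * (\<Lambda> x0 \<bullet> \<Lambda> t) + \<rho> / 2 * (norm (\<Lambda> t))\<^sup>2" for t
    by (simp add: F_def \<Lambda>.add power2_norm_eq_inner inner_simps inner_commute algebra_simps)
  have S_cvx: "x0 + s *\<^sub>R (x - x0) \<in> S" if "x \<in> S" "0 \<le> s" "s \<le> 1" for x s
  proof -
    have "x0 + s *\<^sub>R (x - x0) \<in> Y"
      using that x0Y S by (auto intro!: subspace_add[OF Y] subspace_scale[OF Y] subspace_diff[OF Y])
    moreover have "0 \<le> v \<bullet> (M v + L (x0 + s *\<^sub>R (x - x0)) v)" for v
    proof -
      have "0 \<le> (1 - s) * (v \<bullet> (M v + L x0 v)) + s * (v \<bullet> (M v + L x v))"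
        using that x0 S by (intro add_nonneg_nonneg mult_nonneg_nonneg) auto
      then show ?thesis by (simp add: L_simps inner_simps algebra_simps)
    qed
    ultimately show ?thesis by (simp add: S)
  qed
  have "F x - F x0 \<le> C' * norm d * (F x - F x0) powr (\<theta> / 2)"
    if x: "x \<in> S" "norm x \<le> r" and d: "\<And>y. y \<in> S \<Longrightarrow> F x + d \<bullet> (y - x) \<le> F y" for x d
  proof -
    define \<phi> where "\<phi> = F x - F x0"
    define e where "e = x - x0"
    have \<phi>0: "0 \<le> \<phi>" using min[OF x(1)] by (simp add: \<phi>_def)
    have close: "\<phi> \<le> norm d * norm (x - y)" if "y \<in> S" "F y = F x0" for y
      using d[OF that(1)] that(2) norm_cauchy_schwarz[of d "x - y"] by (simp add: \<phi>_def inner_simps)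
    have normx: "norm e \<le> \<bar>r\<bar> + norm x0" using norm_triangle_ineq4[of x x0] x(2) by (simp add: e_def)
    have "\<phi> \<le> norm d * (C' * \<phi> powr (\<theta> / 2))"
    proof (cases "\<phi> \<le> 1")
      case False
      \<comment> \<open>When the gap exceeds 1, \<open>x0\<close> itself is a near enough
        minimizer.\<close>
      then have "1 \<le> \<phi> powr (\<theta> / 2)" using C by (intro ge_one_powr_ge_zero) auto
      then have "norm (x - x0) \<le> C' * \<phi> powr (\<theta> / 2)"
        using normx C'le mult_mono[of "\<bar>r\<bar> + norm x0" C' 1 "\<phi> powr (\<theta> / 2)"] by (simp add: e_def)
      then show ?thesis using close[OF x0 refl] by (meson mult_left_mono norm_ge_zero order.trans)
    next
      case True
      \<comment> \<open>\<open>m\<close> is the directional derivative of \<open>F\<close> at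
        \<open>x0\<close> towards \<open>x\<close>. Its nonnegativity lets the gap control the
        quadratic part and \<open>m\<close> separately.\<close>
      define m where "m = c \<bullet> e + \<rho> * (\<Lambda> x0 \<bullet> \<Lambda> e)"
      have \<phi>_eq: "\<phi> = m + \<rho> / 2 * (norm (\<Lambda> e))\<^sup>2"
        using expand[of e] by (simp add: \<phi>_def e_def m_def)
      have m: "0 \<le> m"
      proof (rule ccontr)
        assume neg: "\<not> 0 \<le> m"
        define q where "q = \<rho> / 2 * (norm (\<Lambda> e))\<^sup>2"
        have q: "0 \<le> q" using \<rho> by (simp add: q_def)
        have ineq: "0 \<le> s * m + s\<^sup>2 * q" if "0 \<le> s" "s \<le> 1" for s
          using min[OF S_cvx[OF x(1) that]] expand[of "s *\<^sub>R e"]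
          by (simp add: e_def[symmetric] m_def q_def \<Lambda>.scale power_mult_distrib algebra_simps)
        \<comment> \<open>So short a step keeps \<open>s * q\<close> at most \<open>- m / 2\<close>,
          and the first-order decrease wins.\<close>
        define s where "s = min 1 (- m / (2 * q + 1))"
        have s: "0 < s" "s \<le> 1" "s \<le> - m / (2 * q + 1)" using neg q by (auto simp: s_def divide_neg_pos field_simps)
        have "s * q \<le> - m / (2 * q + 1) * q" using s q by (intro mult_right_mono)
        also have "\<dots> \<le> - m / 2" using neg q by (simp add: field_simps)
        also have "\<dots> < - m" using neg by simp
        finally have "s * (m + s * q) < 0" using s by (simp add: mult_pos_neg)
        with ineq[of s] s show False by (simp add: algebra_simps power2_eq_square)
      qed
      have sq: "0 \<le> sqrt \<phi>" "sqrt \<phi> \<le> 1" "\<phi> \<le> sqrt \<phi>"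
        using True \<phi>0 by (auto simp: real_le_rsqrt power2_eq_square mult_left_le)
      have "(norm (\<Lambda> e))\<^sup>2 \<le> (2 / \<rho>) * \<phi>" using m \<phi>_eq \<rho> by (simp add: field_simps)
      then have n\<Lambda>: "norm (\<Lambda> e) \<le> sqrt (2 / \<rho>) * sqrt \<phi>"
        by (metis real_le_rsqrt real_sqrt_mult)
      have "c \<bullet> e = m - \<rho> * (\<Lambda> x0 \<bullet> \<Lambda> e)" by (simp add: m_def)
      then have "\<bar>c \<bullet> e\<bar> \<le> m + \<rho> * \<bar>\<Lambda> x0 \<bullet> \<Lambda> e\<bar>" using m \<rho>
        abs_triangle_ineq4[of m "\<rho> * (\<Lambda> x0 \<bullet> \<Lambda> e)"] by (simp add: abs_mult)
      also have "\<dots> \<le> \<phi> + \<rho> * (norm (\<Lambda> x0) * norm (\<Lambda> e))"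
        using \<phi>_eq \<rho> by (intro add_mono mult_left_mono Cauchy_Schwarz_ineq2) auto
      finally have "norm (\<Lambda> e, c \<bullet> e) \<le> norm (\<Lambda> e) + (\<phi> + \<rho> * (norm (\<Lambda> x0) * norm (\<Lambda> e)))"
        using norm_Pair_le[of "\<Lambda> e" "c \<bullet> e"] by simp
      also have "\<dots> = norm (\<Lambda> e) * (1 + \<rho> * norm (\<Lambda> x0)) + \<phi>" by (simp add: algebra_simps)
      also have "\<dots> \<le> (sqrt (2 / \<rho>) * sqrt \<phi>) * (1 + \<rho> * norm (\<Lambda> x0)) + sqrt \<phi>"
        using sq n\<Lambda> \<rho> by (intro add_mono mult_right_mono) auto
      also have "\<dots> = c1 * sqrt \<phi>" by (simp add: c1_def algebra_simps)
      finally have nf: "norm (\<Lambda> e, c \<bullet> e) \<le> c1 * sqrt \<phi>" .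
      have eY: "e \<in> Y" using x(1) S x0Y by (simp add: e_def subspace_diff[OF Y])
      obtain t where t: "t \<in> T" "norm (e - t) \<le> h * norm (\<Lambda> e, c \<bullet> e)" using h''[OF eY] by blast
      have et: "norm (e - t) \<le> c2 * sqrt \<phi>"
        using order.trans[OF t(2) mult_left_mono[OF nf, of h]] h by (simp add: c2_def mult.assoc)
      have "norm t \<le> \<bar>r\<bar> + norm x0 + c2"
        using norm_triangle_ineq4[of e "e - t"] et normx mult_left_le[OF sq(2) c2] by simp
      moreover have "- (KL * c2 * sqrt \<phi>) * (norm v)\<^sup>2 \<le> v \<bullet> (M0 v + L t v)" for v
      proof -
        have "v \<bullet> L (e - t) v \<le> norm v * (KL * (c2 * sqrt \<phi>) * norm v)"
          using KL et by (intro order.trans[OF norm_cauchy_schwarz] mult_left_mono order.trans[OF KL(2)] mult_right_mono) auto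
        moreover have "0 \<le> v \<bullet> (M v + L x v)" using x(1) S by auto
        ultimately show ?thesis
          by (simp add: M0_def e_def L_simps inner_simps power2_eq_square algebra_simps)
      qed
      ultimately obtain s where s: "s \<in> T" "\<And>v. 0 \<le> v \<bullet> (M0 v + L s v)"
          "norm (t - s) \<le> C * (KL * c2 * sqrt \<phi>) powr \<theta>"
        using bound[of t "KL * c2 * sqrt \<phi>"] t(1) c2 KL(1) sq(1) by auto
      have "x0 + s \<in> S"
        using s(1,2) x0Y by (auto simp: S T_def M0_def L_simps inner_simps algebra_simps intro: subspace_add[OF Y])
      moreover have "F (x0 + s) = F x0" using expand[of s] s(1) by (simp add: T_def)
      ultimately have "\<phi> \<le> norm d * norm (e - s)" using close[of "x0 + s"] by (simp add: e_def algebra_simps)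
      also have "\<dots> \<le> norm d * (C' * \<phi> powr (\<theta> / 2))"
      proof (rule mult_left_mono[OF _ norm_ge_zero])
        have "(KL * c2 * sqrt \<phi>) powr \<theta> = (KL * c2) powr \<theta> * \<phi> powr (\<theta> / 2)"
          using c2 KL \<phi>0 by (simp add: powr_mult powr_half_sqrt[symmetric] powr_powr)
        moreover have "sqrt \<phi> \<le> \<phi> powr (\<theta> / 2)"
          using \<phi>0 True C by (auto simp: powr_half_sqrt[symmetric] intro!: powr_mono')
        ultimately have "norm (e - s) \<le> c2 * \<phi> powr (\<theta> / 2) + C * ((KL * c2) powr \<theta> * \<phi> powr (\<theta> / 2))"
          using norm_triangle_ineq[of "e - t" "t - s"] et s(3) c2 mult_left_mono[of "sqrt \<phi>" "\<phi> powr (\<theta> / 2)" c2]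
          by simp
        also have "\<dots> = (c2 + C * (KL * c2) powr \<theta>) * \<phi> powr (\<theta> / 2)" by (simp add: algebra_simps)
        also have "\<dots> \<le> C' * \<phi> powr (\<theta> / 2)" using C'le by (intro mult_right_mono) auto
        finally show "norm (e - s) \<le> C' * \<phi> powr (\<theta> / 2)" .
      qed
      finally show ?thesis .
    qed
    then show ?thesis by (simp add: \<phi>_def mult_ac)
  qed
  then show ?thesis using C C'le by (intro that[of C' "\<theta> / 2"]) auto
qed

section \<open>Descent and finite length\<close>

lemma convex_combination_norm_sq_le:
  fixes a b :: "'a::real_inner"
  assumes "0 \<le> s" "s \<le> 1"
  shows "(norm ((1 - s) *\<^sub>R a + s *\<^sub>R b))\<^sup>2 \<le> (1 - s) * (norm a)\<^sup>2 + s * (norm b)\<^sup>2"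
proof -
  have "(1 - s) * (norm a)\<^sup>2 + s * (norm b)\<^sup>2 - (norm ((1 - s) *\<^sub>R a + s *\<^sub>R b))\<^sup>2
      = s * (1 - s) * (norm (a - b))\<^sup>2"
    by (simp add: power2_norm_eq_inner inner_simps inner_commute algebra_simps)
  moreover have "0 \<le> s * (1 - s) * (norm (a - b))\<^sup>2" using assms by simp
  ultimately show ?thesis by linarith
qed

text \<open>This is the tangent inequality of the concave power at \<open>a\<close>, multiplied by
  \<open>a powr (1 - \<theta>)\<close> so that it survives at \<open>a = 0\<close>. For positive
  \<open>b\<close> it is the weighted arithmetic-geometric mean inequality.\<close>

lemma powr_concave_gap:
  fixes a b \<theta> :: real
  assumes "0 \<le> b" "b \<le> a" "0 < \<theta>" "\<theta> < 1"
  shows "\<theta> * (a - b) \<le> a powr (1 - \<theta>) * (a powr \<theta> - b powr \<theta>)"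
proof (cases "b = 0")
  case True
  have "a powr (1 - \<theta>) * a powr \<theta> = a" using assms by (cases "a = 0") (auto simp: powr_add[symmetric])
  then show ?thesis using assms True by (simp add: mult_left_le_one_le)
next
  case False
  have "a powr (1 - \<theta>) * a powr \<theta> = a" using assms False by (simp add: powr_add[symmetric])
  moreover have "b powr \<theta> * a powr (1 - \<theta>) \<le> \<theta> * b + (1 - \<theta>) * a"
    using assms False by (intro Youngs_inequality_0) auto
  ultimately show ?thesis by (simp add: algebra_simps)
qed

text \<open>The arithmetic-geometric mean inequality turns the hypothesis into \<open>2 * \<delta>
  (Suc k) \<le> \<delta> k + C * (e k - e (Suc k))\<close>. So \<open>\<delta> k + C * e k\<close>
  drops by at least \<open>\<delta> (Suc k)\<close> at each step.\<close>

lemma summable_of_telescoping_bound: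
  fixes \<delta> e :: "nat \<Rightarrow> real"
  assumes \<delta>: "\<And>k. 0 \<le> \<delta> k" and e: "\<And>k. N \<le> k \<Longrightarrow> 0 \<le> e k" and C: "0 \<le> C"
    and dec: "\<And>k. N \<le> k \<Longrightarrow> e (Suc k) \<le> e k"
    and step: "\<And>k. N \<le> k \<Longrightarrow> (\<delta> (Suc k))\<^sup>2 \<le> \<delta> k * (C * (e k - e (Suc k)))"
  shows "summable \<delta>"
proof -
  define V where "V k = \<delta> (k + N) + C * e (k + N)" for k
  have le: "\<delta> (Suc k + N) \<le> V k - V (Suc k)" for k
  proof -
    define y where "y = C * (e (k + N) - e (Suc k + N))"
    have y: "0 \<le> y" using dec[of "k + N"] C by (simp add: y_def)
    have "(2 * \<delta> (Suc k + N))\<^sup>2 \<le> 4 * (\<delta> (k + N) * y)"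
      using step[of "k + N"] by (simp add: y_def power_mult_distrib)
    also have "\<dots> \<le> (\<delta> (k + N) + y)\<^sup>2"
      using zero_le_power2[of "\<delta> (k + N) - y"] by (simp add: power2_eq_square algebra_simps)
    finally have "2 * \<delta> (Suc k + N) \<le> \<delta> (k + N) + y"
      by (rule power2_le_imp_le) (use \<delta>[of "k + N"] y in simp)
    then show ?thesis by (simp add: V_def y_def algebra_simps)
  qed
  have "summable (\<lambda>k. \<delta> (Suc k + N))"
  proof (rule summableI_nonneg_bounded)
    fix n
    have "(\<Sum>k<n. \<delta> (Suc k + N)) \<le> (\<Sum>k<n. V k - V (Suc k))" by (intro sum_mono le)
    also have "\<dots> = V 0 - V n" by (rule sum_lessThan_telescope')
    also have "\<dots> \<le> V 0" using \<delta>[of "n + N"] mult_nonneg_nonneg[OF C e[of "n + N"]] by (simp add: V_def)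
    finally show "(\<Sum>k<n. \<delta> (Suc k + N)) \<le> V 0" .
  qed (rule \<delta>)
  then show ?thesis
    using summable_iff_shift[of \<delta> "Suc N"] by (simp add: add.commute)
qed

lemma summable_increments_convergent:
  fixes x :: "nat \<Rightarrow> 'a::banach"
  assumes "summable (\<lambda>k. norm (x (Suc k) - x k))"
  obtains l where "x \<longlonglongrightarrow> l"
proof -
  have "(\<lambda>n. x 0 + (\<Sum>k<n. x (Suc k) - x k)) \<longlonglongrightarrow> x 0 + suminf (\<lambda>k. x (Suc k) - x k)"
    by (intro tendsto_add tendsto_const summable_LIMSEQ[OF summable_norm_cancel[OF assms]])
  then show ?thesis using that by (simp add: sum_lessThan_telescope)
qed

text \<open>
  The proximal steps enter only through their optimality conditions. With \<open>\<xi> = \<bar>\<tau> - \<beta>\<bar>\<close>, the two step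
  size conditions are exactly positivity of the descent coefficients \<open>cp\<close> and \<open>cw\<close> below.
\<close>

locale palm =
  fixes A :: "'w::euclidean_space \<Rightarrow> 'r::euclidean_space" and B :: "'p::euclidean_space \<Rightarrow> 'r"
    and K :: "'w set" and c :: 'w and g :: "'p \<Rightarrow> real"
    and \<rho> \<mu> \<beta> \<tau> \<sigma> \<kappa>1 \<kappa>2 \<kappa>3 c0 b0 :: real
    and w z u :: "nat \<Rightarrow> 'w" and p :: "nat \<Rightarrow> 'p"
    and H :: "'w \<Rightarrow> 'p \<Rightarrow> real" and GW :: "'w \<Rightarrow> 'p \<Rightarrow> 'w" and GP :: "'w \<Rightarrow> 'p \<Rightarrow> 'p"
  defines "H x y \<equiv> \<rho> / 2 * (norm (A x + B y))\<^sup>2"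
    and "GW x y \<equiv> \<rho> *\<^sub>R adjoint A (A x + B y)"
    and "GP x y \<equiv> \<rho> *\<^sub>R adjoint B (A x + B y)"
  assumes linA: "linear A" and linB: "linear B" and \<rho>: "0 < \<rho>"
    and lip1: "\<And>x. \<rho> * norm (adjoint A (A x)) \<le> \<kappa>1 * norm x"
    and lip2: "\<And>y. \<rho> * norm (adjoint B (B y)) \<le> \<kappa>2 * norm y"
    and lip3: "\<And>y. \<rho> * norm (adjoint A (B y)) \<le> \<kappa>3 * norm y"
    and \<kappa>1: "0 \<le> \<kappa>1" and \<sigma>: "0 < \<sigma>" "\<sigma> < 1" and \<beta>: "0 < \<beta>"
    and \<mu>_gt: "\<kappa>2 + 16 * \<kappa>3\<^sup>2 / (\<sigma> * \<beta>) < \<mu>"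
    and \<tau>_gt: "12 * \<sigma> * \<bar>\<tau> - \<beta>\<bar>\<^sup>2 / \<beta> + 16 * \<kappa>1 * \<bar>\<tau> - \<beta>\<bar> / \<beta> + 8 * \<kappa>1\<^sup>2 / (\<sigma> * \<beta>) < \<tau> - (\<kappa>1 + \<beta>) / 2"
    and c0: "0 < c0" "\<And>x. x \<in> K \<Longrightarrow> c0 * norm x \<le> c \<bullet> x"
    and b0: "0 < b0" "\<And>y. b0 * norm y \<le> norm (B y)"
    and closedK: "closed K" and g0: "\<And>y. 0 \<le> g y"
    and p_step: "\<And>k y. g (p (Suc k)) + GP (w k) (p k) \<bullet> (p (Suc k) - p k) + \<mu> / 2 * (norm (p (Suc k) - p k))\<^sup>2
        \<le> g y + GP (w k) (p k) \<bullet> (y - p k) + \<mu> / 2 * (norm (y - p k))\<^sup>2"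
    and z_in: "\<And>k. z (Suc k) \<in> K"
    and z_step: "\<And>k y. y \<in> K \<Longrightarrow> (u k + \<beta> *\<^sub>R (w k - z (Suc k))) \<bullet> (y - z (Suc k)) \<le> c \<bullet> (y - z (Suc k))"
    and w_step: "\<And>k. \<tau> *\<^sub>R (w (Suc k) - w k) = - (GW (w k) (p (Suc k)) + u k + \<beta> *\<^sub>R (w k - z (Suc k)))"
    and u_step: "\<And>k. u (Suc k) - u k = (\<sigma> * \<beta>) *\<^sub>R (w (Suc k) - z (Suc k))"
begin

sublocale A: linear A by (rule linA)
sublocale B: linear B by (rule linB)

lemma adjoint_A: "x \<bullet> adjoint A y = A x \<bullet> y" by (rule adjoint_works[OF linA])
lemma adjoint_B: "x \<bullet> adjoint B y = B x \<bullet> y" by (rule adjoint_works[OF linB])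

sublocale A': linear "adjoint A" by (rule adjoint_linear[OF linA])
sublocale B': linear "adjoint B" by (rule adjoint_linear[OF linB])

definition dw where "dw k = w (Suc k) - w k"
definition dp where "dp k = p (Suc k) - p k"
definition du where "du k = u (Suc k) - u k"
text \<open>The factor converting multiplier increments into primal residuals, by
  \<open>w_minus_z\<close>.\<close>

definition a where "a = 1 / (\<sigma> * \<beta>)"
definition \<xi> where "\<xi> = \<bar>\<tau> - \<beta>\<bar>"
definition Lag where
  "Lag k = c \<bullet> z k + g (p k) + H (w k) (p k) + u k \<bullet> (w k - z k) + \<beta> / 2 * (norm (w k - z k))\<^sup>2"

lemma a_pos: "0 < a" using \<sigma> \<beta> by (simp add: a_def)

section \<open>One-step estimates for the augmented Lagrangian\<close>

lemma H_expand_w: "H x' y = H x y + GW x y \<bullet> (x' - x) + \<rho> / 2 * (norm (A (x' - x)))\<^sup>2"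
proof -
  have "A x' = A x + A (x' - x)" by (simp add: A.diff)
  moreover have "GW x y \<bullet> (x' - x) = \<rho> * ((A x + B y) \<bullet> A (x' - x))"
    using adjoint_A[of "x' - x" "A x + B y"] by (simp add: GW_def inner_commute)
  ultimately show ?thesis
    by (simp add: H_def power2_norm_eq_inner inner_simps inner_commute algebra_simps)
qed

lemma H_expand_p: "H x y' = H x y + GP x y \<bullet> (y' - y) + \<rho> / 2 * (norm (B (y' - y)))\<^sup>2"
proof -
  have "B y' = B y + B (y' - y)" by (simp add: B.diff)
  moreover have "GP x y \<bullet> (y' - y) = \<rho> * ((A x + B y) \<bullet> B (y' - y))"
    using adjoint_B[of "y' - y" "A x + B y"] by (simp add: GP_def inner_commute)
  ultimately show ?thesis
    by (simp add: H_def power2_norm_eq_inner inner_simps inner_commute algebra_simps)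
qed

lemma A_bound: "\<rho> * (norm (A x))\<^sup>2 \<le> \<kappa>1 * (norm x)\<^sup>2"
proof -
  have "\<rho> * (norm (A x))\<^sup>2 = \<rho> * (x \<bullet> adjoint A (A x))" by (simp add: adjoint_A power2_norm_eq_inner)
  also have "\<dots> \<le> \<rho> * (norm x * norm (adjoint A (A x)))"
    using \<rho> by (intro mult_left_mono norm_cauchy_schwarz) auto
  also have "\<dots> \<le> norm x * (\<kappa>1 * norm x)"
    using mult_left_mono[OF lip1[of x] norm_ge_zero[of x]] by (simp add: mult_ac)
  finally show ?thesis by (simp add: power2_eq_square mult_ac)
qed

lemma B_bound: "\<rho> * (norm (B y))\<^sup>2 \<le> \<kappa>2 * (norm y)\<^sup>2"
proof -
  have "\<rho> * (norm (B y))\<^sup>2 = \<rho> * (y \<bullet> adjoint B (B y))" by (simp add: adjoint_B power2_norm_eq_inner)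
  also have "\<dots> \<le> \<rho> * (norm y * norm (adjoint B (B y)))"
    using \<rho> by (intro mult_left_mono norm_cauchy_schwarz) auto
  also have "\<dots> \<le> norm y * (\<kappa>2 * norm y)"
    using mult_left_mono[OF lip2[of y] norm_ge_zero[of y]] by (simp add: mult_ac)
  finally show ?thesis by (simp add: power2_eq_square mult_ac)
qed

lemma p_descent:
  "g (p (Suc k)) + H (w k) (p (Suc k)) \<le> g (p k) + H (w k) (p k) - (\<mu> - \<kappa>2) / 2 * (norm (dp k))\<^sup>2"
proof -
  have "H (w k) (p (Suc k)) = H (w k) (p k) + GP (w k) (p k) \<bullet> dp k + \<rho> / 2 * (norm (B (dp k)))\<^sup>2"
    unfolding dp_def by (rule H_expand_p)
  moreover have "(\<mu> - \<kappa>2) / 2 * (norm (dp k))\<^sup>2 = \<mu> / 2 * (norm (dp k))\<^sup>2 - \<kappa>2 * (norm (dp k))\<^sup>2 / 2"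
    by (simp add: field_simps)
  moreover have "g (p (Suc k)) + GP (w k) (p k) \<bullet> dp k + \<mu> / 2 * (norm (dp k))\<^sup>2 \<le> g (p k)"
    using p_step[of k "p k"] by (simp add: dp_def)
  ultimately show ?thesis using B_bound[of "dp k"] by linarith
qed

text \<open>The variational inequality at \<open>z (Suc k)\<close> is tested with
  \<open>z k\<close>, which must therefore be feasible. The initial \<open>z 0\<close> is arbitrary,
  so descent can be claimed only from index 1 on.\<close>

lemma z_descent:
  assumes "z k \<in> K"
  shows "c \<bullet> z (Suc k) + u k \<bullet> (w k - z (Suc k)) + \<beta> / 2 * (norm (w k - z (Suc k)))\<^sup>2
    \<le> c \<bullet> z k + u k \<bullet> (w k - z k) + \<beta> / 2 * (norm (w k - z k))\<^sup>2"
proof -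
  have "(norm (w k - z k))\<^sup>2 = (norm (w k - z (Suc k)))\<^sup>2
      - 2 * ((w k - z (Suc k)) \<bullet> (z k - z (Suc k))) + (norm (z k - z (Suc k)))\<^sup>2"
    by (simp add: power2_norm_eq_inner inner_simps inner_commute algebra_simps)
  then have "\<beta> / 2 * (norm (w k - z k))\<^sup>2 = \<beta> / 2 * (norm (w k - z (Suc k)))\<^sup>2
      - \<beta> * ((w k - z (Suc k)) \<bullet> (z k - z (Suc k))) + \<beta> / 2 * (norm (z k - z (Suc k)))\<^sup>2"
    by (simp only:) (simp add: algebra_simps)
  moreover have "0 \<le> \<beta> / 2 * (norm (z k - z (Suc k)))\<^sup>2" using \<beta> by simp
  moreover have "u k \<bullet> (z k - z (Suc k)) + \<beta> * ((w k - z (Suc k)) \<bullet> (z k - z (Suc k))) \<le> c \<bullet> z k - c \<bullet> z (Suc k)"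
    using z_step[OF assms, of k] by (simp add: inner_add_left inner_diff_right algebra_simps)
  moreover have "u k \<bullet> (w k - z (Suc k)) = u k \<bullet> (w k - z k) + u k \<bullet> (z k - z (Suc k))"
    by (simp add: inner_simps)
  ultimately show ?thesis by linarith
qed

lemma w_descent:
  "H (w (Suc k)) (p (Suc k)) + u k \<bullet> (w (Suc k) - z (Suc k)) + \<beta> / 2 * (norm (w (Suc k) - z (Suc k)))\<^sup>2
   \<le> H (w k) (p (Suc k)) + u k \<bullet> (w k - z (Suc k)) + \<beta> / 2 * (norm (w k - z (Suc k)))\<^sup>2
     - (\<tau> - (\<kappa>1 + \<beta>) / 2) * (norm (dw k))\<^sup>2"
proof -
  have e: "w (Suc k) - z (Suc k) = (w k - z (Suc k)) + dw k" by (simp add: dw_def)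
  have "GW (w k) (p (Suc k)) \<bullet> dw k + u k \<bullet> dw k + \<beta> * ((w k - z (Suc k)) \<bullet> dw k) = - (\<tau> * (dw k \<bullet> dw k))"
    using arg_cong[OF w_step[of k], of "\<lambda>v. v \<bullet> dw k"] unfolding dw_def[symmetric]
    by (simp add: inner_simps algebra_simps)
  moreover have "H (w (Suc k)) (p (Suc k)) = H (w k) (p (Suc k)) + GW (w k) (p (Suc k)) \<bullet> dw k
      + \<rho> / 2 * (norm (A (dw k)))\<^sup>2"
    unfolding dw_def by (rule H_expand_w)
  moreover have "(norm (w (Suc k) - z (Suc k)))\<^sup>2 = (norm (w k - z (Suc k)))\<^sup>2
      + 2 * ((w k - z (Suc k)) \<bullet> dw k) + (norm (dw k))\<^sup>2"
    unfolding e by (simp add: power2_norm_eq_inner inner_simps inner_commute)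
  then have "\<beta> / 2 * (norm (w (Suc k) - z (Suc k)))\<^sup>2 = \<beta> / 2 * (norm (w k - z (Suc k)))\<^sup>2
      + \<beta> * ((w k - z (Suc k)) \<bullet> dw k) + \<beta> * (norm (dw k))\<^sup>2 / 2"
    by (simp only:) (simp add: algebra_simps)
  moreover have "u k \<bullet> (w (Suc k) - z (Suc k)) = u k \<bullet> (w k - z (Suc k)) + u k \<bullet> dw k"
    unfolding e by (simp add: inner_add_right)
  moreover have "(\<tau> - (\<kappa>1 + \<beta>) / 2) * (norm (dw k))\<^sup>2
      = \<tau> * (dw k \<bullet> dw k) - \<kappa>1 * (norm (dw k))\<^sup>2 / 2 - \<beta> * (norm (dw k))\<^sup>2 / 2"
    by (simp add: power2_norm_eq_inner field_simps)
  ultimately show ?thesis using A_bound[of "dw k"] by linarith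
qed

lemma w_minus_z: "w (Suc k) - z (Suc k) = a *\<^sub>R du k"
  using u_step[of k] \<sigma> \<beta> by (simp add: du_def a_def)

lemma Lag_descent:
  assumes "z k \<in> K"
  shows "Lag (Suc k) \<le> Lag k - (\<mu> - \<kappa>2) / 2 * (norm (dp k))\<^sup>2
     - (\<tau> - (\<kappa>1 + \<beta>) / 2) * (norm (dw k))\<^sup>2 + a * (norm (du k))\<^sup>2"
proof -
  have "u (Suc k) \<bullet> (w (Suc k) - z (Suc k)) = u k \<bullet> (w (Suc k) - z (Suc k)) + a * (norm (du k))\<^sup>2"
    unfolding w_minus_z by (simp add: du_def power2_norm_eq_inner inner_simps algebra_simps)
  then show ?thesis
    using p_descent[of k] z_descent[OF assms] w_descent[of k] unfolding Lag_def by simp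
qed

text \<open>Eliminating \<open>w k - z (Suc k)\<close> between the two updates shows that the
  multiplier is minus a gradient up to increments. Both the estimate of \<open>du\<close> and the
  limit equation for \<open>u\<close> rest on this.\<close>

lemma u_eq: "u k = - ((1 / \<sigma>) *\<^sub>R du k) + (\<beta> - \<tau>) *\<^sub>R dw k - GW (w k) (p (Suc k))"
proof -
  have "(1 / \<sigma>) *\<^sub>R du k = \<beta> *\<^sub>R (w (Suc k) - z (Suc k))"
    using u_step[of k] \<sigma> by (simp add: du_def)
  then have "(1 / \<sigma>) *\<^sub>R du k = \<beta> *\<^sub>R dw k + \<beta> *\<^sub>R (w k - z (Suc k))"
    by (simp add: dw_def algebra_simps)
  moreover have "u k = - (\<tau> *\<^sub>R dw k) - GW (w k) (p (Suc k)) - \<beta> *\<^sub>R (w k - z (Suc k))"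
    unfolding dw_def w_step by simp
  ultimately show ?thesis by (simp add: scaleR_left_diff_distrib)
qed

text \<open>
  The multiplier update averages with weight \<open>\<sigma>\<close>. Shifting \<open>du\<close> by a multiple of \<open>dw\<close> removes the term
  \<open>dw (Suc k) - dw k\<close> from the recursion, which gains a factor \<open>\<sigma>\<close> in front of \<open>\<tau> - \<beta>\<close>.
\<close>

definition d where "d k = du k + (\<sigma> * (\<tau> - \<beta>)) *\<^sub>R dw k"

definition e where "e k = (\<sigma> * (\<tau> - \<beta>)) *\<^sub>R dw k - (GW (w (Suc k)) (p (Suc (Suc k))) - GW (w k) (p (Suc k)))"

lemma d_rec: "d (Suc k) = (1 - \<sigma>) *\<^sub>R d k + \<sigma> *\<^sub>R e k"
proof -
  have *: "\<sigma> *\<^sub>R u k = - du k + (\<sigma> * (\<beta> - \<tau>)) *\<^sub>R dw k - \<sigma> *\<^sub>R GW (w k) (p (Suc k))" for k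
    using arg_cong[OF u_eq[of k], of "\<lambda>v. \<sigma> *\<^sub>R v"] \<sigma> by (simp add: scaleR_right_diff_distrib scaleR_right_distrib)
  have "\<sigma> *\<^sub>R du k = \<sigma> *\<^sub>R u (Suc k) - \<sigma> *\<^sub>R u k" by (simp add: du_def scaleR_right_diff_distrib)
  then show ?thesis unfolding *[of k] *[of "Suc k"] d_def e_def
    by (simp add: algebra_simps)
qed

lemma GW_diff: "GW x' y' - GW x y = \<rho> *\<^sub>R adjoint A (A (x' - x)) + \<rho> *\<^sub>R adjoint A (B (y' - y))"
  by (simp add: GW_def A.diff B.diff A'.add A'.diff algebra_simps)

lemma GP_diff: "GP x' y' - GP x y = \<rho> *\<^sub>R adjoint B (A (x' - x)) + \<rho> *\<^sub>R adjoint B (B (y' - y))"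
  by (simp add: GP_def A.diff B.diff B'.add B'.diff algebra_simps)

lemma e_bound: "(norm (e k))\<^sup>2 \<le> 2 * (\<sigma> * \<xi> + \<kappa>1)\<^sup>2 * (norm (dw k))\<^sup>2 + 2 * \<kappa>3\<^sup>2 * (norm (dp (Suc k)))\<^sup>2"
proof -
  have "norm (e k) \<le> norm ((\<sigma> * (\<tau> - \<beta>)) *\<^sub>R dw k) + norm (GW (w (Suc k)) (p (Suc (Suc k))) - GW (w k) (p (Suc k)))"
    unfolding e_def by (rule norm_triangle_ineq4)
  also have "\<dots> \<le> (\<sigma> * \<xi>) * norm (dw k) + (\<kappa>1 * norm (dw k) + \<kappa>3 * norm (dp (Suc k)))"
  proof (intro add_mono)
    show "norm ((\<sigma> * (\<tau> - \<beta>)) *\<^sub>R dw k) \<le> (\<sigma> * \<xi>) * norm (dw k)"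
      using \<sigma> by (simp add: \<xi>_def abs_mult)
    have "norm (GW (w (Suc k)) (p (Suc (Suc k))) - GW (w k) (p (Suc k)))
       \<le> norm (\<rho> *\<^sub>R adjoint A (A (dw k))) + norm (\<rho> *\<^sub>R adjoint A (B (dp (Suc k))))"
      unfolding GW_diff dw_def dp_def by (rule norm_triangle_ineq)
    then show "norm (GW (w (Suc k)) (p (Suc (Suc k))) - GW (w k) (p (Suc k)))
       \<le> \<kappa>1 * norm (dw k) + \<kappa>3 * norm (dp (Suc k))"
      using lip1[of "dw k"] lip3[of "dp (Suc k)"] \<rho> by simp
  qed
  finally have "norm (e k) \<le> (\<sigma> * \<xi> + \<kappa>1) * norm (dw k) + \<kappa>3 * norm (dp (Suc k))" (is "_ \<le> ?s + ?t")
    by (simp add: algebra_simps)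
  then have "(norm (e k))\<^sup>2 \<le> (?s + ?t)\<^sup>2" by (intro power_mono) auto
  also have "\<dots> \<le> 2 * ?s\<^sup>2 + 2 * ?t\<^sup>2"
    using zero_le_power2[of "?s - ?t"] by (simp add: power2_eq_square algebra_simps)
  finally show ?thesis by (simp add: power_mult_distrib)
qed

section \<open>The Lyapunov function\<close>

text \<open>\<open>T\<close> equals \<open>(4 * a / \<sigma>) * (1 - \<sigma>)\<close>. Convexity of
  the squared norm in \<open>d_rec\<close>, weighted by \<open>4 * a / \<sigma>\<close>, reproduces
  the term with weight \<open>T\<close> and leaves \<open>4 * a\<close> times the square of
  \<open>norm (d (Suc k))\<close> to spare. Up to a term in \<open>dw (Suc k)\<close> this dominates
  \<open>2 * a\<close> times the square of \<open>norm (du (Suc k))\<close>: one half pays for the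
  increase in \<open>Lag_descent\<close>, the other half is kept as decrease. \<open>Kc\<close> is
  the weight of \<open>dw k\<close> left over by \<open>e_bound\<close>.\<close>

definition T where "T = 4 * a / \<sigma> - 4 * a"
definition Kc where "Kc = 8 * a * (\<sigma> * \<xi> + \<kappa>1)\<^sup>2"
definition cp where "cp = (\<mu> - \<kappa>2) / 2 - 8 * a * \<kappa>3\<^sup>2"
definition cw where "cw = \<tau> - (\<kappa>1 + \<beta>) / 2 - 4 * a * \<sigma>\<^sup>2 * \<xi>\<^sup>2 - Kc"
text \<open>\<open>Lag\<close> is taken at \<open>Suc k\<close> because \<open>z (Suc k)\<close> is
  feasible for every \<open>k\<close>, while \<open>z 0\<close> may not be.\<close>

definition \<Psi> where "\<Psi> k = Lag (Suc k) + T * (norm (d k))\<^sup>2 + Kc * (norm (dw k))\<^sup>2"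

lemma T_nonneg: "0 \<le> T"
proof -
  have "a \<le> a / \<sigma>" using a_pos \<sigma> by (simp add: field_simps)
  then show ?thesis by (simp add: T_def)
qed

lemma Kc_nonneg: "0 \<le> Kc" using a_pos by (simp add: Kc_def)

lemma cp_pos: "0 < cp"
  using \<mu>_gt \<sigma> \<beta> by (simp add: cp_def a_def field_simps)

lemma cw_pos: "0 < cw"
proof -
  \<comment> \<open>The coefficient 12 is 4 from the shift in \<open>d\<close> plus 8 from the
    square in \<open>Kc\<close>; the remaining two terms also come from that square.\<close>
  have "4 * a * \<sigma>\<^sup>2 * \<xi>\<^sup>2 + Kc = 12 * \<sigma> * \<xi>\<^sup>2 / \<beta> + 16 * \<kappa>1 * \<xi> / \<beta> + 8 * \<kappa>1\<^sup>2 / (\<sigma> * \<beta>)"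
    using \<sigma> \<beta> by (simp add: Kc_def a_def power2_eq_square divide_simps) (simp add: algebra_simps)
  then show ?thesis using \<tau>_gt by (simp add: cw_def \<xi>_def)
qed

lemma \<Psi>_descent:
  "\<Psi> (Suc k) \<le> \<Psi> k - a * (norm (du (Suc k)))\<^sup>2 - cp * (norm (dp (Suc k)))\<^sup>2 - cw * (norm (dw (Suc k)))\<^sup>2"
proof -
  define ND ND' DU DW DW' DP where "ND = (norm (d k))\<^sup>2" and "ND' = (norm (d (Suc k)))\<^sup>2"
    and "DU = (norm (du (Suc k)))\<^sup>2" and "DW = (norm (dw k))\<^sup>2" and "DW' = (norm (dw (Suc k)))\<^sup>2"
    and "DP = (norm (dp (Suc k)))\<^sup>2"
  note defs = this
  have 1: "Lag (Suc (Suc k)) \<le> Lag (Suc k) - (\<mu> - \<kappa>2) / 2 * DP - (\<tau> - (\<kappa>1 + \<beta>) / 2) * DW' + a * DU"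
    unfolding defs by (rule Lag_descent[OF z_in])
  have "DU \<le> 2 * ND' + 2 * \<sigma>\<^sup>2 * \<xi>\<^sup>2 * DW'"
  proof -
    let ?v = "(\<sigma> * (\<tau> - \<beta>)) *\<^sub>R dw (Suc k)"
    have "DU = (norm (d (Suc k) - ?v))\<^sup>2" by (simp add: DU_def d_def)
    moreover have "(norm (q - r))\<^sup>2 + (norm (q + r))\<^sup>2 = 2 * (norm q)\<^sup>2 + 2 * (norm r)\<^sup>2" for q r :: 'w
      by (simp add: power2_norm_eq_inner inner_simps inner_commute)
    from this[of "d (Suc k)" ?v]
    have "(norm (d (Suc k) - ?v))\<^sup>2 + (norm (d (Suc k) + ?v))\<^sup>2 = 2 * ND' + 2 * (norm ?v)\<^sup>2"
      unfolding ND'_def .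
    moreover have "norm ?v = \<sigma> * \<xi> * norm (dw (Suc k))" using \<sigma> by (simp add: \<xi>_def abs_mult)
    then have "(norm ?v)\<^sup>2 = \<sigma>\<^sup>2 * \<xi>\<^sup>2 * DW'"
      by (simp only: DW'_def power_mult_distrib)
    ultimately show ?thesis using zero_le_power2[of "norm (d (Suc k) + ?v)"] by linarith
  qed
  then have 2: "2 * a * DU \<le> 4 * a * ND' + 4 * a * \<sigma>\<^sup>2 * \<xi>\<^sup>2 * DW'"
    using mult_left_mono[of DU _ "2 * a"] a_pos by (fastforce simp: algebra_simps)
  have "ND' \<le> (1 - \<sigma>) * ND + \<sigma> * (norm (e k))\<^sup>2"
    unfolding defs d_rec using \<sigma> by (intro convex_combination_norm_sq_le) auto
  also have "\<dots> \<le> (1 - \<sigma>) * ND + \<sigma> * (2 * (\<sigma> * \<xi> + \<kappa>1)\<^sup>2 * DW + 2 * \<kappa>3\<^sup>2 * DP)"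
    using e_bound[of k] \<sigma> unfolding defs by (intro add_left_mono mult_left_mono) auto
  finally have "(4 * a / \<sigma>) * ND' \<le> (4 * a / \<sigma>) * ((1 - \<sigma>) * ND + \<sigma> * (2 * (\<sigma> * \<xi> + \<kappa>1)\<^sup>2 * DW + 2 * \<kappa>3\<^sup>2 * DP))"
    using a_pos \<sigma> by (intro mult_left_mono) auto
  also have "\<dots> = T * ND + Kc * DW + 8 * a * \<kappa>3\<^sup>2 * DP"
    using \<sigma> by (simp add: T_def Kc_def field_simps)
  finally have 3: "(4 * a / \<sigma>) * ND' \<le> T * ND + Kc * DW + 8 * a * \<kappa>3\<^sup>2 * DP" .
  have "T * ND' = (4 * a / \<sigma>) * ND' - 4 * a * ND'" by (simp add: T_def left_diff_distrib)
  moreover have "cp * DP = (\<mu> - \<kappa>2) / 2 * DP - 8 * a * \<kappa>3\<^sup>2 * DP" by (simp add: cp_def left_diff_distrib)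
  moreover have "cw * DW' = (\<tau> - (\<kappa>1 + \<beta>) / 2) * DW' - 4 * a * \<sigma>\<^sup>2 * \<xi>\<^sup>2 * DW' - Kc * DW'"
    by (simp add: cw_def left_diff_distrib)
  ultimately show ?thesis using 1 2 3 unfolding \<Psi>_def defs[symmetric] by linarith
qed

lemma \<Psi>_decreasing: "decseq \<Psi>"
proof (rule decseq_SucI)
  fix k show "\<Psi> (Suc k) \<le> \<Psi> k"
    using \<Psi>_descent[of k] a_pos cp_pos cw_pos
    by (smt (verit) mult_nonneg_nonneg zero_le_power2)
qed

text \<open>
  Only the coupling term \<open>u \<bullet> (w - z)\<close> can be negative, and it dominates an increment of
  \<open>\<parallel>u\<parallel>\<^sup>2\<close>. So a negative value of the decreasing sequence \<open>\<Psi>\<close> would make these increments sum to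
  \<open>-\<infinity>\<close>.
\<close>

lemma \<Psi>_ge_increment: "a / 2 * ((norm (u (Suc k)))\<^sup>2 - (norm (u k))\<^sup>2) \<le> \<Psi> k"
proof -
  have "0 \<le> c \<bullet> z (Suc k)" using c0 z_in[of k] by (meson less_imp_le mult_nonneg_nonneg norm_ge_zero order.trans)
  moreover have "0 \<le> H (w (Suc k)) (p (Suc k))" using \<rho> by (simp add: H_def)
  ultimately have "u (Suc k) \<bullet> (a *\<^sub>R du k) \<le> Lag (Suc k)"
    using g0[of "p (Suc k)"] \<beta> unfolding Lag_def w_minus_z by simp
  moreover have "u (Suc k) \<bullet> (a *\<^sub>R du k) = a / 2 * ((norm (u (Suc k)))\<^sup>2 - (norm (u k))\<^sup>2) + a / 2 * (norm (du k))\<^sup>2"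
    by (simp add: du_def power2_norm_eq_inner inner_simps inner_commute algebra_simps)
  moreover have "0 \<le> a / 2 * (norm (du k))\<^sup>2" using a_pos by simp
  moreover have "0 \<le> T * (norm (d k))\<^sup>2" "0 \<le> Kc * (norm (dw k))\<^sup>2" using T_nonneg Kc_nonneg by auto
  ultimately show ?thesis unfolding \<Psi>_def by linarith
qed

lemma \<Psi>_nonneg: "0 \<le> \<Psi> j"
proof (rule ccontr)
  assume "\<not> 0 \<le> \<Psi> j"
  then have neg: "\<Psi> j < 0" by simp
  have lower: "- (a / 2 * (norm (u j))\<^sup>2) \<le> real n * \<Psi> j" for n
  proof -
    have "a / 2 * ((norm (u (j + n)))\<^sup>2 - (norm (u j))\<^sup>2)
        = (\<Sum>i<n. a / 2 * ((norm (u (Suc (j + i))))\<^sup>2 - (norm (u (j + i)))\<^sup>2))"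
      unfolding sum_distrib_left[symmetric]
      using sum_lessThan_telescope[of "\<lambda>i. (norm (u (j + i)))\<^sup>2" n] by simp
    also have "\<dots> \<le> (\<Sum>i<n. \<Psi> j)"
      using \<Psi>_decreasing by (intro sum_mono order.trans[OF \<Psi>_ge_increment]) (simp add: decseq_def)
    finally have "a / 2 * ((norm (u (j + n)))\<^sup>2 - (norm (u j))\<^sup>2) \<le> real n * \<Psi> j" by simp
    moreover have "0 \<le> a / 2 * (norm (u (j + n)))\<^sup>2" using a_pos by simp
    ultimately show ?thesis by (simp add: right_diff_distrib)
  qed
  have "0 < - \<Psi> j" using neg by simp
  from reals_Archimedean3[OF this] obtain n where "a / 2 * (norm (u j))\<^sup>2 < real n * (- \<Psi> j)"
    by blast
  with lower[of n] show False by simp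
qed

section \<open>Vanishing steps and bounded iterates\<close>

text \<open>Increments of \<open>z\<close> are left out: by \<open>w_minus_z\<close> they are
  controlled by those of \<open>w\<close> and two consecutive ones of \<open>u\<close>.\<close>

definition \<delta> where "\<delta> k = norm (dw k) + norm (dp k) + norm (du k)"

lemma \<delta>_nonneg: "0 \<le> \<delta> k" by (simp add: \<delta>_def)

lemma sq_sum_three_le: "(r + s + t)\<^sup>2 \<le> 3 * (r\<^sup>2 + s\<^sup>2 + t\<^sup>2)" for r s t :: real
  using zero_le_power2[of "r - s"] zero_le_power2[of "s - t"] zero_le_power2[of "r - t"]
  by (simp add: power2_eq_square algebra_simps)

lemma sufficient_decrease:
  obtains m where "0 < m" "\<And>k. m * (\<delta> (Suc k))\<^sup>2 \<le> \<Psi> k - \<Psi> (Suc k)"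
proof -
  define m where "m = min a (min cp cw)"
  have m: "0 < m" "m \<le> a" "m \<le> cp" "m \<le> cw" using a_pos cp_pos cw_pos by (auto simp: m_def)
  have "m / 3 * (\<delta> (Suc k))\<^sup>2 \<le> \<Psi> k - \<Psi> (Suc k)" for k
  proof -
    have "m / 3 * (\<delta> (Suc k))\<^sup>2 \<le> m / 3 * (3 * ((norm (dw (Suc k)))\<^sup>2 + (norm (dp (Suc k)))\<^sup>2 + (norm (du (Suc k)))\<^sup>2))"
      unfolding \<delta>_def using m by (intro mult_left_mono sq_sum_three_le) auto
    also have "\<dots> = m * (norm (dw (Suc k)))\<^sup>2 + m * (norm (dp (Suc k)))\<^sup>2 + m * (norm (du (Suc k)))\<^sup>2"
      by (simp add: algebra_simps)
    also have "\<dots> \<le> cw * (norm (dw (Suc k)))\<^sup>2 + cp * (norm (dp (Suc k)))\<^sup>2 + a * (norm (du (Suc k)))\<^sup>2"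
      using m by (intro add_mono mult_right_mono) auto
    also have "\<dots> \<le> \<Psi> k - \<Psi> (Suc k)" using \<Psi>_descent[of k] by simp
    finally show ?thesis .
  qed
  then show ?thesis using m by (intro that[of "m / 3"]) auto
qed

lemma \<delta>_tendsto_0: "\<delta> \<longlonglongrightarrow> 0"
proof -
  obtain m where m: "0 < m" "\<And>k. m * (\<delta> (Suc k))\<^sup>2 \<le> \<Psi> k - \<Psi> (Suc k)"
    using sufficient_decrease by blast
  obtain l where l: "\<Psi> \<longlonglongrightarrow> l"
    by (rule decseq_convergent[OF \<Psi>_decreasing allI[OF \<Psi>_nonneg]])
  have "(\<lambda>k. (\<Psi> k - \<Psi> (Suc k)) / m) \<longlonglongrightarrow> (l - l) / m"
    using m by (intro tendsto_divide tendsto_diff l LIMSEQ_Suc[OF l] tendsto_const) auto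
  then have lim: "(\<lambda>k. (\<Psi> k - \<Psi> (Suc k)) / m) \<longlonglongrightarrow> 0" by simp
  have "(\<lambda>k. (\<delta> (Suc k))\<^sup>2) \<longlonglongrightarrow> 0"
  proof (rule tendsto_sandwich[OF _ _ tendsto_const lim])
    show "\<forall>\<^sub>F n in sequentially. (\<delta> (Suc n))\<^sup>2 \<le> (\<Psi> n - \<Psi> (Suc n)) / m"
      using m by (simp add: field_simps)
  qed simp
  then have "(\<lambda>k. sqrt ((\<delta> (Suc k))\<^sup>2)) \<longlonglongrightarrow> sqrt 0" by (intro tendsto_intros)
  then show ?thesis by (simp add: \<delta>_nonneg filterlim_sequentially_Suc)
qed

lemma \<delta>_bounds: "norm (dw k) \<le> \<delta> k" "norm (dp k) \<le> \<delta> k" "norm (du k) \<le> \<delta> k"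
  by (simp_all add: \<delta>_def)

lemma \<xi>_nonneg: "0 \<le> \<xi>" by (simp add: \<xi>_def)

definition Cu where "Cu = 1 + 1 / \<sigma> + \<xi> + \<kappa>1"

lemma Cu_nonneg: "0 \<le> Cu" using \<sigma> \<kappa>1 \<xi>_nonneg by (simp add: Cu_def)

lemma u_plus_gradient: "norm (u (Suc k) + GW (w (Suc k)) (p (Suc k))) \<le> Cu * \<delta> k"
proof -
  have "u k + GW (w k) (p (Suc k)) = - (1 / \<sigma>) *\<^sub>R du k + (\<beta> - \<tau>) *\<^sub>R dw k"
    by (subst u_eq) simp
  moreover have "u (Suc k) + GW (w (Suc k)) (p (Suc k)) = du k + (u k + GW (w k) (p (Suc k)))
      + (GW (w (Suc k)) (p (Suc k)) - GW (w k) (p (Suc k)))"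
    by (simp add: du_def)
  ultimately have "u (Suc k) + GW (w (Suc k)) (p (Suc k))
     = du k + (- (1 / \<sigma>) *\<^sub>R du k) + (\<beta> - \<tau>) *\<^sub>R dw k + (GW (w (Suc k)) (p (Suc k)) - GW (w k) (p (Suc k)))"
    by (simp only: add.assoc)
  also have "\<dots> = du k + (- (1 / \<sigma>) *\<^sub>R du k) + (\<beta> - \<tau>) *\<^sub>R dw k + \<rho> *\<^sub>R adjoint A (A (dw k))"
    unfolding GW_diff by (simp add: dw_def B.zero A'.zero)
  also have "norm \<dots> \<le> norm (du k) + norm (- (1 / \<sigma>) *\<^sub>R du k) + norm ((\<beta> - \<tau>) *\<^sub>R dw k) + norm (\<rho> *\<^sub>R adjoint A (A (dw k)))"
    by (rule order.trans[OF norm_triangle_ineq add_right_mono[OF order.trans[OF norm_triangle_ineq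
      add_right_mono[OF norm_triangle_ineq]]]])
  also have "\<dots> \<le> \<delta> k + 1 / \<sigma> * \<delta> k + \<xi> * \<delta> k + \<kappa>1 * \<delta> k"
  proof (intro add_mono)
    show "norm (- (1 / \<sigma>) *\<^sub>R du k) \<le> 1 / \<sigma> * \<delta> k" using \<sigma> \<delta>_bounds(3)[of k] by (simp add: divide_right_mono)
    show "norm ((\<beta> - \<tau>) *\<^sub>R dw k) \<le> \<xi> * \<delta> k"
      using mult_left_mono[OF \<delta>_bounds(1)[of k] \<xi>_nonneg] by (simp add: \<xi>_def abs_minus_commute)
    show "norm (\<rho> *\<^sub>R adjoint A (A (dw k))) \<le> \<kappa>1 * \<delta> k"
      using order.trans[OF lip1[of "dw k"] mult_left_mono[OF \<delta>_bounds(1)[of k] \<kappa>1]] \<rho> by simp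
  qed (rule \<delta>_bounds)
  also have "\<dots> = Cu * \<delta> k" by (simp add: Cu_def algebra_simps)
  finally show ?thesis .
qed

text \<open>In the coupling term, \<open>u\<close> is replaced by \<open>- GW\<close> with an error
  controlled by \<open>u_plus_gradient\<close>. What remains is an inner product of the residual
  with \<open>A (a *\<^sub>R du k)\<close>, which Young's inequality absorbs into half of
  \<open>H\<close>. The bound on \<open>Lag\<close> then controls \<open>z\<close> through the
  linear growth of \<open>c\<close> on \<open>K\<close>, and also the residual; \<open>p\<close>
  follows because \<open>B\<close> is bounded below.\<close>

lemma iterates_bounded:
  obtains r where "\<And>k. norm (z (Suc k)) \<le> r" "\<And>k. norm (p (Suc k)) \<le> r"
proof -
  have "Bseq \<delta>" using \<delta>_tendsto_0 by (intro convergent_imp_Bseq convergentI)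
  then obtain D where "\<And>k. norm (\<delta> k) \<le> D" by (rule BseqE) blast
  then have D: "\<delta> k \<le> D" for k by (metis abs_le_D1 real_norm_def)
  have D0: "0 \<le> D" using D[of 0] \<delta>_nonneg[of 0] by linarith
  define N where "N = \<Psi> 0 + (\<kappa>1 * a\<^sup>2 + Cu * a) * D\<^sup>2"
  \<comment> \<open>Linear bookkeeping only: \<open>n\<close> is the squared residual,
    \<open>rv\<close> the product absorbed by Young's inequality, \<open>q\<close> and
    \<open>q'\<close> the two error bounds collected in \<open>N\<close>.\<close>
  have arith: "s + \<rho> / 4 * n \<le> N" if "gv = rv" "0 \<le> \<rho> / 4 * n - rv + av" "av \<le> q" "- q' \<le> ugv" "l \<le> \<Psi> 0"
      "s + h + uv \<le> l" "N = \<Psi> 0 + q + q'" "h = \<rho> / 2 * n" "ugv = uv + gv" for s n gv rv av q q' ugv l h uv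
    using that by linarith
  have key: "c0 * norm (z (Suc k)) + \<rho> / 4 * (norm (A (w (Suc k)) + B (p (Suc k))))\<^sup>2 \<le> N" for k
  proof -
    let ?r = "A (w (Suc k)) + B (p (Suc k))" and ?v = "a *\<^sub>R du k" and ?G = "GW (w (Suc k)) (p (Suc k))"
    have sq: "(norm ?v)\<^sup>2 \<le> a\<^sup>2 * D\<^sup>2"
      unfolding power_mult_distrib[symmetric] using a_pos order.trans[OF \<delta>_bounds(3) D, of k]
      by (intro power_mono) auto
    show ?thesis
    proof (rule arith)
      show "?G \<bullet> ?v = \<rho> * (?r \<bullet> A ?v)"
        using adjoint_A[of ?v ?r] by (simp add: GW_def inner_commute)
      have "0 \<le> \<rho> * ((?r - 2 *\<^sub>R A ?v) \<bullet> (?r - 2 *\<^sub>R A ?v))" using \<rho> by simp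
      then show "0 \<le> \<rho> / 4 * (norm ?r)\<^sup>2 - \<rho> * (?r \<bullet> A ?v) + \<rho> * (norm (A ?v))\<^sup>2"
        by (simp add: power2_norm_eq_inner inner_simps inner_commute algebra_simps)
      show "\<rho> * (norm (A ?v))\<^sup>2 \<le> \<kappa>1 * (a\<^sup>2 * D\<^sup>2)"
        by (rule order.trans[OF A_bound mult_left_mono[OF sq \<kappa>1]])
      have "norm (u (Suc k) + ?G) * norm ?v \<le> (Cu * D) * (a * D)"
      proof (rule mult_mono)
        show "norm (u (Suc k) + ?G) \<le> Cu * D"
          by (rule order.trans[OF u_plus_gradient mult_left_mono[OF D Cu_nonneg]])
        show "norm ?v \<le> a * D" using order.trans[OF \<delta>_bounds(3) D, of k] a_pos by simp
      qed (use Cu_nonneg D0 in auto)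
      then show "- ((Cu * D) * (a * D)) \<le> (u (Suc k) + ?G) \<bullet> ?v"
        using Cauchy_Schwarz_ineq2[of "u (Suc k) + ?G" ?v] by linarith
      have "\<Psi> k \<le> \<Psi> 0" using \<Psi>_decreasing by (simp add: decseq_def)
      moreover have "0 \<le> T * (norm (d k))\<^sup>2" "0 \<le> Kc * (norm (dw k))\<^sup>2" using T_nonneg Kc_nonneg by auto
      ultimately show "Lag (Suc k) \<le> \<Psi> 0" by (simp add: \<Psi>_def)
      have "0 \<le> \<beta> / 2 * (norm ?v)\<^sup>2" using \<beta> by simp
      then show "c0 * norm (z (Suc k)) + H (w (Suc k)) (p (Suc k)) + u (Suc k) \<bullet> ?v \<le> Lag (Suc k)"
        using c0(2)[OF z_in[of k]] g0[of "p (Suc k)"] unfolding Lag_def w_minus_z by linarith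
      show "N = \<Psi> 0 + \<kappa>1 * (a\<^sup>2 * D\<^sup>2) + (Cu * D) * (a * D)"
        by (simp add: N_def power2_eq_square algebra_simps)
      show "H (w (Suc k)) (p (Suc k)) = \<rho> / 2 * (norm ?r)\<^sup>2" by (simp add: H_def)
      show "(u (Suc k) + ?G) \<bullet> ?v = u (Suc k) \<bullet> ?v + ?G \<bullet> ?v" by (rule inner_add_left)
    qed
  qed
  have zb: "norm (z (Suc k)) \<le> N / c0" for k
  proof -
    have "0 \<le> \<rho> / 4 * (norm (A (w (Suc k)) + B (p (Suc k))))\<^sup>2" using \<rho> by simp
    with key[of k] have "c0 * norm (z (Suc k)) \<le> N" by linarith
    then show ?thesis using c0 by (simp add: field_simps)
  qed
  have rb: "norm (A (w (Suc k)) + B (p (Suc k))) \<le> sqrt (4 * N / \<rho>)" for k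
  proof (rule real_le_rsqrt)
    have "0 \<le> c0 * norm (z (Suc k))" using c0 by simp
    with key[of k] have "\<rho> / 4 * (norm (A (w (Suc k)) + B (p (Suc k))))\<^sup>2 \<le> N" by linarith
    then show "(norm (A (w (Suc k)) + B (p (Suc k))))\<^sup>2 \<le> 4 * N / \<rho>" using \<rho> by (simp add: field_simps)
  qed
  obtain KA where KA: "0 < KA" "\<And>x. norm (A x) \<le> KA * norm x" using linear_bounded_pos[OF linA] by blast
  have pb: "norm (p (Suc k)) \<le> (sqrt (4 * N / \<rho>) + KA * (N / c0 + a * D)) / b0" for k
  proof -
    have "w (Suc k) = z (Suc k) + a *\<^sub>R du k" using w_minus_z[of k] by (simp add: algebra_simps)
    then have "norm (w (Suc k)) \<le> N / c0 + a * D"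
    proof -
      have "norm (a *\<^sub>R du k) \<le> a * D"
        using mult_left_mono[OF order.trans[OF \<delta>_bounds(3) D, of k] less_imp_le[OF a_pos]] a_pos by simp
      with zb[of k] show ?thesis
        unfolding \<open>w (Suc k) = _\<close> by (intro norm_triangle_le) linarith
    qed
    then have "norm (A (w (Suc k))) \<le> KA * (N / c0 + a * D)"
      using KA(1) by (intro order.trans[OF KA(2)] mult_left_mono) auto
    then have "norm (B (p (Suc k))) \<le> sqrt (4 * N / \<rho>) + KA * (N / c0 + a * D)"
      using rb[of k] norm_triangle_ineq4[of "A (w (Suc k)) + B (p (Suc k))" "A (w (Suc k))"] by simp
    then have "b0 * norm (p (Suc k)) \<le> sqrt (4 * N / \<rho>) + KA * (N / c0 + a * D)"
      using b0(2)[of "p (Suc k)"] by linarith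
    then show ?thesis using b0(1) by (simp add: field_simps)
  qed
  show ?thesis
    using zb pb by (intro that[of "max (N / c0) ((sqrt (4 * N / \<rho>) + KA * (N / c0 + a * D)) / b0)"])
      (auto simp: le_max_iff_disj)
qed

section \<open>Subgradients along the iteration and the comparison of \<open>\<Psi>\<close> with the
  objective\<close>

definition F where "F y = c \<bullet> fst y + H (fst y) (snd y)" for y :: "'w \<times> 'p"
text \<open>The point uses \<open>z\<close> rather than \<open>w\<close>, since only
  \<open>z\<close> is known to lie in \<open>K\<close>.\<close>

definition X where "X k = (z (Suc k), p (Suc k))"
definition D where "D k = (u k + \<beta> *\<^sub>R (w k - z (Suc k)) + GW (z (Suc k)) (p (Suc k)),
   GP (z (Suc k)) (p (Suc k)) - GP (w k) (p k) - \<mu> *\<^sub>R dp k)"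

lemma H_lower: "H x y + GW x y \<bullet> (x' - x) + GP x y \<bullet> (y' - y) \<le> H x' y'"
proof -
  have "A x' + B y' = (A x + B y) + (A (x' - x) + B (y' - y))" by (simp add: A.diff B.diff)
  moreover have "GW x y \<bullet> (x' - x) = \<rho> * ((A x + B y) \<bullet> A (x' - x))"
    using adjoint_A[of "x' - x" "A x + B y"] by (simp add: GW_def inner_commute)
  moreover have "GP x y \<bullet> (y' - y) = \<rho> * ((A x + B y) \<bullet> B (y' - y))"
    using adjoint_B[of "y' - y" "A x + B y"] by (simp add: GP_def inner_commute)
  moreover have "\<rho> / 2 * (norm (q + (r + s)))\<^sup>2 = \<rho> / 2 * (norm q)\<^sup>2 + \<rho> * (q \<bullet> r) + \<rho> * (q \<bullet> s) + \<rho> / 2 * (norm (r + s))\<^sup>2" for q r s :: 'r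
    by (simp add: power2_norm_eq_inner inner_simps inner_commute algebra_simps)
  ultimately have "H x' y' = H x y + GW x y \<bullet> (x' - x) + GP x y \<bullet> (y' - y)
      + \<rho> / 2 * (norm (A (x' - x) + B (y' - y)))\<^sup>2"
    by (simp only: H_def)
  then show ?thesis using \<rho> by simp
qed

lemma D_subgradient:
  assumes "subspace L" "p (Suc k) \<in> L" "\<And>v. v \<in> L \<Longrightarrow> (GP (w k) (p k) + \<mu> *\<^sub>R dp k) \<bullet> v = 0"
    and y: "y \<in> K \<times> L"
  shows "F (X k) + D k \<bullet> (y - X k) \<le> F y"
proof -
  obtain y1 y2 where y12: "y = (y1, y2)" "y1 \<in> K" "y2 \<in> L" using y by blast
  have "(GP (w k) (p k) + \<mu> *\<^sub>R dp k) \<bullet> (y2 - p (Suc k)) = 0"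
    by (intro assms subspace_diff y12)
  then have "D k \<bullet> (y - X k) = (u k + \<beta> *\<^sub>R (w k - z (Suc k))) \<bullet> (y1 - z (Suc k))
     + GW (z (Suc k)) (p (Suc k)) \<bullet> (y1 - z (Suc k)) + GP (z (Suc k)) (p (Suc k)) \<bullet> (y2 - p (Suc k))"
    unfolding D_def X_def y12 diff_Pair inner_Pair
    by (simp only: inner_add_left inner_diff_left)
  moreover have "F (X k) = c \<bullet> z (Suc k) + H (z (Suc k)) (p (Suc k))" "F y = c \<bullet> y1 + H y1 y2"
    by (simp_all add: F_def X_def y12)
  ultimately show ?thesis
    using z_step[OF y12(2), of k] H_lower[of "z (Suc k)" "p (Suc k)" y1 y2] by (simp add: inner_diff_right)
qed

lemma w_minus_z': "z (Suc k) - w k = dw k - a *\<^sub>R du k"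
  using w_minus_z[of k] by (simp add: dw_def algebra_simps)

lemma D_bound:
  obtains CD where "0 \<le> CD" "\<And>k. norm (D k) \<le> CD * \<delta> k"
proof -
  obtain K1 where K1: "0 < K1" "\<And>x. norm (adjoint A x) \<le> K1 * norm x"
    using linear_bounded_pos[OF A'.linear_axioms] by blast
  obtain K2 where K2: "0 < K2" "\<And>x. norm (adjoint B x) \<le> K2 * norm x"
    using linear_bounded_pos[OF B'.linear_axioms] by blast
  obtain K3 where K3: "0 < K3" "\<And>x. norm (A x) \<le> K3 * norm x"
    using linear_bounded_pos[OF linA] by blast
  obtain K4 where K4: "0 < K4" "\<And>x. norm (B x) \<le> K4 * norm x"
    using linear_bounded_pos[OF linB] by blast
  have zw: "norm (z (Suc k) - w k) \<le> (1 + a) * \<delta> k" for k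
  proof -
    have "norm (z (Suc k) - w k) \<le> norm (dw k) + norm (a *\<^sub>R du k)"
      unfolding w_minus_z' by (rule norm_triangle_ineq4)
    also have "\<dots> \<le> \<delta> k + a * \<delta> k"
      using a_pos \<delta>_bounds[of k] by (intro add_mono) auto
    finally show ?thesis by (simp add: algebra_simps)
  qed
  have Azw: "norm (A (z (Suc k) - w k)) \<le> K3 * ((1 + a) * \<delta> k)" for k
    using K3 by (intro order.trans[OF K3(2)] mult_left_mono zw) auto
  have Bdp: "norm (B (dp k)) \<le> K4 * \<delta> k" for k
    using K4 by (intro order.trans[OF K4(2)] mult_left_mono \<delta>_bounds) auto
  have 1: "norm (fst (D k)) \<le> (1 / \<sigma> + \<xi> + \<beta> * (1 + a) + \<rho> * (K1 * (K3 * (1 + a)))) * \<delta> k" for k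
  proof -
    have "u k + GW (w k) (p (Suc k)) = - (1 / \<sigma>) *\<^sub>R du k + (\<beta> - \<tau>) *\<^sub>R dw k"
      by (subst u_eq) simp
    then have "fst (D k) = - (1 / \<sigma>) *\<^sub>R du k + (\<beta> - \<tau>) *\<^sub>R dw k - \<beta> *\<^sub>R (z (Suc k) - w k)
       + (GW (z (Suc k)) (p (Suc k)) - GW (w k) (p (Suc k)))"
      by (simp add: D_def algebra_simps)
    also have "\<dots> = - (1 / \<sigma>) *\<^sub>R du k + (\<beta> - \<tau>) *\<^sub>R dw k - \<beta> *\<^sub>R (z (Suc k) - w k)
       + \<rho> *\<^sub>R adjoint A (A (z (Suc k) - w k))"
      unfolding GW_diff by (simp add: B.zero A'.zero)
    also have "norm \<dots> \<le> norm (- (1 / \<sigma>) *\<^sub>R du k) + norm ((\<beta> - \<tau>) *\<^sub>R dw k) + norm (\<beta> *\<^sub>R (z (Suc k) - w k))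
       + norm (\<rho> *\<^sub>R adjoint A (A (z (Suc k) - w k)))"
      by (rule order.trans[OF norm_triangle_ineq add_right_mono[OF order.trans[OF norm_triangle_ineq4
        add_right_mono[OF norm_triangle_ineq]]]])
    also have "\<dots> \<le> 1 / \<sigma> * \<delta> k + \<xi> * \<delta> k + \<beta> * ((1 + a) * \<delta> k) + \<rho> * (K1 * (K3 * ((1 + a) * \<delta> k)))"
    proof (intro add_mono)
      show "norm (- (1 / \<sigma>) *\<^sub>R du k) \<le> 1 / \<sigma> * \<delta> k" using \<sigma> \<delta>_bounds(3)[of k] by (simp add: divide_right_mono)
      show "norm ((\<beta> - \<tau>) *\<^sub>R dw k) \<le> \<xi> * \<delta> k"
        using mult_left_mono[OF \<delta>_bounds(1)[of k] \<xi>_nonneg] by (simp add: \<xi>_def abs_minus_commute)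
      show "norm (\<beta> *\<^sub>R (z (Suc k) - w k)) \<le> \<beta> * ((1 + a) * \<delta> k)"
        using mult_left_mono[OF zw[of k], of \<beta>] \<beta> by simp
      have "norm (adjoint A (A (z (Suc k) - w k))) \<le> K1 * (K3 * ((1 + a) * \<delta> k))"
        using K1 by (intro order.trans[OF K1(2)] mult_left_mono Azw) auto
      from mult_left_mono[OF this, of \<rho>]
      show "norm (\<rho> *\<^sub>R adjoint A (A (z (Suc k) - w k))) \<le> \<rho> * (K1 * (K3 * ((1 + a) * \<delta> k)))"
        using \<rho> by simp
    qed
    finally show ?thesis by (simp add: algebra_simps)
  qed
  have 2: "norm (snd (D k)) \<le> (\<rho> * (K2 * (K3 * (1 + a))) + \<rho> * (K2 * K4) + \<bar>\<mu>\<bar>) * \<delta> k" for k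
  proof -
    have "snd (D k) = \<rho> *\<^sub>R adjoint B (A (z (Suc k) - w k)) + \<rho> *\<^sub>R adjoint B (B (dp k)) - \<mu> *\<^sub>R dp k"
      by (simp only: D_def snd_conv GP_diff dp_def)
    also have "norm \<dots> \<le> norm (\<rho> *\<^sub>R adjoint B (A (z (Suc k) - w k))) + norm (\<rho> *\<^sub>R adjoint B (B (dp k))) + norm (\<mu> *\<^sub>R dp k)"
      by (rule order.trans[OF norm_triangle_ineq4 add_right_mono[OF norm_triangle_ineq]])
    also have "\<dots> \<le> \<rho> * (K2 * (K3 * ((1 + a) * \<delta> k))) + \<rho> * (K2 * (K4 * \<delta> k)) + \<bar>\<mu>\<bar> * \<delta> k"
    proof (intro add_mono)
      have "norm (adjoint B (A (z (Suc k) - w k))) \<le> K2 * (K3 * ((1 + a) * \<delta> k))"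
        using K2 by (intro order.trans[OF K2(2)] mult_left_mono Azw) auto
      from mult_left_mono[OF this, of \<rho>]
      show "norm (\<rho> *\<^sub>R adjoint B (A (z (Suc k) - w k))) \<le> \<rho> * (K2 * (K3 * ((1 + a) * \<delta> k)))"
        using \<rho> by simp
      have "norm (adjoint B (B (dp k))) \<le> K2 * (K4 * \<delta> k)"
        using K2 by (intro order.trans[OF K2(2)] mult_left_mono Bdp) auto
      from mult_left_mono[OF this, of \<rho>]
      show "norm (\<rho> *\<^sub>R adjoint B (B (dp k))) \<le> \<rho> * (K2 * (K4 * \<delta> k))"
        using \<rho> by simp
      show "norm (\<mu> *\<^sub>R dp k) \<le> \<bar>\<mu>\<bar> * \<delta> k" using \<delta>_bounds(2)[of k] by (simp add: mult_left_mono)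
    qed
    finally show ?thesis by (simp add: algebra_simps)
  qed
  show ?thesis
  proof (rule that)
    fix k
    show "norm (D k) \<le> ((1 / \<sigma> + \<xi> + \<beta> * (1 + a) + \<rho> * (K1 * (K3 * (1 + a))))
        + (\<rho> * (K2 * (K3 * (1 + a))) + \<rho> * (K2 * K4) + \<bar>\<mu>\<bar>)) * \<delta> k"
      unfolding distrib_right[of _ _ "\<delta> k"]
      using norm_Pair_le[of "fst (D k)" "snd (D k)"] add_mono[OF 1[of k] 2[of k]]
      by (simp add: distrib_right)
  qed (use \<sigma> \<xi>_nonneg \<beta> a_pos \<rho> K1 K2 K3 K4 in simp)
qed

text \<open>Passing from \<open>w\<close> to \<open>z\<close> leaves the first-order term
  \<open>(u + GW) \<bullet> (w - z)\<close>, in which both factors are of the size of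
  \<open>\<delta>\<close>. All other differences are already quadratic.\<close>

lemma \<Psi>_near_F:
  obtains CE where "0 \<le> CE" "\<And>k. \<bar>\<Psi> k - (F (X k) + g (p (Suc k)))\<bar> \<le> CE * (\<delta> k)\<^sup>2"
proof -
  define CE where "CE = Cu * a + \<beta> / 2 * a\<^sup>2 + \<kappa>1 / 2 * a\<^sup>2 + T * (1 + \<sigma> * \<xi>)\<^sup>2 + Kc"
  have "\<bar>\<Psi> k - (F (X k) + g (p (Suc k)))\<bar> \<le> CE * (\<delta> k)\<^sup>2" for k
  proof -
    let ?v = "a *\<^sub>R du k" and ?G = "GW (w (Suc k)) (p (Suc k))"
    define t1 t2 t3 t4 t5 where "t1 = (u (Suc k) + ?G) \<bullet> ?v" and "t2 = \<beta> / 2 * (norm ?v)\<^sup>2"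
      and "t3 = \<rho> / 2 * (norm (A ?v))\<^sup>2" and "t4 = T * (norm (d k))\<^sup>2" and "t5 = Kc * (norm (dw k))\<^sup>2"
    have "z (Suc k) - w (Suc k) = - ?v" using w_minus_z[of k] by (simp add: algebra_simps)
    then have "H (z (Suc k)) (p (Suc k)) = H (w (Suc k)) (p (Suc k)) - ?G \<bullet> ?v + t3"
      using H_expand_w[of "z (Suc k)" "p (Suc k)" "w (Suc k)"] by (simp add: A.neg t3_def)
    then have eq: "\<Psi> k - (F (X k) + g (p (Suc k))) = t1 + t2 - t3 + t4 + t5"
      unfolding \<Psi>_def Lag_def w_minus_z F_def X_def fst_conv snd_conv t1_def t2_def t4_def t5_def inner_add_left
      by linarith
    have nv: "norm ?v \<le> a * \<delta> k" using a_pos \<delta>_bounds(3)[of k] by simp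
    have nv2: "(norm ?v)\<^sup>2 \<le> a\<^sup>2 * (\<delta> k)\<^sup>2"
      unfolding power_mult_distrib[symmetric] using nv by (intro power_mono) auto
    have "\<bar>t1\<bar> \<le> norm (u (Suc k) + ?G) * norm ?v" unfolding t1_def by (rule Cauchy_Schwarz_ineq2)
    also have "\<dots> \<le> (Cu * \<delta> k) * (a * \<delta> k)"
      using u_plus_gradient[of k] nv Cu_nonneg \<delta>_nonneg[of k] by (intro mult_mono) auto
    finally have b1: "\<bar>t1\<bar> \<le> Cu * a * (\<delta> k)\<^sup>2" by (simp add: power2_eq_square mult_ac)
    have b2: "\<bar>t2\<bar> \<le> \<beta> / 2 * a\<^sup>2 * (\<delta> k)\<^sup>2"
      using mult_left_mono[OF nv2, of "\<beta> / 2"] \<beta> by (simp add: t2_def mult.assoc)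
    have "\<rho> * (norm (A ?v))\<^sup>2 \<le> \<kappa>1 * (a\<^sup>2 * (\<delta> k)\<^sup>2)"
      by (rule order.trans[OF A_bound mult_left_mono[OF nv2 \<kappa>1]])
    then have b3: "\<bar>t3\<bar> \<le> \<kappa>1 / 2 * a\<^sup>2 * (\<delta> k)\<^sup>2" using \<rho> by (simp add: t3_def abs_mult)
    have "norm (d k) \<le> norm (du k) + \<sigma> * \<xi> * norm (dw k)"
      unfolding d_def using norm_triangle_ineq[of "du k" "(\<sigma> * (\<tau> - \<beta>)) *\<^sub>R dw k"] \<sigma> by (simp add: \<xi>_def abs_mult)
    also have "\<dots> \<le> \<delta> k + \<sigma> * \<xi> * \<delta> k"
      using \<delta>_bounds[of k] \<sigma> \<xi>_nonneg by (intro add_mono mult_left_mono) auto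
    finally have "norm (d k) \<le> (1 + \<sigma> * \<xi>) * \<delta> k" by (simp add: algebra_simps)
    then have "(norm (d k))\<^sup>2 \<le> (1 + \<sigma> * \<xi>)\<^sup>2 * (\<delta> k)\<^sup>2"
      unfolding power_mult_distrib[symmetric] by (intro power_mono) auto
    then have b4: "\<bar>t4\<bar> \<le> T * (1 + \<sigma> * \<xi>)\<^sup>2 * (\<delta> k)\<^sup>2"
      using T_nonneg by (simp add: t4_def abs_mult mult_left_mono mult.assoc)
    have "(norm (dw k))\<^sup>2 \<le> (\<delta> k)\<^sup>2" using \<delta>_bounds(1)[of k] by (intro power_mono) auto
    then have b5: "\<bar>t5\<bar> \<le> Kc * (\<delta> k)\<^sup>2"
      using Kc_nonneg by (simp add: t5_def abs_mult mult_left_mono)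
    have "CE * (\<delta> k)\<^sup>2 = Cu * a * (\<delta> k)\<^sup>2 + \<beta> / 2 * a\<^sup>2 * (\<delta> k)\<^sup>2 + \<kappa>1 / 2 * a\<^sup>2 * (\<delta> k)\<^sup>2
       + T * (1 + \<sigma> * \<xi>)\<^sup>2 * (\<delta> k)\<^sup>2 + Kc * (\<delta> k)\<^sup>2"
      by (simp add: CE_def distrib_right)
    then show ?thesis unfolding eq using b1 b2 b3 b4 b5 by linarith
  qed
  moreover have "0 \<le> CE"
    using Cu_nonneg a_pos \<beta> \<kappa>1 T_nonneg Kc_nonneg by (simp add: CE_def)
  ultimately show ?thesis using that by blast
qed

lemma continuous_F: "continuous_on S F"
proof -
  show ?thesis unfolding F_def H_def
    by (intro continuous_intros linear_continuous_on_compose[OF _ linA] linear_continuous_on_compose[OF _ linB])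
qed

text \<open>
  \<open>D k\<close> is a subgradient of \<open>F\<close> on \<open>K \<times> L\<close> of size \<open>O(\<delta> k)\<close>, and \<open>\<Psi>\<close> differs from \<open>F\<close> by
  \<open>O((\<delta> k)\<^sup>2)\<close>; so the inequality for \<open>F\<close> transfers to \<open>\<Psi>\<close>.
\<close>

lemma finite_length:
  assumes L: "subspace L" and pL: "\<And>k. N \<le> k \<Longrightarrow> p k \<in> L" and gL: "\<And>k. N \<le> k \<Longrightarrow> g (p k) = G0"
    and stat: "\<And>k v. N \<le> k \<Longrightarrow> v \<in> L \<Longrightarrow> (GP (w k) (p k) + \<mu> *\<^sub>R dp k) \<bullet> v = 0"
    and KL: "\<And>x0 r. x0 \<in> K \<times> L \<Longrightarrow> (\<And>y. y \<in> K \<times> L \<Longrightarrow> F x0 \<le> F y) \<Longrightarrow>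
      \<exists>C \<theta>. 0 \<le> C \<and> 0 < \<theta> \<and> \<theta> \<le> 1 / 2 \<and> (\<forall>x\<in>K \<times> L. norm x \<le> r \<longrightarrow>
        (\<forall>d. (\<forall>y\<in>K \<times> L. F x + d \<bullet> (y - x) \<le> F y) \<longrightarrow> F x - F x0 \<le> C * norm d * (F x - F x0) powr \<theta>))"
  shows "summable \<delta>"
proof -
  obtain r where r: "\<And>k. norm (z (Suc k)) \<le> r" "\<And>k. norm (p (Suc k)) \<le> r"
    using iterates_bounded by blast
  obtain CD where CD: "0 \<le> CD" "\<And>k. norm (D k) \<le> CD * \<delta> k" using D_bound by blast
  obtain CE where CE: "0 \<le> CE" "\<And>k. \<bar>\<Psi> k - (F (X k) + g (p (Suc k)))\<bar> \<le> CE * (\<delta> k)\<^sup>2"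
    using \<Psi>_near_F by blast
  obtain m where m: "0 < m" "\<And>k. m * (\<delta> (Suc k))\<^sup>2 \<le> \<Psi> k - \<Psi> (Suc k)"
    using sufficient_decrease by blast
  define S where "S = K \<times> L"
  have XS: "X k \<in> S" if "N \<le> k" for k using that pL[of "Suc k"] z_in by (simp add: X_def S_def)
  have Xr: "norm (X k) \<le> 2 * r" for k
    using norm_Pair_le[of "z (Suc k)" "p (Suc k)"] r[of k] by (simp add: X_def)
  have sub: "F (X k) + D k \<bullet> (y - X k) \<le> F y" if "N \<le> k" "y \<in> S" for k y
    using that(2) unfolding S_def by (intro D_subgradient[OF L] pL stat) (use that(1) in auto)
  have D0: "D \<longlonglongrightarrow> 0"
  proof (rule Lim_null_comparison)
    show "(\<lambda>k. CD * \<delta> k) \<longlonglongrightarrow> 0" using tendsto_mult_right_zero[OF \<delta>_tendsto_0] by simp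
  qed (simp add: CD)
  have "compact (S \<inter> cball 0 (2 * r))"
    unfolding S_def by (intro closed_Int_compact closed_Times closedK closed_subspace L) auto
  moreover have "\<forall>k. X (N + k) \<in> S \<inter> cball 0 (2 * r)" using XS Xr by simp
  ultimately obtain x0 \<phi> where \<phi>: "x0 \<in> S \<inter> cball 0 (2 * r)" "strict_mono \<phi>" "((\<lambda>k. X (N + k)) \<circ> \<phi>) \<longlonglongrightarrow> x0"
    unfolding compact_def by (auto dest!: spec[of _ "\<lambda>k. X (N + k)"])
  \<comment> \<open>In the subgradient inequality at \<open>X k\<close> the subgradients tend to 0,
    so a subsequential limit already minimizes \<open>F\<close> globally on \<open>S\<close>. The
    gap inequality can be anchored there before convergence of the sequence is known.\<close>
  have min: "F x0 \<le> F y" if "y \<in> S" for y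
  proof (rule LIMSEQ_le_const2)
    have X: "(\<lambda>k. X (N + \<phi> k)) \<longlonglongrightarrow> x0" using \<phi>(3) by (simp add: o_def)
    have "strict_mono (\<lambda>k. N + \<phi> k)" using \<phi>(2) by (simp add: strict_mono_def)
    from LIMSEQ_subseq_LIMSEQ[OF D0 this] have D: "(\<lambda>k. D (N + \<phi> k)) \<longlonglongrightarrow> 0" by (simp add: o_def)
    have "(\<lambda>k. F (X (N + \<phi> k))) \<longlonglongrightarrow> F x0"
      by (rule continuous_on_tendsto_compose[OF continuous_F[of UNIV] X]) auto
    from tendsto_add[OF this tendsto_inner[OF D tendsto_diff[OF tendsto_const X]]]
    show "(\<lambda>k. F (X (N + \<phi> k)) + D (N + \<phi> k) \<bullet> (y - X (N + \<phi> k))) \<longlonglongrightarrow> F x0" by simp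
    show "\<exists>K. \<forall>k\<ge>K. F (X (N + \<phi> k)) + D (N + \<phi> k) \<bullet> (y - X (N + \<phi> k)) \<le> F y"
      using sub[OF _ that] by simp
  qed
  obtain C \<theta> where C: "0 \<le> C" and \<theta>: "0 < \<theta>" "\<theta> \<le> 1 / 2"
    and ineq: "\<And>x d. x \<in> S \<Longrightarrow> norm x \<le> 2 * r \<Longrightarrow> (\<And>y. y \<in> S \<Longrightarrow> F x + d \<bullet> (y - x) \<le> F y) \<Longrightarrow>
      F x - F x0 \<le> C * norm d * (F x - F x0) powr \<theta>"
  proof -
    have "\<exists>C \<theta>. 0 \<le> C \<and> 0 < \<theta> \<and> \<theta> \<le> 1 / 2 \<and> (\<forall>x\<in>S. norm x \<le> 2 * r \<longrightarrow>
        (\<forall>d. (\<forall>y\<in>S. F x + d \<bullet> (y - x) \<le> F y) \<longrightarrow> F x - F x0 \<le> C * norm d * (F x - F x0) powr \<theta>))"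
      unfolding S_def by (rule KL) (use \<phi>(1) min in \<open>simp_all add: S_def\<close>)
    then show ?thesis by (elim exE conjE) (rule that; blast)
  qed
  define ph where "ph k = F (X k) - F x0" for k
  define E where "E k = \<Psi> k - (F x0 + G0)" for k
  \<comment> \<open>Solving the gap inequality for the gap yields the power \<open>q\<close> of the
    subgradient norm. Since \<open>q \<le> 2\<close>, the quadratic error of \<open>\<Psi>\<close>
    is at most \<open>\<delta> k powr q\<close> once \<open>\<delta> k \<le> 1\<close>.\<close>
  define q where "q = 1 / (1 - \<theta>)"
  have q: "0 < q" "q \<le> 2" "q * (1 - \<theta>) = 1" using \<theta> by (auto simp: q_def field_simps)
  have ph0: "0 \<le> ph k" if "N \<le> k" for k using min[OF XS[OF that]] by (simp add: ph_def)
  have Eph: "\<bar>E k - ph k\<bar> \<le> CE * (\<delta> k)\<^sup>2" if "N \<le> k" for k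
    using CE(2)[of k] gL[of "Suc k"] that by (simp add: E_def ph_def algebra_simps)
  have E_dec: "E n \<le> E k" if "k \<le> n" for k n
    using \<Psi>_decreasing that by (simp add: E_def decseq_def)
  have E0: "0 \<le> E k" if "N \<le> k" for k
  proof (rule LIMSEQ_le_const2)
    show "(\<lambda>n. - (CE * (\<delta> n)\<^sup>2)) \<longlonglongrightarrow> 0"
    proof -
      have "(\<lambda>n. - (CE * (\<delta> n)\<^sup>2)) \<longlonglongrightarrow> - (CE * 0\<^sup>2)"
        by (intro tendsto_minus tendsto_mult tendsto_power tendsto_const \<delta>_tendsto_0)
      then show ?thesis by simp
    qed
    have "- (CE * (\<delta> n)\<^sup>2) \<le> E k" if "k \<le> n" for n
      using Eph[of n] ph0[of n] E_dec[OF that] that \<open>N \<le> k\<close> by linarith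
    then show "\<exists>M. \<forall>n\<ge>M. - (CE * (\<delta> n)\<^sup>2) \<le> E k" by blast
  qed
  have ph_bound: "ph k \<le> (C * CD * \<delta> k) powr q" if k: "N \<le> k" for k
  proof (cases "ph k = 0")
    case False
    then have pos: "0 < ph k" using ph0[OF k] by simp
    have "ph k \<le> C * norm (D k) * ph k powr \<theta>"
      unfolding ph_def using ineq[OF XS[OF k] Xr sub[OF k]] by simp
    also have "\<dots> \<le> C * (CD * \<delta> k) * ph k powr \<theta>"
      by (intro mult_right_mono mult_left_mono CD C) auto
    finally have "ph k * ph k powr (- \<theta>) \<le> C * (CD * \<delta> k) * ph k powr \<theta> * ph k powr (- \<theta>)"
      by (rule mult_right_mono) auto
    moreover have "ph k * ph k powr (- \<theta>) = ph k powr (1 - \<theta>)"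
      using pos by (simp add: powr_diff powr_minus divide_inverse)
    moreover have "ph k powr \<theta> * ph k powr (- \<theta>) = 1" using pos by (simp add: powr_minus)
    ultimately have "ph k powr (1 - \<theta>) \<le> C * CD * \<delta> k" by (simp add: mult.assoc)
    then have "(ph k powr (1 - \<theta>)) powr q \<le> (C * CD * \<delta> k) powr q"
      using q by (intro powr_mono2) auto
    then show ?thesis using pos q by (simp add: powr_powr mult.commute)
  qed simp
  define C3 where "C3 = (C * CD) powr q + CE"
  have C3: "0 \<le> C3" using CE by (simp add: C3_def)
  define C4 where "C4 = C3 powr (1 - \<theta>)"
  have E_bound: "E k powr (1 - \<theta>) \<le> C4 * \<delta> k" if k: "N \<le> k" "\<delta> k \<le> 1" for k
  proof -
    have "(\<delta> k)\<^sup>2 \<le> \<delta> k powr q"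
      using powr_mono'[of q 2 "\<delta> k"] q k(2) \<delta>_nonneg[of k] by simp
    then have "E k \<le> (C * CD * \<delta> k) powr q + CE * \<delta> k powr q"
      using Eph[OF k(1)] ph_bound[OF k(1)] mult_left_mono[of "(\<delta> k)\<^sup>2" "\<delta> k powr q" CE] CE(1) by linarith
    also have "\<dots> = C3 * \<delta> k powr q"
      using C CD \<delta>_nonneg[of k] by (simp add: C3_def powr_mult algebra_simps)
    finally have "E k powr (1 - \<theta>) \<le> (C3 * \<delta> k powr q) powr (1 - \<theta>)"
      using \<theta> E0[OF k(1)] by (intro powr_mono2) auto
    also have "\<dots> = C4 * \<delta> k"
      using C3 q \<delta>_nonneg[of k] by (simp add: C4_def powr_mult powr_powr)
    finally show ?thesis .
  qed
  obtain N1 where N1: "\<And>k. N1 \<le> k \<Longrightarrow> \<delta> k \<le> 1"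
    using LIMSEQ_D[OF \<delta>_tendsto_0, of 1] \<delta>_nonneg by force
  \<comment> \<open>\<open>E k powr \<theta>\<close> is the desingularized gap. Its concavity turns
    the decrease of \<open>E\<close>, divided by \<open>E k powr (1 - \<theta>)\<close>, into a
    telescoping difference.\<close>
  show ?thesis
  proof (rule summable_of_telescoping_bound[where N = "max N N1" and C = "C4 / (\<theta> * m)" and e = "\<lambda>k. E k powr \<theta>"])
    fix k assume k: "max N N1 \<le> k"
    then have k': "N \<le> k" "\<delta> k \<le> 1" using N1 by auto
    show "E (Suc k) powr \<theta> \<le> E k powr \<theta>"
      using E_dec[of k "Suc k"] E0[of "Suc k"] k' \<theta> by (intro powr_mono2) auto
    then have gap: "0 \<le> E k powr \<theta> - E (Suc k) powr \<theta>" by simp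
    have "\<theta> * (m * (\<delta> (Suc k))\<^sup>2) \<le> \<theta> * (E k - E (Suc k))"
      using m(2)[of k] \<theta> by (intro mult_left_mono) (auto simp: E_def)
    also have "\<dots> \<le> E k powr (1 - \<theta>) * (E k powr \<theta> - E (Suc k) powr \<theta>)"
      using E_dec[of k "Suc k"] E0[of "Suc k"] k' \<theta> by (intro powr_concave_gap) auto
    also have "\<dots> \<le> (C4 * \<delta> k) * (E k powr \<theta> - E (Suc k) powr \<theta>)"
      by (intro mult_right_mono E_bound k' gap)
    finally show "(\<delta> (Suc k))\<^sup>2 \<le> \<delta> k * (C4 / (\<theta> * m) * (E k powr \<theta> - E (Suc k) powr \<theta>))"
      using \<theta>(1) m(1) by (simp add: field_simps)
  qed (use \<delta>_nonneg \<theta> m in \<open>auto simp: C4_def\<close>)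
qed

lemma convergence:
  assumes "summable \<delta>"
  shows "summable (\<lambda>k. norm (w (Suc k) - w k))" "summable (\<lambda>k. norm (p (Suc k) - p k))"
    "summable (\<lambda>k. norm (z (Suc k) - z k))" "summable (\<lambda>k. norm (u (Suc k) - u k))"
    and "\<exists>w' p' u'. w \<longlonglongrightarrow> w' \<and> p \<longlonglongrightarrow> p' \<and> z \<longlonglongrightarrow> w' \<and> u \<longlonglongrightarrow> u' \<and> u' = - GW w' p' \<and> w' \<in> K
       \<and> (\<forall>y\<in>K. u' \<bullet> (y - w') \<le> c \<bullet> (y - w'))
       \<and> (\<lambda>k. GP (w k) (p k) + \<mu> *\<^sub>R dp k) \<longlonglongrightarrow> GP w' p'"
proof -
  have sw: "summable (\<lambda>k. norm (dw k))" and sp: "summable (\<lambda>k. norm (dp k))" and su: "summable (\<lambda>k. norm (du k))"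
    by (rule summable_comparison_test'[OF assms, of 0], simp add: \<delta>_bounds)+
  \<comment> \<open>The relation \<open>w_minus_z\<close> says nothing about \<open>z 0\<close>, so
    the increments of \<open>z\<close> are compared from index 1 on.\<close>
  have "summable (\<lambda>k. norm (z (Suc (Suc k)) - z (Suc k)))"
  proof (rule summable_comparison_test'[of _ 0])
    show "summable (\<lambda>k. norm (dw (Suc k)) + a * (norm (du (Suc k)) + norm (du k)))"
      using sw su by (intro summable_add summable_mult summable_Suc_iff[THEN iffD2, OF sw] summable_Suc_iff[THEN iffD2, OF su])
    fix k
    have "z (Suc k) = w (Suc k) - a *\<^sub>R du k" for k using w_minus_z[of k] by (simp add: algebra_simps)
    then have "z (Suc (Suc k)) - z (Suc k) = dw (Suc k) - a *\<^sub>R (du (Suc k) - du k)"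
      by (simp add: dw_def algebra_simps)
    then have "norm (z (Suc (Suc k)) - z (Suc k)) \<le> norm (dw (Suc k)) + norm (a *\<^sub>R (du (Suc k) - du k))"
      by (metis norm_triangle_ineq4)
    also have "\<dots> \<le> norm (dw (Suc k)) + a * (norm (du (Suc k)) + norm (du k))"
      using a_pos norm_triangle_ineq4[of "du (Suc k)" "du k"] by simp
    finally show "norm (norm (z (Suc (Suc k)) - z (Suc k))) \<le> norm (dw (Suc k)) + a * (norm (du (Suc k)) + norm (du k))"
      by simp
  qed
  then show sz: "summable (\<lambda>k. norm (z (Suc k) - z k))" using summable_Suc_iff by blast
  show sw': "summable (\<lambda>k. norm (w (Suc k) - w k))" and sp': "summable (\<lambda>k. norm (p (Suc k) - p k))"
    and su': "summable (\<lambda>k. norm (u (Suc k) - u k))"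
    using sw sp su by (simp_all add: dw_def dp_def du_def)
  obtain w' where w': "w \<longlonglongrightarrow> w'" using summable_increments_convergent[OF sw'] by blast
  obtain p' where p': "p \<longlonglongrightarrow> p'" using summable_increments_convergent[OF sp'] by blast
  obtain u' where u': "u \<longlonglongrightarrow> u'" using summable_increments_convergent[OF su'] by blast
  have d0: "dw \<longlonglongrightarrow> 0" "dp \<longlonglongrightarrow> 0" "du \<longlonglongrightarrow> 0"
    using summable_LIMSEQ_zero[OF sw] summable_LIMSEQ_zero[OF sp] summable_LIMSEQ_zero[OF su]
    by (simp_all add: tendsto_norm_zero_iff)
  have "(\<lambda>k. w (Suc k) - a *\<^sub>R du k) \<longlonglongrightarrow> w' - a *\<^sub>R 0"
    by (intro tendsto_diff LIMSEQ_Suc[OF w'] tendsto_scaleR tendsto_const d0)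
  moreover have "w (Suc k) - a *\<^sub>R du k = z (Suc k)" for k using w_minus_z[of k] by (simp add: algebra_simps)
  ultimately have zS: "(\<lambda>k. z (Suc k)) \<longlonglongrightarrow> w'" by simp
  then have z': "z \<longlonglongrightarrow> w'" by (simp add: filterlim_sequentially_Suc)
  have blA: "bounded_linear A" "bounded_linear B" "bounded_linear (adjoint A)" "bounded_linear (adjoint B)"
    using linA linB A'.linear_axioms B'.linear_axioms by (simp_all add: linear_conv_bounded_linear)
  have GWlim: "(\<lambda>k. GW (w k) (p (Suc k))) \<longlonglongrightarrow> GW w' p'"
    unfolding GW_def by (intro tendsto_scaleR tendsto_const blA[THEN bounded_linear.tendsto] tendsto_add w' LIMSEQ_Suc[OF p'])
  have GPlim: "(\<lambda>k. GP (w k) (p k)) \<longlonglongrightarrow> GP w' p'"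
    unfolding GP_def by (intro tendsto_scaleR tendsto_const blA[THEN bounded_linear.tendsto] tendsto_add w' p')
  have "(\<lambda>k. - ((1 / \<sigma>) *\<^sub>R du k) + (\<beta> - \<tau>) *\<^sub>R dw k - GW (w k) (p (Suc k)))
      \<longlonglongrightarrow> - ((1 / \<sigma>) *\<^sub>R 0) + (\<beta> - \<tau>) *\<^sub>R 0 - GW w' p'"
    by (intro tendsto_diff tendsto_add tendsto_minus tendsto_scaleR tendsto_const d0 GWlim)
  then have "u \<longlonglongrightarrow> - GW w' p'" unfolding u_eq[symmetric] by simp
  then have ueq: "u' = - GW w' p'" using u' LIMSEQ_unique by blast
  have w'K: "w' \<in> K" using closed_sequentially[OF closedK _ zS] z_in by blast
  have "u' \<bullet> (y - w') \<le> c \<bullet> (y - w')" if "y \<in> K" for y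
  proof (rule LIMSEQ_le[OF _ _ exI[of _ 0]])
    have "(\<lambda>k. (u k + \<beta> *\<^sub>R (w k - z (Suc k))) \<bullet> (y - z (Suc k))) \<longlonglongrightarrow> (u' + \<beta> *\<^sub>R (w' - w')) \<bullet> (y - w')"
      by (intro tendsto_inner tendsto_add tendsto_diff tendsto_scaleR tendsto_const u' w' zS)
    then show "(\<lambda>k. (u k + \<beta> *\<^sub>R (w k - z (Suc k))) \<bullet> (y - z (Suc k))) \<longlonglongrightarrow> u' \<bullet> (y - w')" by simp
    show "(\<lambda>k. c \<bullet> (y - z (Suc k))) \<longlonglongrightarrow> c \<bullet> (y - w')"
      by (intro tendsto_inner tendsto_diff tendsto_const zS)
  qed (use z_step[OF that] in blast)
  moreover have "(\<lambda>k. GP (w k) (p k) + \<mu> *\<^sub>R dp k) \<longlonglongrightarrow> GP w' p'"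
    using tendsto_add[OF GPlim tendsto_scaleR[OF tendsto_const d0(2), of \<mu>]] by simp
  ultimately show "\<exists>w' p' u'. w \<longlonglongrightarrow> w' \<and> p \<longlonglongrightarrow> p' \<and> z \<longlonglongrightarrow> w' \<and> u \<longlonglongrightarrow> u' \<and> u' = - GW w' p' \<and> w' \<in> K
       \<and> (\<forall>y\<in>K. u' \<bullet> (y - w') \<le> c \<bullet> (y - w'))
       \<and> (\<lambda>k. GP (w k) (p k) + \<mu> *\<^sub>R dp k) \<longlonglongrightarrow> GP w' p'"
    using w' p' z' u' ueq w'K by blast
qed

end

section \<open>Counting nonzero blocks\<close>

text \<open>The support at block level. Its cardinality is the nonconvex part of the objective,
  while confining it to a fixed set of blocks describes a linear subspace.\<close>

definition active :: "('k::finite \<Rightarrow> 'b) \<Rightarrow> real^'k \<Rightarrow> 'b set" where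
  "active bl y = bl ` {k. y $ k \<noteq> 0}"

definition block_part :: "('k::finite \<Rightarrow> 'b) \<Rightarrow> 'b \<Rightarrow> real^'k \<Rightarrow> real^'k" where
  "block_part bl b y = (\<chi> k. if bl k = b then y $ k else 0)"

lemma finite_active [simp]: "finite (active bl y)"
  by (simp add: active_def)

lemma subspace_active: "subspace {y. active bl y \<subseteq> S}"
proof -
  have "active bl y \<subseteq> S \<longleftrightarrow> (\<forall>k. bl k \<notin> S \<longrightarrow> y $ k = 0)" for y
    unfolding active_def by blast
  then show ?thesis by (simp add: subspace_def)
qed

lemma norm_block_part_le: "norm (block_part bl b y) \<le> norm y"
  by (rule norm_le_componentwise_cart) (simp add: block_part_def)

lemma active_block_part: "active bl (block_part bl b y) \<subseteq> active bl y"
proof -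
  have "y $ k \<noteq> 0" if "block_part bl b y $ k \<noteq> 0" for k
    using that by (cases "bl k = b") (simp_all add: block_part_def)
  then show ?thesis unfolding active_def by blast
qed

lemma block_part_eq_0:
  assumes "b \<notin> active bl y"
  shows "block_part bl b y = 0"
proof -
  have "y $ k = 0" if "bl k = b" for k using that assms unfolding active_def by blast
  then show ?thesis by (simp add: block_part_def vec_eq_iff)
qed

lemma block_part_nth: "block_part bl b y $ k = (if bl k = b then y $ k else 0)"
  by (simp add: block_part_def)

lemma linear_block_part: "linear (block_part bl b)"
proof (rule linearI)
  show "block_part bl b (x + y) = block_part bl b x + block_part bl b y" for x y
    unfolding vec_eq_iff vector_add_component block_part_nth by simp
  show "block_part bl b (r *\<^sub>R x) = r *\<^sub>R block_part bl b x" for r x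
    unfolding vec_eq_iff vector_scaleR_component block_part_nth by simp
qed

section \<open>The hard threshold and the stabilization of the support\<close>

locale block_prox =
  fixes bl :: "'k::finite \<Rightarrow> 'b" and \<gamma> \<mu> :: real and q p G :: "real^'k"
  assumes \<gamma>: "0 < \<gamma>" and \<mu>: "0 < \<mu>"
    and opt: "\<And>y. \<gamma> * card (active bl q) + G \<bullet> (q - p) + \<mu> / 2 * (norm (q - p))\<^sup>2
        \<le> \<gamma> * card (active bl y) + G \<bullet> (y - p) + \<mu> / 2 * (norm (y - p))\<^sup>2"
begin

lemma perturb: "0 \<le> \<gamma> * card (active bl (q + v)) - \<gamma> * card (active bl q)
   + (G + \<mu> *\<^sub>R (q - p)) \<bullet> v + \<mu> / 2 * (norm v)\<^sup>2"
proof -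
  have "(norm (q + v - p))\<^sup>2 = (norm (q - p))\<^sup>2 + 2 * ((q - p) \<bullet> v) + (norm v)\<^sup>2"
    by (simp add: power2_norm_eq_inner inner_simps inner_commute)
  then have "\<mu> / 2 * (norm (q + v - p))\<^sup>2 = \<mu> / 2 * (norm (q - p))\<^sup>2 + \<mu> * ((q - p) \<bullet> v) + \<mu> / 2 * (norm v)\<^sup>2"
    by (simp only:) (simp add: algebra_simps)
  moreover have "G \<bullet> (q + v - p) = G \<bullet> (q - p) + G \<bullet> v" by (simp add: inner_simps)
  moreover have "(G + \<mu> *\<^sub>R (q - p)) \<bullet> v = G \<bullet> v + \<mu> * ((q - p) \<bullet> v)" by (simp add: inner_add_left)
  ultimately show ?thesis using opt[of "q + v"] by linarith
qed

text \<open>Moving inside the active blocks cannot raise the count, so the smooth part alone must be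
  stationary in these directions.\<close>

lemma stationary:
  assumes "active bl v \<subseteq> active bl q"
  shows "(G + \<mu> *\<^sub>R (q - p)) \<bullet> v = 0"
proof (rule ccontr)
  define s where "s = (G + \<mu> *\<^sub>R (q - p)) \<bullet> v"
  assume "(G + \<mu> *\<^sub>R (q - p)) \<bullet> v \<noteq> 0"
  then have s: "s \<noteq> 0" by (simp add: s_def)
  \<comment> \<open>The step \<open>- s / M\<close> is slightly shorter than the minimizing one; the
    added 1 keeps it defined when \<open>v = 0\<close>.\<close>
  define M where "M = \<mu> * (norm v)\<^sup>2 + 1"
  have M: "0 < M" using \<mu> by (simp add: M_def add_nonneg_pos)
  define t where "t = - s / M"
  have "active bl (q + t *\<^sub>R v) \<subseteq> active bl q"
    using assms subspace_active[of bl "active bl q"]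
    by (auto simp: subspace_def)
  then have "\<gamma> * card (active bl (q + t *\<^sub>R v)) \<le> \<gamma> * card (active bl q)"
    using \<gamma> by (intro mult_left_mono) (auto intro: card_mono)
  then have "0 \<le> t * s + \<mu> / 2 * (t\<^sup>2 * (norm v)\<^sup>2)"
    using perturb[of "t *\<^sub>R v"] by (simp add: s_def power_mult_distrib)
  then have "0 \<le> (t * s + \<mu> / 2 * (t\<^sup>2 * (norm v)\<^sup>2)) * M\<^sup>2"
    by (rule mult_nonneg_nonneg) simp
  also have "\<dots> = - (s\<^sup>2 * (\<mu> / 2 * (norm v)\<^sup>2 + 1))"
    using M unfolding t_def by (simp add: field_simps power2_eq_square) (simp add: M_def power2_eq_square algebra_simps)
  also have "\<dots> < 0" using s \<mu> by (simp add: add_nonneg_pos)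
  finally show False by simp
qed

text \<open>Deleting block \<open>b\<close> saves \<open>\<gamma>\<close> and costs only the
  quadratic term, as stationarity removes the linear one. Optimality forbids a net saving.\<close>

lemma block_lower_bound:
  assumes "b \<in> active bl q"
  shows "2 * \<gamma> / \<mu> \<le> (norm (block_part bl b q))\<^sup>2"
proof -
  let ?v = "- block_part bl b q"
  have act: "active bl (q + ?v) \<subseteq> active bl q - {b}"
  proof
    fix b' assume "b' \<in> active bl (q + ?v)"
    then obtain k where k: "b' = bl k" "(q + ?v) $ k \<noteq> 0" by (auto simp: active_def)
    then have "bl k \<noteq> b" "q $ k \<noteq> 0" by (cases "bl k = b"; simp add: block_part_def)+
    then show "b' \<in> active bl q - {b}" using k(1) by (auto simp: active_def)
  qed
  have "card (active bl (q + ?v)) \<le> card (active bl q - {b})" using act by (intro card_mono) auto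
  then have "card (active bl (q + ?v)) + 1 \<le> card (active bl q)"
    using card_Suc_Diff1[OF finite_active assms] by linarith
  then have "real (card (active bl (q + ?v))) + 1 \<le> card (active bl q)" by linarith
  then have "\<gamma> * (real (card (active bl (q + ?v))) + 1) \<le> \<gamma> * card (active bl q)"
    using \<gamma> by (intro mult_left_mono) auto
  moreover have "(G + \<mu> *\<^sub>R (q - p)) \<bullet> ?v = 0"
    using stationary[OF active_block_part[of bl b q]] by simp
  ultimately have "\<gamma> \<le> \<mu> / 2 * (norm ?v)\<^sup>2"
    using perturb[of ?v] by (simp add: distrib_left)
  then show ?thesis using \<mu> by (simp add: field_simps)
qed

end

text \<open>A block present in a proximal output but absent from another point separates the two by
  at least the threshold, so short steps can neither create nor delete blocks. The initial
  \<open>p 0\<close> is no proximal output, hence the shift to \<open>Suc k\<close>.\<close>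

lemma active_eventually_constant:
  fixes p G :: "nat \<Rightarrow> real^'k::finite" and bl :: "'k \<Rightarrow> 'b"
  assumes prox: "\<And>k. block_prox bl \<gamma> \<mu> (p (Suc k)) (p k) (G k)"
    and lim: "(\<lambda>k. p (Suc k) - p k) \<longlonglongrightarrow> 0"
  obtains N where "\<And>k. N \<le> k \<Longrightarrow> active bl (p (Suc k)) = active bl (p (Suc N))"
proof -
  interpret b0: block_prox bl \<gamma> \<mu> "p (Suc 0)" "p 0" "G 0" by (rule prox)
  have "0 < sqrt (2 * \<gamma> / \<mu>)" using b0.\<gamma> b0.\<mu> by simp
  from LIMSEQ_D[OF lim this] obtain N where N: "\<And>k. N \<le> k \<Longrightarrow> norm (p (Suc k) - p k) < sqrt (2 * \<gamma> / \<mu>)"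
    by auto
  have sub: "active bl (p (Suc i)) \<subseteq> active bl (p j)"
    if close: "norm (p (Suc i) - p j) < sqrt (2 * \<gamma> / \<mu>)" for i j
  proof (rule subsetI, rule ccontr)
    fix b assume b: "b \<in> active bl (p (Suc i))" "b \<notin> active bl (p j)"
    have "sqrt (2 * \<gamma> / \<mu>) \<le> norm (block_part bl b (p (Suc i)))"
      using block_prox.block_lower_bound[OF prox b(1)] by (simp add: real_le_lsqrt)
    also have "\<dots> = norm (block_part bl b (p (Suc i) - p j))"
      using b(2) by (simp add: linear_diff[OF linear_block_part] block_part_eq_0)
    also have "\<dots> \<le> norm (p (Suc i) - p j)" by (rule norm_block_part_le)
    finally show False using close by simp
  qed
  have step: "active bl (p (Suc (Suc k))) = active bl (p (Suc k))" if "N \<le> k" for k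
    using sub[of "Suc k" "Suc k"] sub[of k "Suc (Suc k)"] N[of "Suc k"] that by (auto simp: norm_minus_commute)
  have "active bl (p (Suc k)) = active bl (p (Suc N))" if "N \<le> k" for k
    using that step by (induction rule: dec_induct) auto
  then show ?thesis using that by blast
qed

lemma active_limit:
  fixes p G :: "nat \<Rightarrow> real^'k::finite" and bl :: "'k \<Rightarrow> 'b"
  assumes prox: "\<And>k. block_prox bl \<gamma> \<mu> (p (Suc k)) (p k) (G k)"
    and const: "\<And>k. N \<le> k \<Longrightarrow> active bl (p (Suc k)) = S" and lim: "p \<longlonglongrightarrow> p'"
  shows "active bl p' = S"
proof
  interpret b0: block_prox bl \<gamma> \<mu> "p (Suc 0)" "p 0" "G 0" by (rule prox)
  have "p' \<in> {y. active bl y \<subseteq> S}"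
  proof (rule closed_sequentially[OF closed_subspace[OF subspace_active]])
    show "(\<lambda>k. p (k + Suc N)) \<longlonglongrightarrow> p'" by (rule LIMSEQ_ignore_initial_segment[OF lim])
    show "p (k + Suc N) \<in> {y. active bl y \<subseteq> S}" for k using const[of "k + N"] by simp
  qed
  then show "active bl p' \<subseteq> S" by simp
  show "S \<subseteq> active bl p'"
  proof (rule subsetI, rule ccontr)
    fix b assume b: "b \<in> S" "b \<notin> active bl p'"
    have "(\<lambda>k. (norm (block_part bl b (p (Suc k))))\<^sup>2) \<longlonglongrightarrow> (norm (block_part bl b p'))\<^sup>2"
      using linear_block_part[of bl b]
      by (intro tendsto_power tendsto_norm bounded_linear.tendsto[OF _ LIMSEQ_Suc[OF lim]])
        (simp add: linear_conv_bounded_linear)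
    moreover have "\<exists>N. \<forall>k\<ge>N. 2 * \<gamma> / \<mu> \<le> (norm (block_part bl b (p (Suc k))))\<^sup>2"
      using block_prox.block_lower_bound[OF prox] b(1) const by blast
    ultimately have "2 * \<gamma> / \<mu> \<le> (norm (block_part bl b p'))\<^sup>2" by (rule LIMSEQ_le_const)
    then show False using b(2) b0.\<gamma> b0.\<mu> by (simp add: block_part_eq_0 divide_le_0_iff)
  qed
qed

section \<open>Limiting subgradients from local affine minorants\<close>

text \<open>A local affine minorant makes the difference quotients nonnegative, so \<open>d\<close>
  is a Frechet subgradient; constant sequences then witness the limiting one.\<close>

lemma limiting_subdiff_of_local_support:
  fixes \<psi> :: "'a::euclidean_space \<Rightarrow> ereal"
  assumes "\<psi> x = ereal r" and ev: "\<forall>\<^sub>F y in at x. \<psi> x + ereal (d \<bullet> (y - x)) \<le> \<psi> y"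
  shows "d \<in> limiting_subdiff \<psi> x"
proof -
  have "\<forall>\<^sub>F y in at x. 0 \<le> (\<psi> y - \<psi> x - ereal (d \<bullet> (y - x))) / ereal (norm (y - x))"
    using ev eventually_neq_at_within[of x x UNIV]
  proof eventually_elim
    case (elim y)
    have "0 \<le> \<psi> y - \<psi> x - ereal (d \<bullet> (y - x))"
      using elim(1) assms(1) by (cases "\<psi> y") auto
    moreover have "0 < ereal (norm (y - x))" using elim(2) by simp
    ultimately show ?case
      using assms(1) by (cases "\<psi> y") (auto simp: zero_ereal_def)
  qed
  then have "0 \<le> Liminf (at x) (\<lambda>y. (\<psi> y - \<psi> x - ereal (d \<bullet> (y - x))) / ereal (norm (y - x)))"
    by (rule Liminf_bounded)
  then have "d \<in> frechet_subdiff \<psi> x" using assms(1) by (simp add: frechet_subdiff_def)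
  then have "\<exists>X D. X \<longlonglongrightarrow> x \<and> D \<longlonglongrightarrow> d \<and> (\<lambda>k. \<psi> (X k)) \<longlonglongrightarrow> \<psi> x \<and> (\<forall>k. D k \<in> frechet_subdiff \<psi> (X k))"
    by (rule_tac exI[of _ "\<lambda>_. x"], rule_tac exI[of _ "\<lambda>_. d"]) simp
  then show ?thesis using assms(1) by (simp add: limiting_subdiff_def)
qed

lemma active_eventually_superset:
  fixes x :: "real^'k::finite"
  shows "\<forall>\<^sub>F y in at x. active bl x \<subseteq> active bl y"
proof -
  have "\<forall>\<^sub>F y in at x. \<forall>k\<in>{k. x $ k \<noteq> 0}. y $ k \<noteq> 0"
    by (intro eventually_ball_finite ballI tendsto_imp_eventually_ne[OF tendsto_vec_nth[OF tendsto_ident_at]]) auto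
  then show ?thesis by eventually_elim (auto simp: active_def)
qed

text \<open>Near \<open>x\<close> the support can only grow. If it is unchanged, \<open>d\<close>
  annihilates the displacement; if it grows, the jump of at least \<open>\<gamma>\<close> exceeds
  the small linear term.\<close>

lemma limiting_subdiff_active_card:
  fixes x d :: "real^'k::finite"
  assumes \<gamma>: "0 < \<gamma>" and d: "\<And>v. active bl v \<subseteq> active bl x \<Longrightarrow> d \<bullet> v = 0"
  shows "d \<in> limiting_subdiff (\<lambda>y. ereal (\<gamma> * real (card (active bl y)))) x"
proof (rule limiting_subdiff_of_local_support[OF refl])
  have "((\<lambda>y. d \<bullet> (y - x)) \<longlongrightarrow> d \<bullet> (x - x)) (at x)" by (intro tendsto_intros)
  then have "\<forall>\<^sub>F y in at x. d \<bullet> (y - x) < \<gamma>" using \<gamma> by (intro order_tendstoD) auto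
  then show "\<forall>\<^sub>F y in at x. ereal (\<gamma> * real (card (active bl x))) + ereal (d \<bullet> (y - x))
      \<le> ereal (\<gamma> * real (card (active bl y)))"
    using active_eventually_superset[of bl x]
  proof eventually_elim
    case (elim y)
    show ?case
    proof (cases "active bl y = active bl x")
      case True
      have "y - x \<in> {v. active bl v \<subseteq> active bl x}"
        using True by (intro subspace_diff[OF subspace_active]) auto
      then show ?thesis using d[of "y - x"] True by simp
    next
      case False
      then have "card (active bl x) < card (active bl y)" using elim(2) by (intro psubset_card_mono) auto
      then have "real (card (active bl x)) + 1 \<le> card (active bl y)" by linarith
      from mult_left_mono[OF this less_imp_le[OF \<gamma>]] elim(1) show ?thesis by (simp add: distrib_left)
    qed
  qed
qed

section \<open>The feasible set as a spectrahedron\<close>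

lemma linear_unvec: "linear unvec"
  by (intro linearI) (simp_all add: unvec_def vec_eq_iff)

lemma linear_transpose: "linear (transpose :: real^'a^'b \<Rightarrow> real^'b^'a)"
  by (intro linearI) (simp_all add: transpose_def vec_eq_iff)

lemma linear_matrix_mult_left: "linear (\<lambda>X. (A :: real^'b^'a) ** X)"
  by (intro linearI) (simp_all add: matrix_add_ldistrib matrix_scalar_ac scalar_matrix_assoc)

lemma linear_matrix_mult_right: "linear (\<lambda>X. X ** (A :: real^'b^'a))"
  by (intro linearI) (simp_all add: matrix_matrix_mult_def vec_eq_iff sum.distrib distrib_right
      sum_distrib_left mult.assoc)

lemma symmetric_matrix_inner:
  fixes S :: "real^'a^'a"
  assumes "transpose S = S"
  shows "x \<bullet> (S *v y) = (S *v x) \<bullet> y"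
  using dot_lmul_matrix[of x S y] assms by (metis transpose_matrix_vector)

lemma Upsilon_linear_eq: "Upsilon Q F W = - (mat_V2 ** (F ** W) ** transpose mat_V2
    + mat_V2 ** (W ** transpose F) ** transpose mat_V2 + mat_V2 ** Q ** transpose mat_V2)"
  unfolding Upsilon_def
  by (simp only: linear_add[OF linear_matrix_mult_left] linear_add[OF linear_matrix_mult_right])

lemma linear_Upsilon: "linear (Upsilon 0 F)"
proof (rule linearI)
  note lin = linear_add[OF linear_matrix_mult_left] linear_add[OF linear_matrix_mult_right]
    linear_scale[OF linear_matrix_mult_left] linear_scale[OF linear_matrix_mult_right]
  show "Upsilon 0 F (W + W') = Upsilon 0 F W + Upsilon 0 F W'" for W W'
    unfolding Upsilon_linear_eq lin by simp
  show "Upsilon 0 F (r *\<^sub>R W) = r *\<^sub>R Upsilon 0 F W" for r W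
    unfolding Upsilon_linear_eq lin by (simp add: algebra_simps)
qed

lemma Upsilon_split: "Upsilon Q F W = Upsilon Q F 0 + Upsilon 0 F W"
  unfolding Upsilon_linear_eq by simp

lemma transpose_Upsilon:
  assumes "transpose Q = Q" "transpose W = W"
  shows "transpose (Upsilon Q F W) = Upsilon Q F W"
  unfolding Upsilon_def
  by (simp add: linear_neg[OF linear_transpose] linear_add[OF linear_transpose] matrix_transpose_mul
      assms matrix_mul_assoc add.commute)

definition feasible where
  "feasible Q F = {w. psd (unvec w) \<and> (\<forall>i. psd (Upsilon Q (F i) (unvec w)))}"

text \<open>
  All constraints are collected in one quadratic form on a direct sum, split into its constant part
  and its part linear in \<open>w\<close>.
\<close>

definition lmi0 :: "real^('n::finite + 'm::finite)^('n + 'm) \<Rightarrow> ('i::finite \<Rightarrow> real^('n + 'm)^('n + 'm))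
    \<Rightarrow> (real^('n + 'm)) \<times> ((real^'n)^'i) \<Rightarrow> (real^('n + 'm)) \<times> ((real^'n)^'i)" where
  "lmi0 Q F v = (0, \<chi> i. Upsilon Q (F i) 0 *v (snd v $ i))"

definition lmi1 :: "('i::finite \<Rightarrow> real^('n + 'm)^('n + 'm)) \<Rightarrow> real^(('n::finite + 'm::finite) \<times> ('n + 'm))
    \<Rightarrow> (real^('n + 'm)) \<times> ((real^'n)^'i) \<Rightarrow> (real^('n + 'm)) \<times> ((real^'n)^'i)" where
  "lmi1 F w v = (unvec w *v fst v, \<chi> i. Upsilon 0 (F i) (unvec w) *v (snd v $ i))"

lemma lmi_form:
  fixes v :: "(real^('n::finite + 'm::finite)) \<times> ((real^'n)^'i::finite)"
  shows "v \<bullet> (lmi0 Q F v + lmi1 F w v) = fst v \<bullet> (unvec w *v fst v)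
    + (\<Sum>i\<in>UNIV. snd v $ i \<bullet> (Upsilon Q (F i) (unvec w) *v (snd v $ i)))"
proof -
  have inner_blocks: "y \<bullet> y' = (\<Sum>i\<in>UNIV. y $ i \<bullet> y' $ i)" for y y' :: "(real^'n)^'i"
    by (rule inner_vec_def)
  have "snd v $ i \<bullet> (Upsilon Q (F i) (unvec w) *v (snd v $ i))
      = snd v $ i \<bullet> (Upsilon Q (F i) 0 *v (snd v $ i)) + snd v $ i \<bullet> (Upsilon 0 (F i) (unvec w) *v (snd v $ i))" for i
    by (subst Upsilon_split) (simp add: matrix_vector_mult_add_rdistrib inner_add_right)
  then show ?thesis
    by (simp add: lmi0_def lmi1_def inner_prod_def inner_blocks sum.distrib inner_add_right)
qed

text \<open>Vectors supported on one summand recover the individual constraints. Symmetry is imposed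
  on the unknown matrix only, because \<open>transpose_Upsilon\<close> passes it on to the
  others.\<close>

lemma feasible_iff:
  assumes "transpose Q = Q"
  shows "w \<in> feasible Q F \<longleftrightarrow> transpose (unvec w) = unvec w \<and> (\<forall>v. 0 \<le> v \<bullet> (lmi0 Q F v + lmi1 F w v))"
proof (intro iffI conjI allI)
  assume w: "w \<in> feasible Q F"
  then show "transpose (unvec w) = unvec w" by (simp add: feasible_def psd_def)
  fix v show "0 \<le> v \<bullet> (lmi0 Q F v + lmi1 F w v)"
    unfolding lmi_form using w by (intro add_nonneg_nonneg sum_nonneg) (auto simp: feasible_def psd_def)
next
  assume w: "transpose (unvec w) = unvec w \<and> (\<forall>v. 0 \<le> v \<bullet> (lmi0 Q F v + lmi1 F w v))"
  then have nonneg: "0 \<le> fst v \<bullet> (unvec w *v fst v)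
      + (\<Sum>i\<in>UNIV. snd v $ i \<bullet> (Upsilon Q (F i) (unvec w) *v (snd v $ i)))" for v
    using lmi_form[of v Q F w] by metis
  have "0 \<le> x \<bullet> (unvec w *v x)" for x
    using nonneg[of "(x, 0)"] by simp
  moreover have "0 \<le> x \<bullet> (Upsilon Q (F i) (unvec w) *v x)" for i x
  proof -
    have "(\<Sum>j\<in>UNIV. (if j = i then x else 0) \<bullet> (Upsilon Q (F j) (unvec w) *v (if j = i then x else 0)))
        = (\<Sum>j\<in>UNIV. if j = i then x \<bullet> (Upsilon Q (F j) (unvec w) *v x) else 0)"
      by (rule sum.cong) auto
    then show ?thesis
      using nonneg[of "(0, \<chi> j. if j = i then x else 0)"] by simp
  qed
  ultimately show "w \<in> feasible Q F"
    using w transpose_Upsilon[OF assms] by (simp add: feasible_def psd_def)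
qed

lemma linear_lmi0: "linear (lmi0 Q F)"
  by (intro linearI; simp add: lmi0_def matrix_vector_right_distrib matrix_vector_mult_scaleR;
    simp add: vec_eq_iff)

lemma bilinear_lmi1: "bilinear (lmi1 F)"
  unfolding bilinear_def
proof (intro conjI allI linearI)
  note lin = linear_add[OF linear_unvec] linear_scale[OF linear_unvec]
    linear_add[OF linear_Upsilon] linear_scale[OF linear_Upsilon]
  show "lmi1 F (w + w') v = lmi1 F w v + lmi1 F w' v" for w w' v
    by (simp add: lmi1_def lin matrix_vector_mult_add_rdistrib) (simp add: vec_eq_iff)
  show "lmi1 F (r *\<^sub>R w) v = r *\<^sub>R lmi1 F w v" for r w v
    by (simp add: lmi1_def lin scaleR_matrix_vector_assoc[symmetric]) (simp add: vec_eq_iff)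
  show "lmi1 F w (v + v') = lmi1 F w v + lmi1 F w v'" for w v v'
    by (simp add: lmi1_def matrix_vector_right_distrib) (simp add: vec_eq_iff)
  show "lmi1 F w (r *\<^sub>R v) = r *\<^sub>R lmi1 F w v" for r w v
    by (simp add: lmi1_def matrix_vector_mult_scaleR) (simp add: vec_eq_iff)
qed

lemma lmi0_selfadjoint:
  fixes v v' :: "(real^('n::finite + 'm::finite)) \<times> ((real^'n)^'i::finite)"
  assumes "transpose Q = Q"
  shows "v \<bullet> lmi0 Q F v' = lmi0 Q F v \<bullet> v'"
proof -
  have inner_blocks: "y \<bullet> y' = (\<Sum>i\<in>UNIV. y $ i \<bullet> y' $ i)" for y y' :: "(real^'n)^'i"
    by (rule inner_vec_def)
  have "transpose (Upsilon Q (F i) 0) = Upsilon Q (F i) 0" for i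
    by (rule transpose_Upsilon[OF assms linear_0[OF linear_transpose]])
  then show ?thesis
    by (simp add: lmi0_def inner_prod_def inner_blocks symmetric_matrix_inner)
qed

lemma lmi1_selfadjoint:
  fixes v v' :: "(real^('n::finite + 'm::finite)) \<times> ((real^'n)^'i::finite)"
  assumes "transpose (unvec w) = unvec w"
  shows "v \<bullet> lmi1 F w v' = lmi1 F w v \<bullet> v'"
proof -
  have inner_blocks: "y \<bullet> y' = (\<Sum>i\<in>UNIV. y $ i \<bullet> y' $ i)" for y y' :: "(real^'n)^'i"
    by (rule inner_vec_def)
  have "transpose (Upsilon 0 (F i) (unvec w)) = Upsilon 0 (F i) (unvec w)" for i
    by (rule transpose_Upsilon[OF linear_0[OF linear_transpose] assms])
  then show ?thesis
    by (simp add: lmi1_def inner_prod_def inner_blocks symmetric_matrix_inner[OF assms] symmetric_matrix_inner)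
qed

lemma subspace_symmetric: "subspace {w. transpose (unvec w) = unvec w}"
  by (auto simp: subspace_def linear_0[OF linear_unvec] linear_0[OF linear_transpose]
      linear_add[OF linear_unvec] linear_add[OF linear_transpose]
      linear_scale[OF linear_unvec] linear_scale[OF linear_transpose])

lemma closed_feasible:
  fixes F :: "'i::finite \<Rightarrow> real^('n::finite + 'm::finite)^('n + 'm)"
  assumes "transpose Q = Q"
  shows "closed (feasible Q F)"
proof -
  have "feasible Q F = {w. transpose (unvec w) = unvec w} \<inter> (\<Inter>v. {w. 0 \<le> v \<bullet> (lmi0 Q F v + lmi1 F w v)})"
    using feasible_iff[OF assms] by blast
  moreover have "closed {w. 0 \<le> v \<bullet> (lmi0 Q F v + lmi1 F w v)}" for v
  proof -
    have "linear (\<lambda>w. lmi1 F w v)" using bilinear_lmi1[of F] unfolding bilinear_def by blast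
    then show ?thesis
      by (intro closed_Collect_le continuous_intros linear_continuous_on) (simp add: linear_conv_bounded_linear)
  qed
  ultimately show ?thesis
    by (simp add: closed_INT closed_Int closed_subspace[OF subspace_symmetric])
qed

lemma convex_feasible:
  fixes F :: "'i::finite \<Rightarrow> real^('n::finite + 'm::finite)^('n + 'm)"
  assumes "transpose Q = Q"
  shows "convex (feasible Q F)"
proof (rule convexI)
  fix w w' and s t :: real
  assume w: "w \<in> feasible Q F" "w' \<in> feasible Q F" and st: "0 \<le> s" "0 \<le> t" "s + t = 1"
  have lin: "linear (\<lambda>w. lmi1 F w v)" for v using bilinear_lmi1[of F] unfolding bilinear_def by blast
  have "0 \<le> v \<bullet> (lmi0 Q F v + lmi1 F (s *\<^sub>R w + t *\<^sub>R w') v)" for v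
  proof -
    have "0 \<le> v \<bullet> (lmi0 Q F v + lmi1 F w v)" "0 \<le> v \<bullet> (lmi0 Q F v + lmi1 F w' v)"
      using w feasible_iff[OF assms] by blast+
    then have "0 \<le> s * (v \<bullet> (lmi0 Q F v + lmi1 F w v)) + t * (v \<bullet> (lmi0 Q F v + lmi1 F w' v))"
      using st by (intro add_nonneg_nonneg mult_nonneg_nonneg)
    also have "\<dots> = (s + t) * (v \<bullet> lmi0 Q F v) + v \<bullet> lmi1 F (s *\<^sub>R w + t *\<^sub>R w') v"
      by (simp add: linear_add[OF lin] linear_scale[OF lin] inner_add_right algebra_simps)
    finally show ?thesis using st by (simp add: inner_add_right)
  qed
  moreover have "s *\<^sub>R w + t *\<^sub>R w' \<in> {w. transpose (unvec w) = unvec w}"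
    using w feasible_iff[OF assms] by (intro subspace_add subspace_scale subspace_symmetric) auto
  ultimately show "s *\<^sub>R w + t *\<^sub>R w' \<in> feasible Q F" using feasible_iff[OF assms] by blast
qed

text \<open>The factor \<open>L\<close> is absorbed into the ambient subspace of
  \<open>spectrahedron_KL\<close>, and the quadratic form sees only the first component.\<close>

lemma feasible_KL:
  fixes Q :: "real^('n::finite + 'm::finite)^('n + 'm)"
    and F :: "'i::finite \<Rightarrow> real^('n + 'm)^('n + 'm)"
    and A :: "real^(('n + 'm) \<times> ('n + 'm)) \<Rightarrow> 'r::euclidean_space" and B :: "'p::euclidean_space \<Rightarrow> 'r"
    and c :: "real^(('n + 'm) \<times> ('n + 'm))" and \<rho> :: real
  defines "\<Phi> \<equiv> \<lambda>y. c \<bullet> fst y + \<rho> / 2 * (norm (A (fst y) + B (snd y)))\<^sup>2"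
  assumes Q: "transpose Q = Q" and lin: "linear A" "linear B" and \<rho>: "0 < \<rho>" and L: "subspace L"
    and x0: "x0 \<in> feasible Q F \<times> L" and min: "\<And>y. y \<in> feasible Q F \<times> L \<Longrightarrow> \<Phi> x0 \<le> \<Phi> y"
  shows "\<exists>C \<theta>. 0 \<le> C \<and> 0 < \<theta> \<and> \<theta> \<le> 1 / 2 \<and> (\<forall>x\<in>feasible Q F \<times> L. norm x \<le> r \<longrightarrow>
        (\<forall>d. (\<forall>y\<in>feasible Q F \<times> L. \<Phi> x + d \<bullet> (y - x) \<le> \<Phi> y) \<longrightarrow> \<Phi> x - \<Phi> x0 \<le> C * norm d * (\<Phi> x - \<Phi> x0) powr \<theta>))"
proof -
  let ?\<Lambda> = "\<lambda>y. A (fst y) + B (snd y)"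
  let ?Y = "{w. transpose (unvec w) = unvec w} \<times> L"
  have \<Phi>: "\<Phi> = (\<lambda>y. (c, 0) \<bullet> y + \<rho> / 2 * (norm (?\<Lambda> y))\<^sup>2)"
    by (simp add: \<Phi>_def inner_prod_def)
  have lin\<Lambda>: "linear ?\<Lambda>"
    by (intro linearI) (simp_all add: linear_add[OF lin(1)] linear_add[OF lin(2)] linear_scale[OF lin(1)]
        linear_scale[OF lin(2)] scaleR_add_right)
  have bil: "bilinear (\<lambda>y. lmi1 F (fst y))"
    using bilinear_lmi1[of F] linear_compose[OF linear_fst]
    by (fastforce simp: bilinear_def o_def)
  have sub: "subspace ?Y" by (intro subspace_Times subspace_symmetric L)
  have S: "feasible Q F \<times> L = {y \<in> ?Y. \<forall>v. 0 \<le> v \<bullet> (lmi0 Q F v + lmi1 F (fst y) v)}"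
    using feasible_iff[OF Q, of _ F] by auto
  have sym: "v \<bullet> lmi1 F (fst t) v' = lmi1 F (fst t) v \<bullet> v'" if "t \<in> ?Y" for t v v'
    using that by (intro lmi1_selfadjoint) auto
  show ?thesis
  proof (rule spectrahedron_KL[OF \<rho> lin\<Lambda> linear_lmi0[of Q F] lmi0_selfadjoint[OF Q] bil sub sym S x0, of "(c, 0)" r])
    show "(c, 0) \<bullet> x0 + \<rho> / 2 * (norm (?\<Lambda> x0))\<^sup>2 \<le> (c, 0) \<bullet> y + \<rho> / 2 * (norm (?\<Lambda> y))\<^sup>2"
      if "y \<in> feasible Q F \<times> L" for y using min[OF that] unfolding \<Phi> .
  next
    fix C \<theta> :: real
    assume "0 \<le> C" "0 < \<theta>" "\<theta> \<le> 1 / 2" and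
      "\<And>x d. x \<in> feasible Q F \<times> L \<Longrightarrow> norm x \<le> r \<Longrightarrow>
        (\<And>y. y \<in> feasible Q F \<times> L \<Longrightarrow> (c, 0) \<bullet> x + \<rho> / 2 * (norm (?\<Lambda> x))\<^sup>2 + d \<bullet> (y - x) \<le> (c, 0) \<bullet> y + \<rho> / 2 * (norm (?\<Lambda> y))\<^sup>2) \<Longrightarrow>
        (c, 0) \<bullet> x + \<rho> / 2 * (norm (?\<Lambda> x))\<^sup>2 - ((c, 0) \<bullet> x0 + \<rho> / 2 * (norm (?\<Lambda> x0))\<^sup>2) \<le>
        C * norm d * ((c, 0) \<bullet> x + \<rho> / 2 * (norm (?\<Lambda> x))\<^sup>2 - ((c, 0) \<bullet> x0 + \<rho> / 2 * (norm (?\<Lambda> x0))\<^sup>2)) powr \<theta>"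
    then show ?thesis unfolding \<Phi> by (intro exI[of _ C] exI[of _ \<theta>] conjI ballI impI allI) blast+
  qed
qed

section \<open>Linear growth of the objective on the positive semidefinite cone\<close>

lemma sum_UNIV_sum:
  "(\<Sum>k\<in>(UNIV :: ('a::finite + 'b::finite) set). f k) = (\<Sum>a\<in>UNIV. f (Inl a)) + (\<Sum>b\<in>UNIV. f (Inr b))"
  using sum.Plus[of UNIV UNIV f] by (simp add: o_def)

lemma mat_R_gram:
  fixes C :: "real^'n^'q" and D :: "real^'m^'q"
  shows "mat_R C D = transpose (four_block C 0 0 D) ** four_block C 0 0 D"
proof -
  have "mat_R C D $ i $ j = (transpose (four_block C 0 0 D) ** four_block C 0 0 D) $ i $ j" for i j
    by (cases i; cases j) (simp_all add: mat_R_def four_block_def hcat_def vcat_def transpose_def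
        matrix_matrix_mult_def sum_UNIV_sum)
  then show ?thesis by (simp add: vec_eq_iff)
qed

lemma four_block_diag_injective:
  fixes C :: "real^'n^'q" and D :: "real^'m^'q"
  assumes "posdef (transpose C ** C)" "posdef (transpose D ** D)"
    and y: "four_block C 0 0 D *v y = 0"
  shows "y = 0"
proof -
  define y1 where "y1 = (\<chi> a. y $ Inl a)"
  define y2 where "y2 = (\<chi> b. y $ Inr b)"
  have "(C *v y1) $ k = (four_block C 0 0 D *v y) $ Inl k" for k
    by (simp add: four_block_def hcat_def vcat_def matrix_vector_mult_def sum_UNIV_sum y1_def)
  then have 1: "C *v y1 = 0" by (simp add: y vec_eq_iff)
  have "(D *v y2) $ k = (four_block C 0 0 D *v y) $ Inr k" for k
    by (simp add: four_block_def hcat_def vcat_def matrix_vector_mult_def sum_UNIV_sum y2_def)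
  then have 2: "D *v y2 = 0" by (simp add: y vec_eq_iff)
  have "y1 = 0"
  proof (rule ccontr)
    assume "y1 \<noteq> 0"
    then have "0 < y1 \<bullet> ((transpose C ** C) *v y1)" using assms(1) by (simp add: posdef_def)
    then show False by (simp add: matrix_vector_mul_assoc[symmetric] 1)
  qed
  moreover have "y2 = 0"
  proof (rule ccontr)
    assume "y2 \<noteq> 0"
    then have "0 < y2 \<bullet> ((transpose D ** D) *v y2)" using assms(2) by (simp add: posdef_def)
    then show False by (simp add: matrix_vector_mul_assoc[symmetric] 2)
  qed
  ultimately have "y $ k = 0" for k
    by (cases k) (simp_all add: y1_def y2_def vec_eq_iff)
  then show ?thesis by (simp add: vec_eq_iff)
qed

text \<open>This rewrites the trace pairing with a Gram matrix as a sum of values of the form on the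
  rows of \<open>N\<close>, so that each summand is nonnegative on the cone.\<close>

lemma gram_inner:
  fixes N :: "real^'a^'k"
  shows "vec_of (transpose N ** N) \<bullet> w = (\<Sum>k\<in>UNIV. N $ k \<bullet> (unvec w *v (N $ k)))"
proof -
  have "vec_of (transpose N ** N) \<bullet> w
      = (\<Sum>(i, j)\<in>UNIV \<times> UNIV. (\<Sum>k\<in>UNIV. N $ k $ j * N $ k $ i) * w $ (i, j))"
    unfolding inner_vec_def UNIV_Times_UNIV
    by (rule sum.cong) (auto simp: vec_of_def matrix_matrix_mult_def transpose_def)
  also have "\<dots> = (\<Sum>i\<in>UNIV. \<Sum>j\<in>UNIV. \<Sum>k\<in>UNIV. N $ k $ j * N $ k $ i * w $ (i, j))"
    by (simp only: sum.cartesian_product[symmetric] sum_distrib_right)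
  also have "\<dots> = (\<Sum>i\<in>UNIV. \<Sum>k\<in>UNIV. \<Sum>j\<in>UNIV. N $ k $ j * N $ k $ i * w $ (i, j))"
    by (intro sum.cong refl sum.swap)
  also have "\<dots> = (\<Sum>k\<in>UNIV. \<Sum>i\<in>UNIV. \<Sum>j\<in>UNIV. N $ k $ j * N $ k $ i * w $ (i, j))"
    by (rule sum.swap)
  also have "\<dots> = (\<Sum>k\<in>UNIV. \<Sum>j\<in>UNIV. \<Sum>i\<in>UNIV. N $ k $ j * N $ k $ i * w $ (i, j))"
    by (intro sum.cong refl sum.swap)
  also have "\<dots> = (\<Sum>k\<in>UNIV. N $ k \<bullet> (unvec w *v (N $ k)))"
    by (simp add: inner_vec_def matrix_vector_mult_def unvec_def sum_distrib_left mult_ac)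
  finally show ?thesis .
qed

lemma closed_psd_vecs: "closed (psd_vecs :: (real^('a::finite \<times> 'a)) set)"
proof -
  have eq: "psd_vecs = {w :: real^('a \<times> 'a). transpose (unvec w) = unvec w} \<inter> (\<Inter>x. {w. 0 \<le> x \<bullet> (unvec w *v x)})"
    by (auto simp: psd_vecs_def psd_def) (metis vec_of_unvec)
  have "closed {w :: real^('a \<times> 'a). 0 \<le> x \<bullet> (unvec w *v x)}" for x
  proof -
    have "linear (\<lambda>w :: real^('a \<times> 'a). unvec w *v x)"
      by (intro linearI) (simp_all add: linear_add[OF linear_unvec] linear_scale[OF linear_unvec]
          matrix_vector_mult_add_rdistrib scaleR_matrix_vector_assoc)
    then show ?thesis
      by (intro closed_Collect_le continuous_intros linear_continuous_on) (simp add: linear_conv_bounded_linear)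
  qed
  moreover have "closed {w :: real^('a \<times> 'a). transpose (unvec w) = unvec w}"
    using linear_compose[OF linear_unvec linear_transpose] linear_unvec
    by (intro closed_Collect_eq linear_continuous_on) (simp_all add: o_def linear_conv_bounded_linear)
  ultimately show ?thesis unfolding eq by (intro closed_Int closed_INT ballI)
qed

text \<open>If the pairing vanished at some \<open>w\<close> of the cone, every row of
  \<open>N\<close> would lie in the kernel of \<open>unvec w\<close>; by symmetry \<open>N\<close>
  would annihilate the range of \<open>unvec w\<close>, and injectivity gives \<open>w = 0\<close>.
  Compactness of the unit slice and homogeneity then yield \<open>c0\<close>.\<close>

lemma gram_coercive:
  fixes N :: "real^'a^'k"
  assumes inj: "\<And>y. N *v y = 0 \<Longrightarrow> y = 0"
  obtains c0 where "0 < c0" "\<And>w. w \<in> psd_vecs \<Longrightarrow> c0 * norm w \<le> vec_of (transpose N ** N) \<bullet> w"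
proof -
  let ?r = "vec_of (transpose N ** N)"
  have pos: "0 < ?r \<bullet> w" if w: "w \<in> psd_vecs" "w \<noteq> 0" for w
  proof (rule ccontr)
    assume "\<not> 0 < ?r \<bullet> w"
    have psd: "psd (unvec w)" using w(1) by (auto simp: psd_vecs_def)
    then have nonneg: "0 \<le> x \<bullet> (unvec w *v x)" for x by (simp add: psd_def)
    have sym: "x \<bullet> (unvec w *v y) = (unvec w *v x) \<bullet> y" for x y
      using psd by (intro symmetric_matrix_inner) (simp add: psd_def)
    have "(\<Sum>k\<in>UNIV. N $ k \<bullet> (unvec w *v (N $ k))) = 0"
      using \<open>\<not> 0 < ?r \<bullet> w\<close> nonneg unfolding gram_inner by (smt (verit) sum_nonneg)
    then have zero: "N $ k \<bullet> (unvec w *v (N $ k)) = 0" for k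
      using nonneg by (simp add: sum_nonneg_eq_0_iff)
    have kernel: "unvec w *v (N $ k) = 0" for k
    proof -
      have "(norm (unvec w *v (N $ k)))\<^sup>2 \<le> onorm ((*v) (unvec w)) * (N $ k \<bullet> (unvec w *v (N $ k)))"
        by (rule psd_form_norm_le[OF matrix_vector_mul_linear sym nonneg onorm[OF matrix_vector_mul_bounded_linear]])
      then show ?thesis by (simp add: zero)
    qed
    have "unvec w *v y = 0" for y
    proof (rule inj)
      have "(N *v (unvec w *v y)) $ k = N $ k \<bullet> (unvec w *v y)" for k
        by (simp add: matrix_vector_mult_def inner_vec_def)
      also have "\<dots> k = 0" for k using sym[of "N $ k" y] kernel[of k] by simp
      finally show "N *v (unvec w *v y) = 0" by (simp add: vec_eq_iff)
    qed
    then have "unvec w = 0" by (simp add: matrix_eq)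
    then have "w = 0" by (metis linear_0[OF linear_unvec] vec_of_unvec)
    with w(2) show False by simp
  qed
  define S :: "(real^('a \<times> 'a)) set" where "S = psd_vecs \<inter> sphere 0 1"
  have S: "compact S"
    unfolding S_def by (intro closed_Int_compact closed_psd_vecs) auto
  have "\<exists>c0>0. \<forall>w\<in>S. c0 \<le> ?r \<bullet> w"
  proof (cases "S = {}")
    case False
    have "continuous_on S (\<lambda>w. ?r \<bullet> w)" by (intro continuous_intros)
    from continuous_attains_inf[OF S False this] obtain w0 where "w0 \<in> S" "\<forall>w\<in>S. ?r \<bullet> w0 \<le> ?r \<bullet> w" by blast
    moreover have "0 < ?r \<bullet> w0" using \<open>w0 \<in> S\<close> by (intro pos) (auto simp: S_def)
    ultimately show ?thesis by blast
  qed (auto intro: exI[of _ 1])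
  then obtain c0 where c0: "0 < c0" "\<And>w. w \<in> S \<Longrightarrow> c0 \<le> ?r \<bullet> w" by blast
  have "c0 * norm w \<le> ?r \<bullet> w" if w: "w \<in> psd_vecs" for w
  proof (cases "w = 0")
    case False
    let ?e = "(1 / norm w) *\<^sub>R w"
    have "unvec ?e = (1 / norm w) *\<^sub>R unvec w" by (rule linear_scale[OF linear_unvec])
    moreover have "psd (unvec w)" using w by (auto simp: psd_vecs_def)
    ultimately have "psd (unvec ?e)"
      by (simp add: psd_def linear_scale[OF linear_transpose] scaleR_matrix_vector_assoc[symmetric])
    then have "?e \<in> psd_vecs" unfolding psd_vecs_def by (metis (mono_tags, lifting) mem_Collect_eq vec_of_unvec)
    then have "?e \<in> S" using False by (simp add: S_def)
    from c0(2)[OF this] show ?thesis using False by (simp add: field_simps)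
  qed simp
  then show ?thesis using c0(1) that by blast
qed

section \<open>Optimality conditions and step sizes\<close>

text \<open>Nonemptiness of \<open>K\<close> matters: for an identically infinite \<open>f\<close>
  every point would count as a minimizer. One finite competitor forces the minimizer into
  \<open>K\<close>.\<close>

lemma prox_inverse_optimal:
  fixes h :: "'a::real_normed_vector \<Rightarrow> real"
  assumes b: "0 < b" and K: "K \<noteq> {}" and f: "\<And>y. f y = (if y \<in> K then ereal (h y) else \<infinity>)"
    and y: "y \<in> prox (inverse b) f v"
  shows "y \<in> K" and "\<And>y'. y' \<in> K \<Longrightarrow> h y + b / 2 * (norm (y - v))\<^sup>2 \<le> h y' + b / 2 * (norm (y' - v))\<^sup>2"
proof -
  have b2: "1 / (2 * inverse b) = b / 2" using b by (simp add: field_simps)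
  have le: "f y + ereal (b / 2 * (norm (y - v))\<^sup>2) \<le> f y' + ereal (b / 2 * (norm (y' - v))\<^sup>2)" for y'
    using y unfolding prox_def is_arg_min_def b2 by (auto simp: not_less)
  obtain k where k: "k \<in> K" using K by blast
  show yK: "y \<in> K" using le[of k] k by (auto simp: f split: if_splits)
  show "h y + b / 2 * (norm (y - v))\<^sup>2 \<le> h y' + b / 2 * (norm (y' - v))\<^sup>2" if "y' \<in> K" for y'
    using le[of y'] that yK by (simp add: f)
qed

text \<open>Compare \<open>z\<close> with points on the segment towards \<open>y\<close>: a negative
  directional derivative \<open>m\<close> would beat the quadratic term \<open>q\<close> for short
  steps.\<close>

lemma projection_variational:
  fixes z v r :: "'a::real_inner"
  assumes K: "convex K" "z \<in> K" "y \<in> K" and b: "0 < b"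
    and min: "\<And>y. y \<in> K \<Longrightarrow> r \<bullet> z + b / 2 * (norm (z - v))\<^sup>2 \<le> r \<bullet> y + b / 2 * (norm (y - v))\<^sup>2"
  shows "b * ((v - z) \<bullet> (y - z)) \<le> r \<bullet> (y - z)"
proof (rule ccontr)
  define m where "m = r \<bullet> (y - z) - b * ((v - z) \<bullet> (y - z))"
  define q where "q = b / 2 * (norm (y - z))\<^sup>2"
  assume "\<not> b * ((v - z) \<bullet> (y - z)) \<le> r \<bullet> (y - z)"
  then have neg: "m < 0" by (simp add: m_def)
  have q: "0 \<le> q" using b by (simp add: q_def)
  have ineq: "0 \<le> t * m + t\<^sup>2 * q" if t: "0 \<le> t" "t \<le> 1" for t
  proof -
    have "z + t *\<^sub>R (y - z) = (1 - t) *\<^sub>R z + t *\<^sub>R y" by (simp add: algebra_simps)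
    then have "z + t *\<^sub>R (y - z) \<in> K" using K t by (simp add: convexD_alt)
    from min[OF this] have "0 \<le> t * (r \<bullet> (y - z)) + b / 2 * ((norm (z + t *\<^sub>R (y - z) - v))\<^sup>2 - (norm (z - v))\<^sup>2)"
      by (simp add: inner_add_right algebra_simps)
    also have "(norm (z + t *\<^sub>R (y - z) - v))\<^sup>2 - (norm (z - v))\<^sup>2
        = - 2 * t * ((v - z) \<bullet> (y - z)) + t\<^sup>2 * (norm (y - z))\<^sup>2"
    proof -
      have "z + t *\<^sub>R (y - z) - v = t *\<^sub>R (y - z) - (v - z)" "norm (z - v) = norm (v - z)"
        by (simp_all add: norm_minus_commute)
      then show ?thesis
        by (simp only: power2_norm_eq_inner) (simp add: inner_diff_left inner_diff_right inner_commute power2_eq_square algebra_simps)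
    qed
    finally show ?thesis by (simp add: m_def q_def algebra_simps)
  qed
  define t where "t = min 1 (- m / (2 * q + 1))"
  have t: "0 < t" "t \<le> 1" "t \<le> - m / (2 * q + 1)" using neg q by (auto simp: t_def divide_neg_pos field_simps)
  have "t * q \<le> - m / (2 * q + 1) * q" using t q by (intro mult_right_mono)
  also have "\<dots> \<le> - m / 2" using neg q by (simp add: field_simps)
  also have "\<dots> < - m" using neg by simp
  finally have "t * (m + t * q) < 0" using t by (simp add: mult_pos_neg)
  with ineq[of t] t show False by (simp add: algebra_simps power2_eq_square)
qed

text \<open>Completing the square; the last term does not depend on \<open>y\<close>, so it cancels
  when two candidates are compared.\<close>

lemma forward_step_sq:
  fixes y p G :: "'a::real_inner"
  assumes "0 < \<mu>"
  shows "\<mu> / 2 * (norm (y - (p - inverse \<mu> *\<^sub>R G)))\<^sup>2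
    = G \<bullet> (y - p) + \<mu> / 2 * (norm (y - p))\<^sup>2 + (norm G)\<^sup>2 / (2 * \<mu>)"
proof -
  have "y - (p - inverse \<mu> *\<^sub>R G) = (y - p) + inverse \<mu> *\<^sub>R G" by simp
  then have "(norm (y - (p - inverse \<mu> *\<^sub>R G)))\<^sup>2
      = (norm (y - p))\<^sup>2 + 2 * inverse \<mu> * (G \<bullet> (y - p)) + (inverse \<mu>)\<^sup>2 * (norm G)\<^sup>2"
    by (simp only: power2_norm_eq_inner) (simp add: inner_add_left inner_add_right inner_commute power2_eq_square)
  then show ?thesis using assms by (simp only:) (simp add: field_simps power2_eq_square)
qed

lemma gradient_half_norm_sq:
  fixes L :: "'a::euclidean_space \<Rightarrow> 'b::euclidean_space"
  assumes L: "linear L"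
  shows "gradient (\<lambda>y. \<rho> / 2 * (norm (L y + b))\<^sup>2) x = \<rho> *\<^sub>R adjoint L (L x + b)"
proof (rule gradient_eq)
  have d: "(L has_derivative L) (at x)" by (rule linear_imp_has_derivative[OF L])
  show "GDERIV (\<lambda>y. \<rho> / 2 * (norm (L y + b))\<^sup>2) x :> \<rho> *\<^sub>R adjoint L (L x + b)"
    unfolding gderiv_def power2_norm_eq_inner
    by (rule derivative_eq_intros d refl)+
      (simp add: fun_eq_iff adjoint_works[OF L] inner_commute algebra_simps)
qed

text \<open>With \<open>\<tau>\<close> in place of \<open>\<bar>\<tau> - \<beta>\<bar>\<close> the
  claim is a quadratic inequality in \<open>\<tau>\<close>. Its leading coefficient is
  \<open>12 * \<sigma> / \<beta>\<close>, its discriminant is \<open>\<zeta>\<close>, and the two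
  expressions with \<open>sqrt \<zeta>\<close> are its roots.\<close>

lemma step_size_condition:
  fixes \<kappa>1 \<beta> \<sigma> \<tau> \<zeta> :: real
  assumes \<beta>: "0 < \<beta>" and \<sigma>: "0 < \<sigma>" and \<kappa>1: "0 \<le> \<kappa>1"
    and \<zeta>: "\<zeta> = 1 - 32 * \<kappa>1 / \<beta> - 128 * \<kappa>1\<^sup>2 / \<beta>\<^sup>2 - 24 * \<kappa>1 * \<sigma> / \<beta> - 24 * \<sigma>" "0 < \<zeta>"
    and lo: "max (\<beta> / 2) (\<beta> / (24 * \<sigma>) * (1 - 16 * \<kappa>1 / \<beta> - sqrt \<zeta>)) < \<tau>"
    and hi: "\<tau> < \<beta> / (24 * \<sigma>) * (1 - 16 * \<kappa>1 / \<beta> + sqrt \<zeta>)"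
  shows "12 * \<sigma> * \<bar>\<tau> - \<beta>\<bar>\<^sup>2 / \<beta> + 16 * \<kappa>1 * \<bar>\<tau> - \<beta>\<bar> / \<beta> + 8 * \<kappa>1\<^sup>2 / (\<sigma> * \<beta>) < \<tau> - (\<kappa>1 + \<beta>) / 2"
proof -
  define e where "e = \<beta> / (24 * \<sigma>)"
  define b where "b = 1 - 16 * \<kappa>1 / \<beta>"
  have e: "0 < e" using \<beta> \<sigma> by (simp add: e_def)
  have "e * b - e * sqrt \<zeta> < \<tau>" "\<tau> < e * b + e * sqrt \<zeta>"
    using lo hi unfolding e_def[symmetric] b_def[symmetric] by (simp_all add: algebra_simps)
  then have "\<bar>\<tau> - e * b\<bar> < e * sqrt \<zeta>" by linarith
  then have "(\<tau> - e * b)\<^sup>2 < (e * sqrt \<zeta>)\<^sup>2"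
    using power_strict_mono[of "\<bar>\<tau> - e * b\<bar>" "e * sqrt \<zeta>" 2] by simp
  then have "\<tau>\<^sup>2 - 2 * e * b * \<tau> + e\<^sup>2 * b\<^sup>2 < e\<^sup>2 * \<zeta>"
    using \<zeta>(2) by (simp add: power_mult_distrib power2_diff algebra_simps)
  then have "(12 * \<sigma> / \<beta>) * (\<tau>\<^sup>2 - 2 * e * b * \<tau>) < (12 * \<sigma> / \<beta>) * (e\<^sup>2 * (\<zeta> - b\<^sup>2))"
    using \<beta> \<sigma> by (intro mult_strict_left_mono) (auto simp: algebra_simps)
  moreover have "(12 * \<sigma> / \<beta>) * (\<tau>\<^sup>2 - 2 * e * b * \<tau>) = 12 * \<sigma> * \<tau>\<^sup>2 / \<beta> - \<tau> + 16 * \<kappa>1 * \<tau> / \<beta>"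
    using \<beta> \<sigma> by (simp add: e_def b_def field_simps)
  moreover have "(12 * \<sigma> / \<beta>) * (e\<^sup>2 * (\<zeta> - b\<^sup>2)) = - (8 * \<kappa>1\<^sup>2 / (\<sigma> * \<beta>)) - (\<kappa>1 + \<beta>) / 2"
    using \<beta> \<sigma> unfolding \<zeta>(1) by (simp add: e_def b_def power2_eq_square divide_simps) (simp add: algebra_simps)
  ultimately have main: "12 * \<sigma> * \<tau>\<^sup>2 / \<beta> + 16 * \<kappa>1 * \<tau> / \<beta> + 8 * \<kappa>1\<^sup>2 / (\<sigma> * \<beta>) < \<tau> - (\<kappa>1 + \<beta>) / 2"
    by linarith
  \<comment> \<open>The bound \<open>\<beta> / 2 < \<tau>\<close> enters here and allows
    \<open>\<bar>\<tau> - \<beta>\<bar>\<close> to be replaced by \<open>\<tau>\<close>.\<close>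
  have le: "\<bar>\<tau> - \<beta>\<bar> \<le> \<tau>" using lo \<beta> by (auto simp: abs_le_iff)
  have "12 * \<sigma> * \<bar>\<tau> - \<beta>\<bar>\<^sup>2 / \<beta> \<le> 12 * \<sigma> * \<tau>\<^sup>2 / \<beta>"
    using \<beta> \<sigma> power_mono[OF le, of 2] by (intro divide_right_mono mult_left_mono) auto
  moreover have "16 * \<kappa>1 * \<bar>\<tau> - \<beta>\<bar> / \<beta> \<le> 16 * \<kappa>1 * \<tau> / \<beta>"
    using \<beta> \<kappa>1 le by (intro divide_right_mono mult_left_mono) auto
  ultimately show ?thesis using main by linarith
qed

lemma transpose_mat_Q: "transpose (mat_Q B1 :: real^('n::finite + 'm::finite)^('n + 'm)) = mat_Q B1"
proof -
  have "mat_Q B1 $ j $ i = (mat_Q B1 :: real^('n + 'm)^('n + 'm)) $ i $ j" for i j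
    by (cases i; cases j) (simp_all add: mat_Q_def four_block_def hcat_def vcat_def transpose_def
        matrix_matrix_mult_def mult.commute)
  then show ?thesis by (simp add: transpose_def vec_eq_iff)
qed

lemma mem_psd_vecs [simp]: "w \<in> psd_vecs \<longleftrightarrow> psd (unvec w)"
  by (auto simp: psd_vecs_def intro!: exI[of _ "unvec w"])

lemma obj_f_eq: "obj_f R Q F w = (if w \<in> feasible Q F then ereal (vec_of R \<bullet> w) else \<infinity>)"
proof (cases "\<forall>i. psd (Upsilon Q (F i) (unvec w))")
  case True
  then show ?thesis by (simp add: obj_f_def feasible_def indicator_fun_def)
next
  case False
  then have "(\<Sum>i\<in>UNIV. indicator_fun psd_vecs (vec_of (Upsilon Q (F i) (unvec w)))) = (\<infinity>::ereal)"
    by (auto simp: sum_Pinfty indicator_fun_def)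
  then show ?thesis using False by (auto simp: obj_f_def feasible_def indicator_fun_def)
qed

lemma nonzero_blocks_unvec:
  "nonzero_blocks rb cb (unvec p) = card (active (\<lambda>k. (rb (snd k), cb (fst k))) p)"
proof -
  have "{(i, j). \<exists>a b. rb a = i \<and> cb b = j \<and> unvec p $ a $ b \<noteq> 0} = active (\<lambda>k. (rb (snd k), cb (fst k))) p"
    by (force simp: active_def unvec_def)
  then show ?thesis by (simp add: nonzero_blocks_def)
qed

lemma spectral_norm_bound: "norm (X *v x) \<le> spectral_norm X * norm x"
  unfolding spectral_norm_def by (rule onorm) (rule matrix_vector_mul_bounded_linear)

lemma spectral_norm_nonneg: "0 \<le> spectral_norm X"
  unfolding spectral_norm_def by (rule onorm_pos_le) (rule matrix_vector_mul_bounded_linear)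

lemma adjoint_mult_eq: "adjoint ((*v) X) (Y *v x) = (transpose X ** Y) *v x" for X :: "real^'a^'b"
  by (simp only: adjoint_matrix matrix_vector_mul_assoc)

text \<open>The block \<open>- mat 1\<close> makes the map injective, and in finite dimension
  injectivity gives a positive lower bound.\<close>

lemma coupling_B_bounded_below:
  obtains b0 where "0 < b0"
    "\<And>y :: real^('n::finite \<times> 'm::finite). b0 * norm y \<le>
      norm ((coupling_B :: real^('n \<times> 'm)^((('t::finite \<times> 't) \<times> ('n \<times> 'n)) + ('n \<times> 'm))) *v y)"
proof -
  let ?B = "coupling_B :: real^('n \<times> 'm)^((('t \<times> 't) \<times> ('n \<times> 'n)) + ('n \<times> 'm))"
  have "y = 0" if "?B *v y = 0" for y
  proof -
    have "(?B *v y) $ Inr k = (- mat 1 *v y) $ k" for k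
      by (simp add: coupling_B_def vcat_def matrix_vector_mult_def)
    then have "- mat 1 *v y = 0" using that by (simp add: vec_eq_iff)
    moreover have "- mat 1 *v y = - y"
      using matrix_vector_mult_diff_rdistrib[of 0 "mat 1" y] by simp
    ultimately show "y = 0" by simp
  qed
  then have "inj ((*v) ?B)" using linear_injective_0[OF matrix_vector_mul_linear[of ?B]] by blast
  then show ?thesis
    using linear_inj_bounded_below_pos[OF matrix_vector_mul_linear[of ?B]] that by blast
qed

theorem theorem4:
  fixes A :: "real^'n::{finite,linorder}^'n::_"
    and B2 :: "real^'m::{finite,linorder}^'n::_"
    and B1 :: "real^'l^'n::_"
    and C :: "real^'n::_^'q"
    and D :: "real^'m::_^'q"
    and As :: "'i::finite \<Rightarrow> real^'n::_^'n::_"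
    and B2s :: "'i \<Rightarrow> real^'m::_^'n::_"
    and rb :: "'m \<Rightarrow> 's::{finite,linorder}"
    and cb :: "'n \<Rightarrow> 't::{finite,linorder}"
    and Q R :: "real^('n + 'm)^('n + 'm)"
    and F :: "'i \<Rightarrow> real^('n + 'm)^('n + 'm)"
    and f :: "real^(('n + 'm) \<times> ('n + 'm)) \<Rightarrow> ereal"
    and g :: "real^('n \<times> 'm) \<Rightarrow> ereal"
    and \<A> :: "real^(('n + 'm) \<times> ('n + 'm))^((('t \<times> 't) \<times> ('n \<times> 'n)) + ('n \<times> 'm))"
    and \<B> :: "real^('n \<times> 'm)^((('t \<times> 't) \<times> ('n \<times> 'n)) + ('n \<times> 'm))"
    and H :: "real^(('n + 'm) \<times> ('n + 'm)) \<Rightarrow> real^('n \<times> 'm) \<Rightarrow> real"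
    and \<gamma> \<rho> \<mu> \<beta> \<tau> \<sigma> \<kappa>1 \<kappa>2 \<kappa>3 \<zeta> :: real
    and w z u :: "nat \<Rightarrow> real^(('n + 'm) \<times> ('n + 'm))"
    and p :: "nat \<Rightarrow> real^('n \<times> 'm)"
  assumes rb: "block_partition rb" and cb: "block_partition cb"
    and Q: "Q = mat_Q B1" and R: "R = mat_R C D" and F: "\<And>i. F i = mat_F (As i) (B2s i)"
    and "transpose C ** D = 0" and "posdef (transpose D ** D)" and "posdef (transpose C ** C)"
    and "posdef (B1 ** transpose B1)"
    and "stabilizable A B2" and "\<And>x. Re x = 0 \<Longrightarrow> \<not> unobservable_mode A C x"
    and "mat_F A B2 \<in> convex hull (range F)"
    and "\<exists>W. posdef W \<and> (\<forall>i. posdef (Upsilon Q (F i) W))"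
    and "\<And>W. psd W \<Longrightarrow> (\<And>i. psd (Upsilon Q (F i) W)) \<Longrightarrow> posdef (upper_left W)"
    and "\<gamma> > 0" and "\<rho> > 0"
    and f: "f = obj_f R Q F" and g: "g = obj_g \<gamma> rb cb"
    and \<A>: "\<A> = coupling_A cb" and \<B>: "\<B> = coupling_B" and H: "H = coupling_H \<rho> \<A> \<B>"
    and \<kappa>1: "\<kappa>1 = \<rho> * spectral_norm (transpose \<A> ** \<A>)"
    and \<kappa>2: "\<kappa>2 = \<rho> * spectral_norm (transpose \<B> ** \<B>)"
    and \<kappa>3: "\<kappa>3 = \<rho> * spectral_norm (transpose \<A> ** \<B>)"
    and "0 < \<sigma>" and "\<sigma> < 1 / 24"
    and "\<beta> > 4 * \<kappa>1 / (1 - 24 * \<sigma>) * (4 + 3 * \<sigma> + sqrt (24 - 168 * \<sigma> + 9 * \<sigma>\<^sup>2))"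
    and "4 * \<kappa>1 / (1 - 24 * \<sigma>) * (4 + 3 * \<sigma> + sqrt (24 - 168 * \<sigma> + 9 * \<sigma>\<^sup>2)) > 0"
    and "\<mu> > \<kappa>2 + 16 * \<kappa>3\<^sup>2 / (\<sigma> * \<beta>)" and "\<kappa>2 + 16 * \<kappa>3\<^sup>2 / (\<sigma> * \<beta>) > 0"
    and \<zeta>: "\<zeta> = 1 - 32 * \<kappa>1 / \<beta> - 128 * \<kappa>1\<^sup>2 / \<beta>\<^sup>2 - 24 * \<kappa>1 * \<sigma> / \<beta> - 24 * \<sigma>" and "\<zeta> > 0"
    and "max (\<beta> / 2) (\<beta> / (24 * \<sigma>) * (1 - 16 * \<kappa>1 / \<beta> - sqrt \<zeta>)) < \<tau>"
    and "\<tau> < \<beta> / (24 * \<sigma>) * (1 - 16 * \<kappa>1 / \<beta> + sqrt \<zeta>)"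
    and "\<And>k. p (Suc k) \<in> prox (inverse \<mu>) g (p k - inverse \<mu> *\<^sub>R gradient (\<lambda>y. H (w k) y) (p k))"
    and "\<And>k. z (Suc k) \<in> prox (inverse \<beta>) f (w k + inverse \<beta> *\<^sub>R u k)"
    and "\<And>k. w (Suc k) = w k - inverse \<tau> *\<^sub>R
               (gradient (\<lambda>y. H y (p (Suc k))) (w k) + u k + \<beta> *\<^sub>R (w k - z (Suc k)))"
    and "\<And>k. u (Suc k) = u k + (\<sigma> * \<beta>) *\<^sub>R (w (Suc k) - z (Suc k))"
  shows "summable (\<lambda>k. norm (w (Suc k) - w k)) \<and> summable (\<lambda>k. norm (p (Suc k) - p k)) \<and>
         summable (\<lambda>k. norm (z (Suc k) - z k)) \<and> summable (\<lambda>k. norm (u (Suc k) - u k)) \<and>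
         (\<exists>w' p' z' u'. w \<longlonglongrightarrow> w' \<and> p \<longlonglongrightarrow> p' \<and> z \<longlonglongrightarrow> z' \<and> u \<longlonglongrightarrow> u' \<and>
            0 = u' + \<rho> *\<^sub>R (transpose \<A> *v (\<A> *v w' + \<B> *v p')) \<and>
            0 \<in> (\<lambda>v. v + \<rho> *\<^sub>R (transpose \<B> *v (\<A> *v w' + \<B> *v p'))) ` limiting_subdiff g p' \<and>
            u' \<in> limiting_subdiff f z' \<and> z' = w')"
proof -
  have Qsym: "transpose Q = Q" unfolding Q by (rule transpose_mat_Q)
  \<comment> \<open>Indices of vectorized matrices are pairs of column and row, hence the exchanged
    projections.\<close>
  define bl where "bl = (\<lambda>k :: 'n \<times> 'm. (rb (snd k), cb (fst k)))"
  define K where "K = feasible Q F"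
  define r where "r = vec_of R"
  define gr where "gr y = \<gamma> * real (card (active bl y))" for y :: "real^('n \<times> 'm)"
  have f_eq: "f y = (if y \<in> K then ereal (r \<bullet> y) else \<infinity>)" for y
    unfolding f K_def r_def by (rule obj_f_eq)
  have g_eq: "g y = ereal (gr y)" for y
    by (simp add: g obj_g_def gr_def bl_def nonzero_blocks_unvec)
  have K_ne: "K \<noteq> {}"
  proof -
    have pd: "psd X" if "posdef X" for X :: "real^'c^'c"
      unfolding psd_def
    proof (intro conjI allI)
      show "transpose X = X" using that by (simp add: posdef_def)
      show "0 \<le> x \<bullet> (X *v x)" for x
        using that unfolding posdef_def by (cases "x = 0") (auto intro: less_imp_le)
    qed
    obtain W where "posdef W" "\<And>i. posdef (Upsilon Q (F i) W)"
      using \<open>\<exists>W. posdef W \<and> (\<forall>i. posdef (Upsilon Q (F i) W))\<close> by blast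
    then have "vec_of W \<in> K" by (simp add: K_def feasible_def pd)
    then show ?thesis by blast
  qed
  have "0 \<le> \<kappa>1" unfolding \<kappa>1 using \<open>\<rho> > 0\<close> by (intro mult_nonneg_nonneg spectral_norm_nonneg) simp
  have "0 < \<beta>" using \<open>4 * \<kappa>1 / (1 - 24 * \<sigma>) * _ > 0\<close> \<open>\<beta> > _\<close> by linarith
  have "0 < \<mu>" using \<open>\<mu> > \<kappa>2 + _\<close> \<open>\<kappa>2 + _ > 0\<close> by linarith
  have \<tau>_gt: "12 * \<sigma> * \<bar>\<tau> - \<beta>\<bar>\<^sup>2 / \<beta> + 16 * \<kappa>1 * \<bar>\<tau> - \<beta>\<bar> / \<beta> + 8 * \<kappa>1\<^sup>2 / (\<sigma> * \<beta>) < \<tau> - (\<kappa>1 + \<beta>) / 2"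
    by (rule step_size_condition) fact+
  have "0 < \<tau>" using \<open>max (\<beta> / 2) _ < \<tau>\<close> \<open>0 < \<beta>\<close> by simp
  obtain c0 where c0: "0 < c0" "\<And>y. y \<in> K \<Longrightarrow> c0 * norm y \<le> r \<bullet> y"
  proof (rule gram_coercive[of "four_block C 0 0 D"])
    show "y = 0" if "four_block C 0 0 D *v y = 0" for y
      by (rule four_block_diag_injective) fact+
    fix c0 :: real
    assume "0 < c0" "\<And>w. w \<in> psd_vecs \<Longrightarrow> c0 * norm w \<le> vec_of (transpose (four_block C 0 0 D) ** four_block C 0 0 D) \<bullet> w"
    then show thesis
      by (intro that[of c0]) (auto simp: r_def R mat_R_gram K_def feasible_def)
  qed
  obtain b0 where b0: "0 < b0" "\<And>y. b0 * norm y \<le> norm (\<B> *v y)"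
    unfolding \<B> using coupling_B_bounded_below by blast
  define GW where "GW x y = \<rho> *\<^sub>R adjoint ((*v) \<A>) (\<A> *v x + \<B> *v y)" for x y
  define GP where "GP x y = \<rho> *\<^sub>R adjoint ((*v) \<B>) (\<A> *v x + \<B> *v y)" for x y
  have gW: "gradient (\<lambda>x. H x y) x = GW x y" for x y
    unfolding H coupling_H_def GW_def by (rule gradient_half_norm_sq[OF matrix_vector_mul_linear])
  have gP: "gradient (\<lambda>y. H x y) y = GP x y" for x y
    unfolding H coupling_H_def GP_def add.commute[of "\<A> *v x"]
    by (rule gradient_half_norm_sq[OF matrix_vector_mul_linear])
  have p_step: "gr (p (Suc k)) + GP (w k) (p k) \<bullet> (p (Suc k) - p k) + \<mu> / 2 * (norm (p (Suc k) - p k))\<^sup>2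
      \<le> gr y + GP (w k) (p k) \<bullet> (y - p k) + \<mu> / 2 * (norm (y - p k))\<^sup>2" for k y
  proof -
    have pr: "p (Suc k) \<in> prox (inverse \<mu>) g (p k - inverse \<mu> *\<^sub>R GP (w k) (p k))"
      using \<open>\<And>k. p (Suc k) \<in> prox _ _ _\<close>[of k] unfolding gP .
    have gU: "g y = (if y \<in> UNIV then ereal (gr y) else \<infinity>)" for y by (simp add: g_eq)
    from prox_inverse_optimal(2)[OF \<open>0 < \<mu>\<close> UNIV_not_empty gU pr UNIV_I, of y]
    show ?thesis unfolding forward_step_sq[OF \<open>0 < \<mu>\<close>] by simp
  qed
  have z_in: "z (Suc k) \<in> K" and z_step: "y \<in> K \<Longrightarrow> (u k + \<beta> *\<^sub>R (w k - z (Suc k))) \<bullet> (y - z (Suc k)) \<le> r \<bullet> (y - z (Suc k))" for k y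
  proof -
    let ?v = "w k + inverse \<beta> *\<^sub>R u k"
    note prox = prox_inverse_optimal[OF \<open>0 < \<beta>\<close> K_ne f_eq \<open>\<And>k. z (Suc k) \<in> prox _ _ _\<close>[of k]]
    show "z (Suc k) \<in> K" by (rule prox(1))
    assume "y \<in> K"
    from projection_variational[OF _ prox(1) this \<open>0 < \<beta>\<close> prox(2)]
    have "\<beta> * ((?v - z (Suc k)) \<bullet> (y - z (Suc k))) \<le> r \<bullet> (y - z (Suc k))"
      unfolding K_def using convex_feasible[OF Qsym] by blast
    moreover have "u k + \<beta> *\<^sub>R (w k - z (Suc k)) = \<beta> *\<^sub>R (?v - z (Suc k))"
      using \<open>0 < \<beta>\<close> by (simp add: algebra_simps)
    ultimately show "(u k + \<beta> *\<^sub>R (w k - z (Suc k))) \<bullet> (y - z (Suc k)) \<le> r \<bullet> (y - z (Suc k))"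
      by simp
  qed
  interpret P: palm "(*v) \<A>" "(*v) \<B>" K r gr \<rho> \<mu> \<beta> \<tau> \<sigma> \<kappa>1 \<kappa>2 \<kappa>3 c0 b0 w z u p
    "\<lambda>x y. \<rho> / 2 * (norm (\<A> *v x + \<B> *v y))\<^sup>2"
    "\<lambda>x y. \<rho> *\<^sub>R adjoint ((*v) \<A>) (\<A> *v x + \<B> *v y)"
    "\<lambda>x y. \<rho> *\<^sub>R adjoint ((*v) \<B>) (\<A> *v x + \<B> *v y)"
  proof (rule palm.intro, unfold GW_def[symmetric] GP_def[symmetric])
    show "\<rho> * norm (adjoint ((*v) \<A>) (\<A> *v x)) \<le> \<kappa>1 * norm x" for x
      unfolding adjoint_mult_eq \<kappa>1 mult.assoc using \<open>\<rho> > 0\<close> by (intro mult_left_mono spectral_norm_bound) auto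
    show "\<rho> * norm (adjoint ((*v) \<B>) (\<B> *v y)) \<le> \<kappa>2 * norm y" for y
      unfolding adjoint_mult_eq \<kappa>2 mult.assoc using \<open>\<rho> > 0\<close> by (intro mult_left_mono spectral_norm_bound) auto
    show "\<rho> * norm (adjoint ((*v) \<A>) (\<B> *v y)) \<le> \<kappa>3 * norm y" for y
      unfolding adjoint_mult_eq \<kappa>3 mult.assoc using \<open>\<rho> > 0\<close> by (intro mult_left_mono spectral_norm_bound) auto
    show "closed K" unfolding K_def by (rule closed_feasible[OF Qsym])
    show "0 \<le> gr y" for y using \<open>\<gamma> > 0\<close> by (simp add: gr_def)
    show "\<tau> *\<^sub>R (w (Suc k) - w k) = - (GW (w k) (p (Suc k)) + u k + \<beta> *\<^sub>R (w k - z (Suc k)))" for k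
      using \<open>\<And>k. w (Suc k) = _\<close>[of k] \<open>0 < \<tau>\<close> unfolding gW by simp
    show "u (Suc k) - u k = (\<sigma> * \<beta>) *\<^sub>R (w (Suc k) - z (Suc k))" for k
      using \<open>\<And>k. u (Suc k) = _\<close>[of k] by simp
    show "\<sigma> < 1" using \<open>\<sigma> < 1 / 24\<close> by simp
  qed (fact matrix_vector_mul_linear \<open>\<rho> > 0\<close> \<open>0 \<le> \<kappa>1\<close> \<open>0 < \<sigma>\<close> \<open>0 < \<beta>\<close> \<open>\<mu> > \<kappa>2 + _\<close> \<tau>_gt c0 b0 p_step z_in z_step)+
  have prox: "block_prox bl \<gamma> \<mu> (p (Suc k)) (p k) (GP (w k) (p k))" for k
    by unfold_locales (use \<open>\<gamma> > 0\<close> \<open>0 < \<mu>\<close> p_step[of k] in \<open>simp_all add: gr_def\<close>)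
  have "(\<lambda>k. norm (p (Suc k) - p k)) \<longlonglongrightarrow> 0"
    by (rule tendsto_sandwich[OF _ _ tendsto_const P.\<delta>_tendsto_0])
      (use P.\<delta>_bounds(2) in \<open>simp_all add: P.dp_def\<close>)
  then have "(\<lambda>k. p (Suc k) - p k) \<longlonglongrightarrow> 0" by (simp add: tendsto_norm_zero_iff)
  from active_eventually_constant[OF prox this] obtain N where
    N: "\<And>k. N \<le> k \<Longrightarrow> active bl (p (Suc k)) = active bl (p (Suc N))" by blast
  \<comment> \<open>From index \<open>Suc N\<close> on all iterates \<open>p k\<close> have support
    \<open>S\<close>, so the method runs inside the subspace \<open>L\<close>, where the count is
    constant.\<close>
  define S where "S = active bl (p (Suc N))"
  define L where "L = {y. active bl y \<subseteq> S}"
  have L: "subspace L" unfolding L_def by (rule subspace_active)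
  have act: "active bl (p k) = S" if "Suc N \<le> k" for k
    using that N[of "k - 1"] by (simp add: S_def)
  have stat: "(GP (w k) (p k) + \<mu> *\<^sub>R P.dp k) \<bullet> v = 0" if "Suc N \<le> k" "v \<in> L" for k v
    unfolding P.dp_def
    by (rule block_prox.stationary[OF prox]) (use that act[of "Suc k"] in \<open>simp add: L_def\<close>)
  have "summable P.\<delta>"
  proof (rule P.finite_length[OF L, of "Suc N" "\<gamma> * real (card S)"], unfold GP_def[symmetric])
    show "p k \<in> L" if "Suc N \<le> k" for k using act[OF that] by (simp add: L_def)
    show "gr (p k) = \<gamma> * real (card S)" if "Suc N \<le> k" for k using act[OF that] by (simp add: gr_def)
    show "(GP (w k) (p k) + \<mu> *\<^sub>R P.dp k) \<bullet> v = 0" if "Suc N \<le> k" "v \<in> L" for k v using that by (rule stat)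
    show "\<exists>C \<theta>. 0 \<le> C \<and> 0 < \<theta> \<and> \<theta> \<le> 1 / 2 \<and> (\<forall>x\<in>K \<times> L. norm x \<le> s \<longrightarrow>
        (\<forall>d. (\<forall>y\<in>K \<times> L. P.F x + d \<bullet> (y - x) \<le> P.F y) \<longrightarrow> P.F x - P.F x0 \<le> C * norm d * (P.F x - P.F x0) powr \<theta>))"
      if "x0 \<in> K \<times> L" "\<And>y. y \<in> K \<times> L \<Longrightarrow> P.F x0 \<le> P.F y" for x0 s
      using that unfolding K_def P.F_def
      by (intro feasible_KL[OF Qsym matrix_vector_mul_linear matrix_vector_mul_linear \<open>\<rho> > 0\<close> L])
  qed
  note conv = P.convergence[OF this, folded GW_def GP_def]
  obtain w' p' u' where lim: "w \<longlonglongrightarrow> w'" "p \<longlonglongrightarrow> p'" "z \<longlonglongrightarrow> w'" "u \<longlonglongrightarrow> u'"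
    and u': "u' = - GW w' p'" and w'K: "w' \<in> K"
    and sub: "\<And>y. y \<in> K \<Longrightarrow> u' \<bullet> (y - w') \<le> r \<bullet> (y - w')"
    and GPlim: "(\<lambda>k. GP (w k) (p k) + \<mu> *\<^sub>R P.dp k) \<longlonglongrightarrow> GP w' p'"
    using conv(5) by blast
  have p'S: "active bl p' = S"
    by (rule active_limit[OF prox act lim(2)]) simp
  have "GP w' p' \<bullet> v = 0" if "v \<in> L" for v
  proof (rule LIMSEQ_unique)
    show "(\<lambda>k. (GP (w k) (p k) + \<mu> *\<^sub>R P.dp k) \<bullet> v) \<longlonglongrightarrow> GP w' p' \<bullet> v"
      by (intro tendsto_inner GPlim tendsto_const)
    show "(\<lambda>k. (GP (w k) (p k) + \<mu> *\<^sub>R P.dp k) \<bullet> v) \<longlonglongrightarrow> 0"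
      by (rule tendsto_eventually) (use stat[OF _ that] in \<open>auto simp: eventually_sequentially\<close>)
  qed
  then have "- GP w' p' \<in> limiting_subdiff (\<lambda>y. ereal (\<gamma> * real (card (active bl y)))) p'"
    by (intro limiting_subdiff_active_card \<open>\<gamma> > 0\<close>) (simp add: p'S L_def)
  moreover have "g = (\<lambda>y. ereal (\<gamma> * real (card (active bl y))))" by (simp add: fun_eq_iff g_eq gr_def)
  ultimately have g_sub: "- GP w' p' \<in> limiting_subdiff g p'" by simp
  have f_sub: "u' \<in> limiting_subdiff f w'"
  proof (rule limiting_subdiff_of_local_support)
    show "f w' = ereal (r \<bullet> w')" using w'K by (simp add: f_eq)
    have "r \<bullet> w' + u' \<bullet> (y - w') \<le> r \<bullet> y" if "y \<in> K" for y
      using sub[OF that] by (simp add: inner_diff_right)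
    then show "\<forall>\<^sub>F y in at w'. f w' + ereal (u' \<bullet> (y - w')) \<le> f y"
      using w'K by (intro always_eventually allI) (simp add: f_eq)
  qed
  have "0 = u' + \<rho> *\<^sub>R (transpose \<A> *v (\<A> *v w' + \<B> *v p'))"
    using u' by (simp only: GW_def adjoint_matrix) simp
  moreover have "0 \<in> (\<lambda>v. v + \<rho> *\<^sub>R (transpose \<B> *v (\<A> *v w' + \<B> *v p'))) ` limiting_subdiff g p'"
    by (rule image_eqI[OF _ g_sub]) (simp only: GP_def adjoint_matrix, simp)
  ultimately show ?thesis using conv(1-4) lim f_sub by blast
qed

end
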